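(* Let $\Phi:(0,\infty)\to\mathbb{R}$ be continuous and convex with $\Phi(1)=0$, and put $\Phi(0)=\lim_{t\downarrow 0}\Phi(t)$, $\Phi^{*}(0)=\lim_{t\to\infty}\Phi(t)/t$. Let $N:[0,\infty]\to[0,1]$ be continuous and strictly increasing with $N(0)=0$ and $N(\infty)=1$. For random vectors $\mathbf{X}=(\mathbf{X}_1,\dots,\mathbf{X}_k)$ with continuous univariate marginals and an absolutely continuous copula, with copula density $c$ and with $c_i$ the copula density of $\mathbf{X}_i$, let $$\mathcal{D}_\Phi(\mathbf{X}_1,\dots,\mathbf{X}_k)=\int_{[0,1]^q}\prod_{i=1}^k c_i(\mathbf{u}_i)\,\Phi\left(\frac{c(\mathbf{u})}{\prod_{i=1}^k c_i(\mathbf{u}_i)}\right)d\mathbf{u},$$ and define the normalized measure $\mathcal{D}=N_\Phi\circ\mathcal{D}_\Phi$ by $$N_\Phi\circ\mathcal{D}_\Phi=\begin{cases}\mathcal{D}_\Phi/(\Phi(0)+\Phi^{*}(0)) & \text{if } \Phi(0)+\Phi^{*}(0)<\infty,\\ N(\mathcal{D}_\Phi) & \text{if } \Phi(0)+\Phi^{*}(0)=\infty.\end{cases}$$ Then the following hold (for all random vectors with continuous univariate marginals and an absolutely continuous copula). (A1) For every permutation $\pi$ of $\mathbf{X}_1,\dots,\mathbf{X}_k$, $\mathcal{D}(\mathbf{X})=\mathcal{D}(\pi(\mathbf{X}))$; and for every $i\in\{1,\dots,k\}$ and every permutation $\pi_i$ of the components $X_{i1},\dots,X_{id_i}$ of $\mathbf{X}_i$,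 $\mathcal{D}(\mathbf{X})=\mathcal{D}(\mathbf{X}_1,\dots,\pi_i(\mathbf{X}_i),\dots,\mathbf{X}_k)$. (A2) $0\le\mathcal{D}(\mathbf{X})\le 1$. (A5) $\mathcal{D}(\mathbf{X})$ is well defined for any such $q$-dimensional random vector $\mathbf{X}$ and is a functional of solely the copula $C$ of $\mathbf{X}$. (A6) If $T_{ij}$, for $i=1,\dots,k$ and $j=1,\dots,d_i$, are strictly increasing continuous transformations and $T_i(\mathbf{X}_i)=(T_{i1}(X_{i1}),\dots,T_{id_i}(X_{id_i}))$, then $\mathcal{D}(T_1(\mathbf{X}_1),\dots,T_k(\mathbf{X}_k))=\mathcal{D}(\mathbf{X}_1,\dots,\mathbf{X}_k)$. (A7) If, for a fixed $i\in\{1,\dots,k\}$ and a fixed $j\in\{1,\dots,d_i\}$, $T_{ij}$ is a strictly decreasing continuous transformation and $T_i(\mathbf{X}_i)=(X_{i1},\dots,T_{ij}(X_{ij}),\dots,X_{id_i})$, then $\mathcal{D}(\mathbf{X}_1,\dots,T_i(\mathbf{X}_i),\dots,\mathbf{X}_k)=\mathcal{D}(\mathbf{X}_1,\dots,\mathbf{X}_k)$. (A3) If $\Phi$ is strictly convex at $1$, then $\mathcal{D}(\mathbf{X})=0$ if and only if $\mathbf{X}_1,\dots,\mathbf{X}_k$ are mutually independent. (A4) If $\Phi$ is strictly convex on $(0,\infty)$, then for every further random vector $\mathbf{X}_{k+1}$, $\mathcal{D}(\mathbf{X}_1,\dots,\mathbf{X}_k,\mathbf{X}_{k+1})\ge\mathcal{D}(\mathbf{X}_1,\dots,\mathbf{X}_k)$,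 with equality if and only if $\mathbf{X}_{k+1}$ is independent of $(\mathbf{X}_1,\dots,\mathbf{X}_k)$. (A8, density version) Let $(\mathbf{X}_n)_{n\in\mathbb{N}}$ be a sequence of $q$-dimensional random vectors with copula densities $(c_n)_{n\in\mathbb{N}}$, and let $\mathbf{X}$ have copula density $c$ satisfying $0<m\le c(\mathbf{u})\le M<\infty$ for all $\mathbf{u}\in[0,1]^q$, for some constants $m,M>0$. If $c_n\to c$ uniformly on $[0,1]^q$, then $\lim_{n\to\infty}\mathcal{D}(\mathbf{X}_n)=\mathcal{D}(\mathbf{X})$.
   Context: Setting: $\mathbf{X}=(\mathbf{X}_1,\dots,\mathbf{X}_k)$ is a $q$-dimensional random vector composed of $k$ random vectors $\mathbf{X}_i=(X_{i1},\dots,X_{id_i})$, $q=d_1+\cdots+d_k$, all univariate components $X_{ij}$ having continuous cdf's $F_{ij}$. By Sklar's theorem $\mathbf{X}$ has a unique copula $C$ (the cdf of $(F_{11}(X_{11}),\dots,F_{kd_k}(X_{kd_k}))$) and each $\mathbf{X}_i$ a unique copula $C_i$. The probability measure on $[0,1]^q$ induced by $C$ is assumed absolutely continuous with respect to Lebesgue measure; $c$ and $c_i$ denote the densities of $C$ and $C_i$, and $\mathbf{u}=(\mathbf{u}_1,\dots,\mathbf{u}_k)$ with $\mathbf{u}_i=(u_{i1},\dots,u_{id_i})\in[0,1]^{d_i}$. The integral defining $\mathcal{D}_\Phi$ is the integral of $\Phi\big(c/\prod_i c_i\big)$ with respect to the probability measure with density $\prod_i c_i(\mathbf{u}_i)$,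 with $\Phi(0)$ (possibly $+\infty$) used where the ratio is $0$ and the convention $0\cdot\infty=0$; $\mathcal{D}_\Phi$ takes values in $[0,\infty]$. In (A4), the vector $(\mathbf{X}_1,\dots,\mathbf{X}_{k+1})$ also has continuous marginals and an absolutely continuous copula, and $\mathcal{D}$ is the analogous quantity for $k+1$ random vectors. Strict convexity at $1$: $\Phi$ is strictly convex at $1$ if it is convex and not locally linear at $1$, i.e. there is no neighbourhood of $1$ on which $\Phi$ is affine. The normalization by $\Phi(0)+\Phi^{*}(0)$ presupposes that this number is nonzero.
   Formalization: In (A4), "equality implies independence" is claimed only if Φ(0)+Φ*(0)<∞ or D_Φ(X_1,…,X_k)<∞; otherwise both sides equal N(∞)=1 even for dependent X_{k+1} (e.g. Φ(t)=t log t with infinite mutual information), so the unrestricted claim is false. *)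

theory Defs
  imports "HOL-Probability.Probability"
begin

(* Blocks and components are numbered from 0: component j of block i carries the index (i, j). *)
definition block :: "(nat \<Rightarrow> nat) \<Rightarrow> nat \<Rightarrow> (nat \<times> nat) set" where
  "block d i = {i} \<times> {..<d i}"

definition comps :: "nat \<Rightarrow> (nat \<Rightarrow> nat) \<Rightarrow> (nat \<times> nat) set" where
  "comps k d = (SIGMA i:{..<k}. {..<d i})"

definition unit_cube :: "'i set \<Rightarrow> ('i \<Rightarrow> real) measure" where
  "unit_cube I = PiM I (\<lambda>_. restrict_space lborel {0..1})"

definition subvector :: "('i \<Rightarrow> 'w \<Rightarrow> real) \<Rightarrow> 'i set \<Rightarrow> 'w \<Rightarrow> ('i \<Rightarrow> real)" where
  "subvector X J = (\<lambda>\<omega>. \<lambda>p\<in>J. X p \<omega>)"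

definition prob_transform :: "'w measure \<Rightarrow> ('i \<Rightarrow> 'w \<Rightarrow> real) \<Rightarrow> 'i \<Rightarrow> 'w \<Rightarrow> real" where
  "prob_transform M X p \<omega> = cdf (distr M borel (X p)) (X p \<omega>)"

(* With continuous marginals this is the copula of (X p) for p in I, by Sklar's theorem. *)
definition copula ::
    "'w measure \<Rightarrow> 'i set \<Rightarrow> ('i \<Rightarrow> 'w \<Rightarrow> real) \<Rightarrow> ('i \<Rightarrow> real) \<Rightarrow> real" where
  "copula M I X u = measure M {\<omega> \<in> space M. \<forall>p\<in>I. prob_transform M X p \<omega> \<le> u p}"

(* The probability measure on the unit cube whose cdf is copula M I X. *)
definition copula_measure ::
    "'w measure \<Rightarrow> 'i set \<Rightarrow> ('i \<Rightarrow> 'w \<Rightarrow> real) \<Rightarrow> ('i \<Rightarrow> real) measure" where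
  "copula_measure M I X = distr M (unit_cube I) (subvector (prob_transform M X) I)"

definition is_copula_density ::
    "'w measure \<Rightarrow> 'i set \<Rightarrow> ('i \<Rightarrow> 'w \<Rightarrow> real) \<Rightarrow> (('i \<Rightarrow> real) \<Rightarrow> real) \<Rightarrow> bool" where
  "is_copula_density M I X c \<longleftrightarrow>
     c \<in> borel_measurable (unit_cube I) \<and>
     (\<forall>u\<in>space (unit_cube I). 0 \<le> c u) \<and>
     copula_measure M I X = density (unit_cube I) (\<lambda>u. ennreal (c u))"

definition copula_density ::
    "'w measure \<Rightarrow> 'i set \<Rightarrow> ('i \<Rightarrow> 'w \<Rightarrow> real) \<Rightarrow> ('i \<Rightarrow> real) \<Rightarrow> real" where
  "copula_density M I X u = enn2real (RN_deriv (unit_cube I) (copula_measure M I X) u)"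

definition admissible ::
    "'w measure \<Rightarrow> nat \<Rightarrow> (nat \<Rightarrow> nat) \<Rightarrow> (nat \<times> nat \<Rightarrow> 'w \<Rightarrow> real) \<Rightarrow> bool" where
  "admissible M k d X \<longleftrightarrow>
     prob_space M \<and> 1 \<le> k \<and> (\<forall>i<k. 1 \<le> d i) \<and>
     (\<forall>p\<in>comps k d. X p \<in> borel_measurable M \<and>
        continuous_on UNIV (cdf (distr M borel (X p)))) \<and>
     absolutely_continuous (unit_cube (comps k d)) (copula_measure M (comps k d) X)"

definition Phi_zero :: "(real \<Rightarrow> real) \<Rightarrow> ereal" where
  "Phi_zero \<Phi> = Lim (at_right 0) (\<lambda>t. ereal (\<Phi> t))"

definition Phi_star_zero :: "(real \<Rightarrow> real) \<Rightarrow> ereal" where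
  "Phi_star_zero \<Phi> = Lim at_top (\<lambda>t. ereal (\<Phi> t / t))"

definition Phi_ext :: "(real \<Rightarrow> real) \<Rightarrow> real \<Rightarrow> ereal" where
  "Phi_ext \<Phi> t = (if t > 0 then ereal (\<Phi> t) else Phi_zero \<Phi>)"

(* e2ennreal maps negative numbers to 0, so the two integrals are those of the positive and
   the negative part of f. *)
definition ext_integral_exists :: "'a measure \<Rightarrow> ('a \<Rightarrow> ereal) \<Rightarrow> bool" where
  "ext_integral_exists \<mu> f \<longleftrightarrow>
     f \<in> borel_measurable \<mu> \<and> (\<integral>\<^sup>+x. e2ennreal (- f x) \<partial>\<mu>) < \<infinity>"

definition ext_integral :: "'a measure \<Rightarrow> ('a \<Rightarrow> ereal) \<Rightarrow> ereal" where
  "ext_integral \<mu> f =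
     enn2ereal (\<integral>\<^sup>+x. e2ennreal (f x) \<partial>\<mu>) - enn2ereal (\<integral>\<^sup>+x. e2ennreal (- f x) \<partial>\<mu>)"

definition prod_density ::
    "nat \<Rightarrow> (nat \<Rightarrow> nat) \<Rightarrow> (nat \<Rightarrow> (nat \<times> nat \<Rightarrow> real) \<Rightarrow> real) \<Rightarrow> (nat \<times> nat \<Rightarrow> real) \<Rightarrow> real" where
  "prod_density k d cs u = (\<Prod>i<k. cs i (restrict u (block d i)))"

(* Integrating against the measure with density prod_density implements the convention
   0 * infinity = 0; where prod_density vanishes the (arbitrary) value of the ratio is irrelevant. *)
definition prod_measure ::
    "nat \<Rightarrow> (nat \<Rightarrow> nat) \<Rightarrow> (nat \<Rightarrow> (nat \<times> nat \<Rightarrow> real) \<Rightarrow> real) \<Rightarrow> (nat \<times> nat \<Rightarrow> real) measure" where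
  "prod_measure k d cs = density (unit_cube (comps k d)) (\<lambda>u. ennreal (prod_density k d cs u))"

definition Phi_ratio ::
    "(real \<Rightarrow> real) \<Rightarrow> nat \<Rightarrow> (nat \<Rightarrow> nat) \<Rightarrow> ((nat \<times> nat \<Rightarrow> real) \<Rightarrow> real) \<Rightarrow>
     (nat \<Rightarrow> (nat \<times> nat \<Rightarrow> real) \<Rightarrow> real) \<Rightarrow> (nat \<times> nat \<Rightarrow> real) \<Rightarrow> ereal" where
  "Phi_ratio \<Phi> k d c cs u = Phi_ext \<Phi> (c u / prod_density k d cs u)"

definition D_Phi ::
    "(real \<Rightarrow> real) \<Rightarrow> 'w measure \<Rightarrow> nat \<Rightarrow> (nat \<Rightarrow> nat) \<Rightarrow> (nat \<times> nat \<Rightarrow> 'w \<Rightarrow> real) \<Rightarrow> ereal" where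
  "D_Phi \<Phi> M k d X =
     (let c = copula_density M (comps k d) X;
          cs = (\<lambda>i. copula_density M (block d i) X)
      in ext_integral (prod_measure k d cs) (Phi_ratio \<Phi> k d c cs))"

definition D_norm ::
    "(real \<Rightarrow> real) \<Rightarrow> (ereal \<Rightarrow> real) \<Rightarrow> 'w measure \<Rightarrow> nat \<Rightarrow> (nat \<Rightarrow> nat) \<Rightarrow>
     (nat \<times> nat \<Rightarrow> 'w \<Rightarrow> real) \<Rightarrow> ereal" where
  "D_norm \<Phi> N M k d X =
     (if Phi_zero \<Phi> + Phi_star_zero \<Phi> < \<infinity>
      then D_Phi \<Phi> M k d X / (Phi_zero \<Phi> + Phi_star_zero \<Phi>)
      else ereal (N (D_Phi \<Phi> M k d X)))"

definition strictly_convex_at_1 :: "(real \<Rightarrow> real) \<Rightarrow> bool" where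
  "strictly_convex_at_1 \<Phi> \<longleftrightarrow>
     convex_on {0<..} \<Phi> \<and> \<not> (\<exists>a b. \<forall>\<^sub>F t in nhds 1. \<Phi> t = a * t + b)"

definition strictly_convex_on :: "real set \<Rightarrow> (real \<Rightarrow> real) \<Rightarrow> bool" where
  "strictly_convex_on S f \<longleftrightarrow> convex S \<and>
     (\<forall>x\<in>S. \<forall>y\<in>S. \<forall>t. x \<noteq> y \<and> 0 < t \<and> t < 1 \<longrightarrow>
        f ((1 - t) * x + t * y) < (1 - t) * f x + t * f y)"

definition permute_blocks ::
    "(nat \<Rightarrow> nat) \<Rightarrow> (nat \<times> nat \<Rightarrow> 'w \<Rightarrow> real) \<Rightarrow> nat \<times> nat \<Rightarrow> 'w \<Rightarrow> real" where
  "permute_blocks \<pi> X = (\<lambda>(i, j). X (\<pi> i, j))"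

definition permute_within ::
    "nat \<Rightarrow> (nat \<Rightarrow> nat) \<Rightarrow> (nat \<times> nat \<Rightarrow> 'w \<Rightarrow> real) \<Rightarrow> nat \<times> nat \<Rightarrow> 'w \<Rightarrow> real" where
  "permute_within i \<sigma> X = (\<lambda>(i', j). if i' = i then X (i, \<sigma> j) else X (i', j))"

definition append_block ::
    "nat \<Rightarrow> (nat \<times> nat \<Rightarrow> 'w \<Rightarrow> real) \<Rightarrow> (nat \<Rightarrow> 'w \<Rightarrow> real) \<Rightarrow> nat \<times> nat \<Rightarrow> 'w \<Rightarrow> real" where
  "append_block k X Y = (\<lambda>(i, j). if i = k then Y j else X (i, j))"

definition mutually_independent ::
    "'w measure \<Rightarrow> nat \<Rightarrow> (nat \<Rightarrow> nat) \<Rightarrow> (nat \<times> nat \<Rightarrow> 'w \<Rightarrow> real) \<Rightarrow> bool" where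
  "mutually_independent M k d X \<longleftrightarrow>
     prob_space.indep_vars M (\<lambda>i. PiM (block d i) (\<lambda>_. borel))
       (\<lambda>i. subvector X (block d i)) {..<k}"

definition last_block_independent ::
    "'w measure \<Rightarrow> nat \<Rightarrow> (nat \<Rightarrow> nat) \<Rightarrow> (nat \<times> nat \<Rightarrow> 'w \<Rightarrow> real) \<Rightarrow> bool" where
  "last_block_independent M k d X \<longleftrightarrow>
     prob_space.indep_var M (PiM (block d k) (\<lambda>_. borel)) (subvector X (block d k))
       (PiM (comps k d) (\<lambda>_. borel)) (subvector X (comps k d))"

end

theory Submission
  imports Defs
begin

text \<open>Let \<open>P\<close> be the copula measure of all components and \<open>Q\<close> the product of the copula
measures of the blocks. The density \<open>c\<close> vanishes almost everywhere where some block density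
\<open>c\<^sub>i\<close> does, because the \<open>c\<^sub>i\<close> are densities of marginals of \<open>P\<close>; hence \<open>P\<close> has the density
\<open>c / \<Prod>\<^sub>i c\<^sub>i\<close> with respect to \<open>Q\<close> (copula_measure_eq_density_ratio) and \<open>D_Phi\<close> is the
\<open>\<Phi>\<close>-divergence of \<open>P\<close> from \<open>Q\<close>. Let \<open>a\<close> be the slope of a supporting line of \<open>\<Phi>\<close> at \<open>1\<close>.
Since \<open>dP/dQ\<close> has \<open>Q\<close>-mean \<open>1\<close>, replacing \<open>\<Phi> t\<close> by \<open>psi t = \<Phi> t - a * (t - 1)\<close> does not change
the integral, and \<open>psi \<ge> 0\<close>. So the integral exists, is nonnegative, does not depend on the
versions of the densities, and equals an ordinary nonnegative integral phi_div
(D_Phi_eq_phi_div). The properties of the measure are properties of this divergence.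

  \<^item> The upper bound holds because \<open>psi t \<le> A + B * t\<close> with \<open>A + B = \<Phi>(0) + \<Phi>*(0)\<close> (psi_le_affine).

  \<^item> Permuting blocks or components and applying monotone functions acts on the cube by permuting
  coordinates and reflecting some of them. Such a map carries \<open>P\<close> and \<open>Q\<close> to the corresponding
  measures of the new vector, and a divergence is invariant under injective maps
  (D_Phi_coordinate_map).

  \<^item> If \<open>\<Phi>\<close> is not affine near \<open>1\<close>, then \<open>psi\<close> vanishes on one side of \<open>1\<close> at most. If the divergence
  is \<open>0\<close>, then \<open>dP/dQ\<close> stays on one side of its mean \<open>1\<close>, so \<open>P = Q\<close> (phi_div_eq_0_iff). That this
  means independence of the random vectors themselves holds because each component is almost
  surely a function of its probability integral transform (mutually_independent_iff).

  \<^item> Adjoining a vector with copula measure \<open>\<nu>\<close> replaces \<open>Q\<close> by \<open>Q \<Otimes> \<nu>\<close>, and the old \<open>dP/dQ\<close> is the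
  \<open>\<nu>\<close>-average of the new one. Monotonicity is Jensen's inequality for each value of the old
  coordinates, and the remainder in Jensen's inequality, which is the mean distance of \<open>\<Phi>\<close> from a
  supporting line, settles equality (phi_div_fst_le, phi_div_fst_eqD, D_Phi_Suc_eqD).

  \<^item> Under uniform convergence to a density with positive lower and finite upper bounds, the
  marginal densities converge too and all the ratios stay in one compact subinterval of \<open>(0, \<infinity>)\<close>,
  where \<open>psi\<close> is bounded and continuous; dominated convergence applies (D_Phi_tendsto_bounded).\<close>

section \<open>Convex functions and their supporting lines\<close>

locale phi_generator =
  fixes \<Phi> :: "real \<Rightarrow> real"
  assumes Phi_cont: "continuous_on {0<..} \<Phi>"
    and Phi_convex: "convex_on {0<..} \<Phi>"
    and Phi_1: "\<Phi> 1 = 0"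
begin

definition supports :: "real \<Rightarrow> real \<Rightarrow> bool" where
  "supports s b \<longleftrightarrow> (\<forall>t>0. \<Phi> s + b * (t - s) \<le> \<Phi> t)"

text \<open>The distance of \<open>\<Phi>\<close> from its tangent with slope \<open>b\<close> at \<open>s\<close>, with the limit \<open>\<Phi>(0)\<close> at \<open>t = 0\<close>. For a
supporting slope the difference is nonnegative, so the passage to \<open>ennreal\<close> cuts nothing off.\<close>
definition gap :: "real \<Rightarrow> real \<Rightarrow> real \<Rightarrow> ennreal" where
  "gap s b t = e2ennreal (Phi_ext \<Phi> t - ereal (\<Phi> s + b * (t - s)))"

definition slope :: real where
  "slope = (SOME a. supports 1 a)"

abbreviation psi :: "real \<Rightarrow> ennreal" where
  "psi \<equiv> gap 1 slope"

lemma supports_exists: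
  assumes "s > 0"
  shows "\<exists>b. supports s b"
proof -
  have "s \<in> interior {0<..}" using assms by (simp add: interior_open)
  from convex_le_Inf_differential[OF Phi_convex this]
  show ?thesis unfolding supports_def by (intro exI) auto
qed

lemma supports_slope: "supports 1 slope"
  unfolding slope_def using supports_exists[of 1] by (auto intro: someI_ex)

lemma gap_pos:
  assumes "t > 0"
  shows "gap s b t = ennreal (\<Phi> t - (\<Phi> s + b * (t - s)))"
  using assms by (simp add: gap_def Phi_ext_def e2ennreal_ereal)

text \<open>A convex function that attains its minimum at \<open>s\<close> decreases to the left of \<open>s\<close>.\<close>
lemma tangent_gap_antimono:
  assumes "supports s b" "0 < t'" "t' \<le> t" "t \<le> s"
  shows "\<Phi> t - (\<Phi> s + b * (t - s)) \<le> \<Phi> t' - (\<Phi> s + b * (t' - s))"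
proof (cases "t' < s")
  case True
  define l where "l = (s - t) / (s - t')"
  have l: "0 \<le> l" "l \<le> 1" using assms True by (auto simp: l_def)
  have t: "t = l * t' + (1 - l) * s"
  proof -
    have "l * (s - t') = s - t" using True by (simp add: l_def)
    then show ?thesis by (simp add: algebra_simps)
  qed
  have conv: "\<Phi> t \<le> l * \<Phi> t' + (1 - l) * \<Phi> s"
    using convex_onD[OF Phi_convex, of "1 - l" t' s] l assms by (simp add: t)
  have ge: "0 \<le> \<Phi> t' - (\<Phi> s + b * (t' - s))"
    using assms(1,2) by (simp add: supports_def)
  have "\<Phi> t - (\<Phi> s + b * (t - s)) \<le> l * (\<Phi> t' - (\<Phi> s + b * (t' - s)))"
  proof -
    have "t - s = l * (t' - s)" by (simp add: t algebra_simps)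
    then have "b * (t - s) = l * (b * (t' - s))" by simp
    with conv show ?thesis by (simp add: algebra_simps)
  qed
  also have "\<dots> \<le> \<Phi> t' - (\<Phi> s + b * (t' - s))"
    using mult_right_mono[OF l(2) ge] by simp
  finally show ?thesis .
next
  case False
  with assms have "t = t'" by simp
  then show ?thesis by simp
qed

text \<open>For a nonnegative convex \<open>f\<close> with \<open>f 1 = 0\<close>, the slope \<open>f t / (t - 1)\<close> of the chord from \<open>1\<close> and the
factor \<open>(t - 1) / t\<close> are both nonnegative and increasing in \<open>t > 1\<close>, hence so is \<open>f t / t\<close>.\<close>
lemma tangent_gap_ratio_mono:
  assumes "1 < t" "t \<le> t'"
  shows "(\<Phi> t - slope * (t - 1)) / t \<le> (\<Phi> t' - slope * (t' - 1)) / t'"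
proof -
  define f where "f t = \<Phi> t - slope * (t - 1)" for t
  have ge: "0 \<le> f t'" using supports_slope assms by (simp add: supports_def f_def Phi_1)
  define l where "l = (t - 1) / (t' - 1)"
  have l: "0 \<le> l" "l \<le> 1" using assms by (auto simp: l_def)
  have t: "t = (1 - l) * 1 + l * t'"
  proof -
    have "l * (t' - 1) = t - 1" using assms by (simp add: l_def)
    then show ?thesis by (simp add: algebra_simps)
  qed
  have conv: "\<Phi> t \<le> (1 - l) * \<Phi> 1 + l * \<Phi> t'"
    using convex_onD[OF Phi_convex, of l 1 t'] l assms by (simp add: t)
  have "t - 1 = l * (t' - 1)" by (simp add: t algebra_simps)
  then have "slope * (t - 1) = l * (slope * (t' - 1))" by simp
  with conv have "f t \<le> l * f t'" by (simp add: f_def Phi_1 algebra_simps)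
  also have "l \<le> t / t'"
    using assms by (simp add: l_def field_simps)
  then have "l * f t' \<le> t / t' * f t'" using ge by (rule mult_right_mono)
  finally show ?thesis using assms by (simp add: f_def field_simps)
qed

text \<open>\<open>Lim\<close> in the definition of \<open>Phi_zero\<close> is meaningful because \<open>\<Phi>\<close> differs by an affine function from
one that is monotone on \<open>(0, 1]\<close>. The analogous lemma for \<open>Phi_star_zero\<close> rests on the monotone
quotient of the preceding lemma.\<close>
lemma Phi_zero_tendsto: "((\<lambda>t. ereal (\<Phi> t)) \<longlongrightarrow> Phi_zero \<Phi>) (at_right 0)"
proof -
  define f where "f t = ereal (\<Phi> t - slope * (t - 1))" for t
  have mono: "f t \<le> f t'" if "0 < t'" "t' \<le> t" "t \<le> 1" for t t'
    using tangent_gap_antimono[OF supports_slope that] by (simp add: f_def Phi_1)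
  have "(f \<longlongrightarrow> (SUP t\<in>{0<..1}. f t)) (at_right 0)"
  proof (rule increasing_tendsto)
    show "\<forall>\<^sub>F t in at_right 0. f t \<le> (SUP t\<in>{0<..1}. f t)"
      by (auto intro!: SUP_upper eventually_at_rightI[of 0 1])
    fix x assume "x < (SUP t\<in>{0<..1}. f t)"
    then obtain t where t: "t \<in> {0<..1}" "x < f t" by (auto simp: less_SUP_iff)
    then show "\<forall>\<^sub>F t in at_right 0. x < f t"
      by (intro eventually_at_rightI[of 0 t]) (auto intro: less_le_trans[OF _ mono])
  qed
  moreover have "((\<lambda>t. ereal (slope * (t - 1))) \<longlongrightarrow> ereal (slope * (0 - 1))) (at_right 0)"
    by (intro tendsto_intros)
  ultimately have "((\<lambda>t. f t + ereal (slope * (t - 1))) \<longlongrightarrow>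
      (SUP t\<in>{0<..1}. f t) + ereal (slope * (0 - 1))) (at_right 0)"
    by (intro tendsto_add_ereal_general) auto
  then have "((\<lambda>t. ereal (\<Phi> t)) \<longlongrightarrow> (SUP t\<in>{0<..1}. f t) + ereal (slope * (0 - 1))) (at_right 0)"
    by (simp add: f_def)
  with tendsto_Lim[OF _ this] show ?thesis by (simp add: Phi_zero_def)
qed

lemma Phi_star_tendsto: "((\<lambda>t. ereal (\<Phi> t / t)) \<longlongrightarrow> Phi_star_zero \<Phi>) at_top"
proof -
  define f where "f t = ereal ((\<Phi> t - slope * (t - 1)) / t)" for t
  have mono: "f t \<le> f t'" if "1 < t" "t \<le> t'" for t t'
    using tangent_gap_ratio_mono[OF that] by (simp add: f_def)
  have "(f \<longlongrightarrow> (SUP t\<in>{1<..}. f t)) at_top"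
  proof (rule increasing_tendsto)
    show "\<forall>\<^sub>F t in at_top. f t \<le> (SUP t\<in>{1<..}. f t)"
      using eventually_gt_at_top[of 1] by eventually_elim (auto intro!: SUP_upper)
    fix x assume "x < (SUP t\<in>{1<..}. f t)"
    then obtain t where t: "t \<in> {1<..}" "x < f t" by (auto simp: less_SUP_iff)
    show "\<forall>\<^sub>F t in at_top. x < f t"
      using eventually_ge_at_top[of t] by eventually_elim (use t in \<open>auto intro: less_le_trans mono\<close>)
  qed
  moreover have "((\<lambda>t::real. slope * (1 - 1 / t)) \<longlongrightarrow> slope * (1 - 0)) at_top"
    by (intro tendsto_intros tendsto_divide_0[OF tendsto_const] filterlim_at_top_imp_at_infinity filterlim_ident)
  ultimately have "((\<lambda>t. f t + ereal (slope * (1 - 1 / t))) \<longlongrightarrow>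
      (SUP t\<in>{1<..}. f t) + ereal (slope * (1 - 0))) at_top"
    by (intro tendsto_add_ereal_general) auto
  then have "((\<lambda>t. ereal (\<Phi> t / t)) \<longlongrightarrow> (SUP t\<in>{1<..}. f t) + ereal (slope * (1 - 0))) at_top"
    by (rule Lim_transform_eventually)
       (use eventually_gt_at_top[of 1] in \<open>eventually_elim, auto simp: f_def field_simps\<close>)
  with tendsto_Lim[OF _ this] show ?thesis by (simp add: Phi_star_zero_def)
qed

lemma supports_Phi_ext:
  assumes "supports s b" "0 \<le> t"
  shows "ereal (\<Phi> s + b * (t - s)) \<le> Phi_ext \<Phi> t"
proof (cases "t > 0")
  case True
  with assms show ?thesis by (simp add: supports_def Phi_ext_def)
next
  case False
  with assms have t: "t = 0" by simp
  have "((\<lambda>t. ereal (\<Phi> s + b * (t - s))) \<longlongrightarrow> ereal (\<Phi> s + b * (0 - s))) (at_right 0)"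
    by (intro tendsto_intros)
  moreover have "\<forall>\<^sub>F t in at_right 0. ereal (\<Phi> s + b * (t - s)) \<le> ereal (\<Phi> t)"
    using assms by (auto simp: supports_def intro!: eventually_at_rightI[of 0 1])
  ultimately have "ereal (\<Phi> s + b * (0 - s)) \<le> Phi_zero \<Phi>"
    by (rule tendsto_le[OF _ Phi_zero_tendsto, rotated]) simp
  with t show ?thesis by (simp add: Phi_ext_def)
qed

lemma gap_antimono:
  assumes "supports s b" "0 \<le> t'" "t' \<le> t" "t \<le> s" "0 < t"
  shows "gap s b t \<le> gap s b t'"
proof (cases "t' > 0")
  case True
  then show ?thesis using assms tangent_gap_antimono[OF assms(1) True assms(3,4)]
    by (auto simp: gap_pos intro: ennreal_leI)
next
  case False
  with assms have t': "t' = 0" by simp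
  have lim: "((\<lambda>r. ereal (\<Phi> r) + ereal (- (\<Phi> s + b * (r - s)))) \<longlongrightarrow>
      Phi_zero \<Phi> + ereal (- (\<Phi> s + b * (0 - s)))) (at_right 0)"
    by (intro tendsto_add_ereal_general Phi_zero_tendsto tendsto_intros) auto
  have "\<forall>\<^sub>F r in at_right 0. ereal (\<Phi> t - (\<Phi> s + b * (t - s))) \<le>
      ereal (\<Phi> r) + ereal (- (\<Phi> s + b * (r - s)))"
  proof (rule eventually_at_rightI[of 0 t])
    fix r assume "r \<in> {0<..<t}"
    with tangent_gap_antimono[OF assms(1), of r t] assms(4)
    show "ereal (\<Phi> t - (\<Phi> s + b * (t - s))) \<le> ereal (\<Phi> r) + ereal (- (\<Phi> s + b * (r - s)))"
      by simp
  qed (use assms in auto)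
  from tendsto_lowerbound[OF lim this]
  have "ereal (\<Phi> t - (\<Phi> s + b * (t - s))) \<le> Phi_zero \<Phi> - ereal (\<Phi> s + b * (0 - s))"
    by (simp add: minus_ereal_def)
  from e2ennreal_mono[OF this] show ?thesis
    using assms(5) by (simp add: gap_def Phi_ext_def t')
qed

lemma psi_mono:
  assumes "1 \<le> t" "t \<le> t'"
  shows "psi t \<le> psi t'"
proof (cases "t = 1")
  case True
  then show ?thesis by (simp add: gap_pos)
next
  case False
  define f where "f t = \<Phi> t - slope * (t - 1)" for t
  have ge: "0 \<le> f t'" using supports_slope assms by (simp add: supports_def f_def Phi_1)
  have "f t / t \<le> f t' / t'"
    using tangent_gap_ratio_mono[of t t'] assms False by (simp add: f_def)
  also have "\<dots> \<le> f t' / t" using ge assms by (simp add: frac_le)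
  finally have "f t \<le> f t'" using assms by (simp add: divide_le_cancel)
  then show ?thesis using assms by (simp add: gap_pos f_def Phi_1 ennreal_leI)
qed

lemma psi_1: "psi 1 = 0"
  by (simp add: gap_pos)

text \<open>If \<open>psi\<close> had zeros on both sides of \<open>1\<close>, then by monotonicity it would vanish between them, and
\<open>\<Phi>\<close> would coincide with its supporting line near \<open>1\<close>.\<close>
lemma psi_eq_0_one_sided:
  assumes "strictly_convex_at_1 \<Phi>"
  shows "(\<forall>t\<ge>0. psi t = 0 \<longrightarrow> 1 \<le> t) \<or> (\<forall>t\<ge>0. psi t = 0 \<longrightarrow> t \<le> 1)"
proof (rule ccontr)
  assume "\<not> ?thesis"
  then obtain t1 t2 where t: "0 \<le> t1" "t1 < 1" "1 < t2" "psi t1 = 0" "psi t2 = 0"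
    by (auto simp: not_le)
  have "\<Phi> r = slope * r + (- slope)" if "r \<in> {t1<..<t2}" for r
  proof -
    have "psi r = 0"
    proof (cases "r \<le> 1")
      case True
      with that t gap_antimono[OF supports_slope, of t1 r] show ?thesis by auto
    next
      case False
      with that t psi_mono[of r t2] show ?thesis by auto
    qed
    then have "\<Phi> r \<le> slope * (r - 1)"
      using that t by (simp add: gap_pos Phi_1 ennreal_eq_0_iff)
    moreover have "slope * (r - 1) \<le> \<Phi> r"
      using that t supports_slope by (simp add: supports_def Phi_1)
    ultimately show ?thesis by (simp add: algebra_simps)
  qed
  moreover have "\<forall>\<^sub>F r in nhds 1. r \<in> {t1<..<t2}"
    using t by (intro eventually_nhds_in_open) auto
  ultimately have "\<forall>\<^sub>F r in nhds 1. \<Phi> r = slope * r + (- slope)"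
    by (auto elim: eventually_mono)
  with assms show False unfolding strictly_convex_at_1_def by blast
qed

text \<open>A second point of contact with the supporting line would force \<open>\<Phi>\<close> below the line at the
midpoint. The point \<open>t = 0\<close> lies outside the domain of strict convexity, but by monotonicity of
the gap, contact there produces contact at \<open>s / 2\<close> as well.\<close>
lemma gap_eq_0_strict:
  assumes "strictly_convex_on {0<..} \<Phi>" "supports s b" "0 < s" "0 \<le> t" "gap s b t = 0"
  shows "t = s"
proof (rule ccontr)
  assume "t \<noteq> s"
  have pos: False if "r > 0" "r \<noteq> s" "gap s b r = 0" for r
  proof -
    have "\<Phi> r \<le> \<Phi> s + b * (r - s)"
      using that by (simp add: gap_pos ennreal_eq_0_iff)
    moreover have "\<Phi> ((1 - 1/2) * s + 1/2 * r) < (1 - 1/2) * \<Phi> s + 1/2 * \<Phi> r"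
      using assms(1,3) that unfolding strictly_convex_on_def
      by (elim conjE ballE[where x = s] ballE[where x = r] allE[where x = "1/2"]) auto
    moreover have "\<Phi> s + b * (((1 - 1/2) * s + 1/2 * r) - s) \<le> \<Phi> ((1 - 1/2) * s + 1/2 * r)"
      by (rule assms(2)[unfolded supports_def, rule_format]) (use assms(3) that(1) in \<open>simp add: field_simps add_pos_pos\<close>)
    ultimately show False by (simp add: algebra_simps)
  qed
  show False
  proof (cases "t > 0")
    case True
    with pos[OF True] \<open>t \<noteq> s\<close> assms show False by auto
  next
    case False
    with assms have "t = 0" by simp
    then have "gap s b (s / 2) \<le> gap s b 0"
      using gap_antimono[OF assms(2), of 0 "s / 2"] assms by auto
    with pos[of "s / 2"] assms \<open>t = 0\<close> show False by auto
  qed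
qed

lemma Phi_ext_measurable [measurable]: "Phi_ext \<Phi> \<in> borel_measurable borel"
proof -
  have [measurable]: "(\<lambda>t. indicator {0<..} t *\<^sub>R \<Phi> t) \<in> borel_measurable borel"
    by (intro borel_measurable_continuous_on_indicator Phi_cont) auto
  have "Phi_ext \<Phi> = (\<lambda>t. if t > 0 then ereal (indicator {0<..} t *\<^sub>R \<Phi> t) else Phi_zero \<Phi>)"
    by (auto simp: Phi_ext_def fun_eq_iff)
  also have "\<dots> \<in> borel_measurable borel" by measurable
  finally show ?thesis .
qed

lemma gap_measurable [measurable]: "gap s b \<in> borel_measurable borel"
  unfolding gap_def[abs_def] by measurable

lemma Phi_ext_cases:
  assumes "0 \<le> t"
  obtains "Phi_ext \<Phi> t = \<infinity>" | r where "Phi_ext \<Phi> t = ereal r"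
  using supports_Phi_ext[OF supports_slope assms] by (cases "Phi_ext \<Phi> t") auto

text \<open>The identity \<open>psi t = gap s b t + psi s + (b - slope) * (t - s)\<close>, with \<open>b - slope\<close> split into its
positive part \<open>p\<close> and negative part \<open>n\<close> and the terms moved so that only nonnegative quantities are
added. In this form it makes sense for infinite \<open>\<Phi>(0)\<close> and can be integrated term by term.\<close>
lemma psi_tangent_decomposition:
  assumes sup: "supports s b" and s: "0 < s" and t: "0 \<le> t"
    and p: "0 \<le> p" and n: "0 \<le> n" and pn: "b = slope + p - n"
  shows "psi t + ennreal n * ennreal t + ennreal (p * s) =
    gap s b t + psi s + ennreal p * ennreal t + ennreal (n * s)"
proof (cases rule: Phi_ext_cases[OF t])
  case 1
  then show ?thesis by (simp add: gap_def)
next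
  case (2 r)
  have 1: "0 \<le> r - slope * (t - 1)" "0 \<le> r - (\<Phi> s + b * (t - s))"
    using supports_Phi_ext[OF supports_slope t] supports_Phi_ext[OF sup t] 2 by (auto simp: Phi_1)
  have 3: "0 \<le> \<Phi> s - slope * (s - 1)" using supports_slope s by (simp add: supports_def Phi_1)
  have psi_t: "psi t = ennreal (r - slope * (t - 1))" and gap_t: "gap s b t = ennreal (r - (\<Phi> s + b * (t - s)))"
    and psi_s: "psi s = ennreal (\<Phi> s - slope * (s - 1))"
    using 2 s by (simp_all add: gap_def Phi_1 e2ennreal_ereal Phi_ext_def[of _ s])
  have "psi t + ennreal n * ennreal t + ennreal (p * s) = ennreal (r - slope * (t - 1) + n * t + p * s)"
    using 1 n p t s by (simp only: psi_t ennreal_plus ennreal_mult add_nonneg_nonneg mult_nonneg_nonneg less_imp_le)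
  also have "r - slope * (t - 1) + n * t + p * s =
    (r - (\<Phi> s + b * (t - s))) + (\<Phi> s - slope * (s - 1)) + p * t + n * s"
    by (simp add: pn algebra_simps)
  also have "ennreal \<dots> = gap s b t + psi s + ennreal p * ennreal t + ennreal (n * s)"
    using 1 3 n p t s by (simp only: psi_s gap_t ennreal_plus ennreal_mult add_nonneg_nonneg mult_nonneg_nonneg less_imp_le)
  finally show ?thesis .
qed

text \<open>The same rearrangement of \<open>\<Phi> t = psi t + slope * (t - 1)\<close>, with the positive and negative parts of
\<open>\<Phi> t\<close> and of the slope on the appropriate sides.\<close>
lemma Phi_ext_psi_decomposition:
  assumes t: "0 \<le> t" and p: "0 \<le> p" and n: "0 \<le> n" and pn: "slope = p - n"
  shows "e2ennreal (Phi_ext \<Phi> t) + ennreal n * ennreal t + ennreal p =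
    e2ennreal (- Phi_ext \<Phi> t) + psi t + ennreal p * ennreal t + ennreal n"
proof (cases rule: Phi_ext_cases[OF t])
  case 1
  then show ?thesis by (simp add: gap_def)
next
  case (2 r)
  have 1: "0 \<le> r - slope * (t - 1)"
    using supports_Phi_ext[OF supports_slope t] 2 by (auto simp: Phi_1)
  define r1 r2 where "r1 = max 0 r" and "r2 = max 0 (- r)"
  have r: "0 \<le> r1" "0 \<le> r2" "r = r1 - r2" by (auto simp: r1_def r2_def)
  have *: "e2ennreal (Phi_ext \<Phi> t) = ennreal r1" "e2ennreal (- Phi_ext \<Phi> t) = ennreal r2"
    by (auto simp: 2 e2ennreal_ereal max_def ennreal_neg r1_def r2_def)
  have psi_t: "psi t = ennreal (r - slope * (t - 1))"
    using 2 by (simp add: gap_def Phi_1 e2ennreal_ereal)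
  have "e2ennreal (Phi_ext \<Phi> t) + ennreal n * ennreal t + ennreal p = ennreal (r1 + n * t + p)"
    using n p t r by (simp only: * ennreal_plus ennreal_mult add_nonneg_nonneg mult_nonneg_nonneg)
  also have "r1 + n * t + p = r2 + (r - slope * (t - 1)) + p * t + n"
    by (simp add: pn r(3) algebra_simps)
  also have "ennreal \<dots> = e2ennreal (- Phi_ext \<Phi> t) + psi t + ennreal p * ennreal t + ennreal n"
    using 1 n p t r(1,2) by (simp only: * psi_t ennreal_plus ennreal_mult add_nonneg_nonneg mult_nonneg_nonneg)
  finally show ?thesis .
qed

lemma Phi_ext_neg_bound:
  assumes "0 \<le> t"
  shows "e2ennreal (- Phi_ext \<Phi> t) \<le> ennreal \<bar>slope\<bar> * ennreal t + ennreal \<bar>slope\<bar>"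
proof (cases rule: Phi_ext_cases[OF assms])
  case 1
  then show ?thesis by (simp add: e2ennreal_neg)
next
  case (2 r)
  have 1: "0 \<le> r - slope * (t - 1)"
    using supports_Phi_ext[OF supports_slope assms(1)] 2 by (auto simp: Phi_1)
  have "- r \<le> (- slope) * t + slope" using 1 by (simp add: algebra_simps)
  also have "\<dots> \<le> \<bar>slope\<bar> * t + \<bar>slope\<bar>"
    using mult_right_mono[OF abs_ge_minus_self assms, of slope] abs_ge_self[of slope] by linarith
  finally show ?thesis
    using 2 assms by (simp add: e2ennreal_ereal ennreal_leI flip: ennreal_plus ennreal_mult)
qed

lemma Phi_zero_ge: "ereal (- slope) \<le> Phi_zero \<Phi>"
  using supports_Phi_ext[OF supports_slope, of 0] by (simp add: Phi_ext_def Phi_1)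

lemma psi_ratio_tendsto:
  "((\<lambda>t. ereal ((\<Phi> t - slope * (t - 1)) / t)) \<longlongrightarrow> Phi_star_zero \<Phi> - ereal slope) at_top"
proof -
  have "((\<lambda>t. ereal (\<Phi> t / t) - ereal (slope * (1 - 1 / t))) \<longlongrightarrow> Phi_star_zero \<Phi> - ereal (slope * (1 - 0))) at_top"
    by (intro tendsto_diff_ereal_general tendsto_intros Phi_star_tendsto
        tendsto_divide_0[OF tendsto_const] filterlim_at_top_imp_at_infinity filterlim_ident) auto
  then have "((\<lambda>t. ereal ((\<Phi> t - slope * (t - 1)) / t)) \<longlongrightarrow> Phi_star_zero \<Phi> - ereal (slope * (1 - 0))) at_top"
    by (rule Lim_transform_eventually)
       (use eventually_gt_at_top[of 1] in \<open>eventually_elim, auto simp: field_simps\<close>)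
  then show ?thesis by simp
qed

lemma Phi_star_ge: "ereal slope \<le> Phi_star_zero \<Phi>"
proof -
  have "\<forall>\<^sub>F t in at_top. 0 \<le> ereal ((\<Phi> t - slope * (t - 1)) / t)"
    using eventually_gt_at_top[of 0]
    by eventually_elim (use supports_slope in \<open>simp add: supports_def Phi_1\<close>)
  from tendsto_lowerbound[OF psi_ratio_tendsto this] show ?thesis
    by (cases "Phi_star_zero \<Phi>") simp_all
qed

lemma Phi_sum_nonneg: "0 \<le> Phi_zero \<Phi> + Phi_star_zero \<Phi>"
  using add_mono[OF Phi_zero_ge Phi_star_ge] by (simp add: zero_ereal_def)

text \<open>To the left of \<open>1\<close> the decreasing function \<open>psi\<close> is bounded by its limit \<open>A = \<Phi>(0) + slope\<close> at \<open>0\<close>; to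
the right the increasing quotient \<open>psi t / t\<close> is bounded by its limit \<open>B = \<Phi>*(0) - slope\<close>. The slope
cancels in \<open>A + B\<close>.\<close>
lemma psi_le_affine:
  assumes fin: "Phi_zero \<Phi> + Phi_star_zero \<Phi> < \<infinity>"
  obtains A B where "0 \<le> A" "0 \<le> B" "ereal (A + B) = Phi_zero \<Phi> + Phi_star_zero \<Phi>"
    "\<And>t. 0 \<le> t \<Longrightarrow> psi t \<le> ennreal A + ennreal B * ennreal t"
proof -
  obtain z where z: "Phi_zero \<Phi> = ereal z"
    using fin Phi_zero_ge Phi_star_ge by (cases "Phi_zero \<Phi>"; cases "Phi_star_zero \<Phi>") auto
  obtain w where w: "Phi_star_zero \<Phi> = ereal w"
    using fin Phi_zero_ge Phi_star_ge by (cases "Phi_zero \<Phi>"; cases "Phi_star_zero \<Phi>") auto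
  have A: "0 \<le> z + slope" and B: "0 \<le> w - slope" using Phi_zero_ge Phi_star_ge by (auto simp: z w)
  have psi0: "psi 0 = ennreal (z + slope)"
    by (simp add: gap_def Phi_ext_def z Phi_1 e2ennreal_ereal)
  have "psi t \<le> ennreal (z + slope) + ennreal (w - slope) * ennreal t" if "0 \<le> t" for t
  proof (cases "t \<le> 1")
    case True
    then have "psi t \<le> psi 0"
      using that gap_antimono[OF supports_slope, of 0 t] by (cases "t = 0") auto
    then show ?thesis unfolding psi0 by (rule order_trans) simp
  next
    case False
    have "\<forall>\<^sub>F r in at_top. ereal ((\<Phi> t - slope * (t - 1)) / t) \<le> ereal ((\<Phi> r - slope * (r - 1)) / r)"
      using eventually_ge_at_top[of t] by eventually_elim (use False tangent_gap_ratio_mono[of t] in auto)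
    from tendsto_lowerbound[OF psi_ratio_tendsto this]
    have "\<Phi> t - slope * (t - 1) \<le> (w - slope) * t" using False by (simp add: w field_simps)
    then have "psi t \<le> ennreal ((w - slope) * t)"
      using False by (simp add: gap_pos Phi_1 ennreal_leI)
    also have "\<dots> = ennreal (w - slope) * ennreal t" using B that by (simp add: ennreal_mult)
    finally show ?thesis by (rule order_trans) simp
  qed
  then show ?thesis using A B by (intro that[of "z + slope" "w - slope"]) (simp_all add: z w)
qed

end

section \<open>Divergence of probability measures\<close>

definition rn_ratio :: "'a measure \<Rightarrow> 'a measure \<Rightarrow> 'a \<Rightarrow> real" where
  "rn_ratio P Q x = enn2real (RN_deriv Q P x)"

lemma rn_ratio_nonneg: "0 \<le> rn_ratio P Q x"
  by (simp add: rn_ratio_def)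

lemma rn_ratio_measurable [measurable]: "rn_ratio P Q \<in> borel_measurable Q"
  unfolding rn_ratio_def[abs_def] by measurable

lemma density_rn_ratio:
  assumes "sigma_finite_measure Q" "finite_measure P" "absolutely_continuous Q P" "sets P = sets Q"
  shows "density Q (\<lambda>x. ennreal (rn_ratio P Q x)) = P"
proof -
  interpret Q: sigma_finite_measure Q by fact
  interpret P: finite_measure P by fact
  have "AE x in Q. RN_deriv Q P x \<noteq> \<infinity>"
    using assms by (intro Q.RN_deriv_finite P.sigma_finite_measure_axioms) auto
  then have "density Q (\<lambda>x. ennreal (rn_ratio P Q x)) = density Q (RN_deriv Q P)"
    by (intro density_cong) (auto simp: rn_ratio_def less_top)
  also have "\<dots> = P" using assms by (intro Q.density_RN_deriv) auto
  finally show ?thesis .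
qed

lemma nn_integral_density_prob:
  assumes "prob_space (density Q f)" "f \<in> borel_measurable Q"
  shows "(\<integral>\<^sup>+x. f x \<partial>Q) = 1"
  using prob_space.emeasure_space_1[OF assms(1)] assms(2)
  by (simp add: emeasure_density cong: nn_integral_cong)

lemma AE_le_of_nn_integral_le:
  assumes "AE x in M. f x \<le> g x" "f \<in> borel_measurable M" "g \<in> borel_measurable M"
    and "(\<integral>\<^sup>+x. g x \<partial>M) \<le> (\<integral>\<^sup>+x. f x \<partial>M)" "(\<integral>\<^sup>+x. f x \<partial>M) \<noteq> \<infinity>"
  shows "AE x in M. g x \<le> f x"
proof (rule ccontr)
  assume "\<not> ?thesis"
  from nn_integral_less[OF assms(2,3,5,1) this] assms(4) show False by simp
qed

lemma density_eq_AE_real: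
  fixes f g :: "'a \<Rightarrow> real"
  assumes "sigma_finite_measure Q" "f \<in> borel_measurable Q" "g \<in> borel_measurable Q"
    and f: "AE x in Q. 0 \<le> f x" and g: "AE x in Q. 0 \<le> g x"
    and eq: "density Q (\<lambda>x. ennreal (f x)) = density Q (\<lambda>x. ennreal (g x))"
  shows "AE x in Q. f x = g x"
proof -
  interpret Q: sigma_finite_measure Q by fact
  have "AE x in Q. ennreal (f x) = ennreal (g x)"
    using assms by (intro Q.density_unique_iff[THEN iffD1]) auto
  with f g show ?thesis by eventually_elim simp
qed

context phi_generator
begin

text \<open>The \<open>\<Phi>\<close>-divergence of \<open>P\<close> from \<open>Q\<close> for \<open>P\<close> absolutely continuous with respect to \<open>Q\<close>. With \<open>psi\<close> in
place of \<open>\<Phi>\<close> the integrand is nonnegative; ext_integral_phi_div shows that this does not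
change the value.\<close>
definition phi_div :: "'a measure \<Rightarrow> 'a measure \<Rightarrow> ennreal" where
  "phi_div P Q = (\<integral>\<^sup>+x. psi (rn_ratio P Q x) \<partial>Q)"

lemma phi_div_density:
  assumes Q: "prob_space Q" and f [measurable]: "f \<in> borel_measurable Q"
    and nonneg: "AE x in Q. 0 \<le> f x" and P: "P = density Q (\<lambda>x. ennreal (f x))" "prob_space P"
  shows "phi_div P Q = (\<integral>\<^sup>+x. psi (f x) \<partial>Q)"
proof -
  interpret Q: prob_space Q by fact
  interpret P: prob_space P by fact
  have "absolutely_continuous Q P" unfolding P(1) by (intro absolutely_continuousI_density) measurable
  then have "density Q (\<lambda>x. ennreal (rn_ratio P Q x)) = density Q (\<lambda>x. ennreal (f x))"
    using P(1) by (subst density_rn_ratio[OF Q.sigma_finite_measure_axioms P.finite_measure_axioms]) auto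
  then have "AE x in Q. rn_ratio P Q x = f x"
    by (intro density_eq_AE_real Q.sigma_finite_measure_axioms nonneg) (auto simp: rn_ratio_nonneg)
  then show ?thesis unfolding phi_div_def by (intro nn_integral_cong_AE) auto
qed

text \<open>The linear term \<open>slope * (t - 1)\<close> that separates \<open>\<Phi>\<close> from \<open>psi\<close> integrates to \<open>0\<close> because \<open>f\<close> has mean
\<open>1\<close>. It also bounds the negative part of \<open>\<Phi>\<close>, which is therefore integrable.\<close>
lemma ext_integral_phi_div:
  fixes f :: "'a \<Rightarrow> real"
  assumes Q: "prob_space Q" and f [measurable]: "f \<in> borel_measurable Q"
    and nonneg: "AE x in Q. 0 \<le> f x" and P: "P = density Q (\<lambda>x. ennreal (f x))" "prob_space P"
  shows "ext_integral_exists Q (\<lambda>x. Phi_ext \<Phi> (f x))"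
    and "ext_integral Q (\<lambda>x. Phi_ext \<Phi> (f x)) = enn2ereal (phi_div P Q)"
proof -
  interpret Q: prob_space Q by fact
  interpret P: prob_space P by fact
  have int_f: "(\<integral>\<^sup>+x. ennreal (f x) \<partial>Q) = 1"
    using P by (intro nn_integral_density_prob) simp_all
  let ?p = "\<integral>\<^sup>+x. e2ennreal (Phi_ext \<Phi> (f x)) \<partial>Q"
  let ?n = "\<integral>\<^sup>+x. e2ennreal (- Phi_ext \<Phi> (f x)) \<partial>Q"
  let ?psi = "\<integral>\<^sup>+x. psi (f x) \<partial>Q"
  define p n where "p = max 0 slope" and "n = max 0 (- slope)"
  have pn: "0 \<le> p" "0 \<le> n" "slope = p - n" by (auto simp: p_def n_def)
  have "?n \<le> (\<integral>\<^sup>+x. ennreal \<bar>slope\<bar> * ennreal (f x) + ennreal \<bar>slope\<bar> \<partial>Q)"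
    using nonneg by (intro nn_integral_mono_AE) (auto intro: Phi_ext_neg_bound)
  also have "\<dots> = ennreal \<bar>slope\<bar> + ennreal \<bar>slope\<bar>"
    by (simp add: nn_integral_add nn_integral_cmult int_f Q.emeasure_space_1)
  also have "\<dots> < \<infinity>" by (simp add: ennreal_add_less_top)
  finally have n_fin: "?n < \<infinity>" .
  then show "ext_integral_exists Q (\<lambda>x. Phi_ext \<Phi> (f x))"
    by (simp add: ext_integral_exists_def)
  \<comment> \<open>The decomposition is integrated term by term; the finite constants cancel afterwards.\<close>
  have "?p + ennreal n * 1 + ennreal p =
      (\<integral>\<^sup>+x. e2ennreal (Phi_ext \<Phi> (f x)) + ennreal n * ennreal (f x) + ennreal p \<partial>Q)"
    by (simp add: nn_integral_add nn_integral_cmult int_f Q.emeasure_space_1)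
  also have "\<dots> = (\<integral>\<^sup>+x. e2ennreal (- Phi_ext \<Phi> (f x)) + psi (f x) + ennreal p * ennreal (f x) + ennreal n \<partial>Q)"
    using nonneg by (intro nn_integral_cong_AE) (auto intro: Phi_ext_psi_decomposition pn)
  also have "\<dots> = ?n + ?psi + ennreal p * 1 + ennreal n"
    by (simp add: nn_integral_add nn_integral_cmult int_f Q.emeasure_space_1)
  finally have "(ennreal n + ennreal p) + ?p = (ennreal n + ennreal p) + (?n + ?psi)"
    by (simp add: ac_simps)
  then have "?p = ?n + ?psi"
    by (subst (asm) ennreal_add_left_cancel) simp
  moreover obtain r where "?n = ennreal r" "0 \<le> r" using n_fin by (cases ?n) auto
  ultimately have "enn2ereal ?p - enn2ereal ?n = enn2ereal ?psi"
    by (cases ?psi) (auto simp: plus_ennreal.rep_eq)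
  then show "ext_integral Q (\<lambda>x. Phi_ext \<Phi> (f x)) = enn2ereal (phi_div P Q)"
    using phi_div_density[OF assms] by (simp add: ext_integral_def)
qed

lemma phi_div_le:
  assumes Q: "prob_space Q" and P: "prob_space P" "sets P = sets Q" "absolutely_continuous Q P"
    and fin: "Phi_zero \<Phi> + Phi_star_zero \<Phi> < \<infinity>"
  shows "enn2ereal (phi_div P Q) \<le> Phi_zero \<Phi> + Phi_star_zero \<Phi>"
proof -
  interpret Q: prob_space Q by fact
  interpret P: prob_space P by fact
  have dens: "density Q (\<lambda>x. ennreal (rn_ratio P Q x)) = P"
    using P by (intro density_rn_ratio Q.sigma_finite_measure_axioms P.finite_measure_axioms)
  have int: "(\<integral>\<^sup>+x. ennreal (rn_ratio P Q x) \<partial>Q) = 1"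
    using P by (intro nn_integral_density_prob) (simp_all add: dens)
  obtain A B where AB: "0 \<le> A" "0 \<le> B" "ereal (A + B) = Phi_zero \<Phi> + Phi_star_zero \<Phi>"
    "\<And>t. 0 \<le> t \<Longrightarrow> psi t \<le> ennreal A + ennreal B * ennreal t"
    using psi_le_affine[OF fin] by blast
  have "phi_div P Q \<le> (\<integral>\<^sup>+x. ennreal A + ennreal B * ennreal (rn_ratio P Q x) \<partial>Q)"
    unfolding phi_div_def by (intro nn_integral_mono AB(4) rn_ratio_nonneg)
  also have "\<dots> = ennreal (A + B)"
    using AB by (simp add: nn_integral_add nn_integral_cmult int Q.emeasure_space_1)
  finally have "enn2ereal (phi_div P Q) \<le> enn2ereal (ennreal (A + B))"
    by (simp add: less_eq_ennreal.rep_eq)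
  with AB show ?thesis by (simp add: enn2ereal_ennreal del: ennreal_plus)
qed

text \<open>A vanishing divergence means that \<open>psi\<close> vanishes at \<open>dP/dQ\<close>, so \<open>dP/dQ \<ge> 1\<close> or \<open>dP/dQ \<le> 1\<close>
throughout; as the mean is \<open>1\<close>, it equals \<open>1\<close> almost everywhere.\<close>
lemma phi_div_eq_0_iff:
  assumes Q: "prob_space Q" and P: "prob_space P" "sets P = sets Q" "absolutely_continuous Q P"
    and strict: "strictly_convex_at_1 \<Phi>"
  shows "phi_div P Q = 0 \<longleftrightarrow> P = Q"
proof
  interpret Q: prob_space Q by fact
  interpret P: prob_space P by fact
  let ?f = "rn_ratio P Q"
  have dens: "density Q (\<lambda>x. ennreal (?f x)) = P"
    using P by (intro density_rn_ratio Q.sigma_finite_measure_axioms P.finite_measure_axioms)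
  have int: "(\<integral>\<^sup>+x. ennreal (?f x) \<partial>Q) = 1"
    using P by (intro nn_integral_density_prob) (simp_all add: dens)
  assume "phi_div P Q = 0"
  then have zero: "AE x in Q. psi (?f x) = 0"
    unfolding phi_div_def by (subst (asm) nn_integral_0_iff_AE) auto
  have "AE x in Q. ennreal (?f x) = 1"
    using psi_eq_0_one_sided[OF strict]
  proof
    assume *: "\<forall>t\<ge>0. psi t = 0 \<longrightarrow> 1 \<le> t"
    have ge: "AE x in Q. 1 \<le> ennreal (?f x)"
      using zero by eventually_elim (use * rn_ratio_nonneg[of P Q] in auto)
    then have "AE x in Q. ennreal (?f x) \<le> 1"
      by (rule AE_le_of_nn_integral_le[where f = "\<lambda>_. 1"]) (simp_all add: int Q.emeasure_space_1)
    with ge show ?thesis by eventually_elim (rule antisym)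
  next
    assume *: "\<forall>t\<ge>0. psi t = 0 \<longrightarrow> t \<le> 1"
    have le: "AE x in Q. ennreal (?f x) \<le> 1"
      using zero by eventually_elim (use * rn_ratio_nonneg[of P Q] in auto)
    then have "AE x in Q. 1 \<le> ennreal (?f x)"
      by (rule AE_le_of_nn_integral_le[where g = "\<lambda>_. 1"]) (simp_all add: int Q.emeasure_space_1)
    with le show ?thesis by eventually_elim (rule antisym)
  qed
  then have "density Q (\<lambda>x. ennreal (?f x)) = density Q (\<lambda>_. 1)"
    by (intro density_cong) auto
  with dens show "P = Q" by (simp add: density_1)
next
  assume "P = Q"
  then have "phi_div P Q = (\<integral>\<^sup>+x. psi 1 \<partial>Q)"
    by (intro phi_div_density Q P) (auto simp: density_1)
  then show "phi_div P Q = 0" by (simp add: psi_1)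
qed

text \<open>If \<open>g\<close> undoes \<open>h\<close> and \<open>f = dP/dQ\<close>, then \<open>f \<circ> g\<close> is the density of the images, and composing with \<open>h\<close>
returns \<open>f\<close>.\<close>
lemma phi_div_distr:
  assumes Q: "prob_space Q" and P: "prob_space P" "sets P = sets Q" "absolutely_continuous Q P"
    and h [measurable]: "h \<in> measurable Q Q'" and g [measurable]: "g \<in> measurable Q' Q"
    and inv: "\<And>x. x \<in> space Q \<Longrightarrow> g (h x) = x"
  shows "phi_div (distr P Q' h) (distr Q Q' h) = phi_div P Q"
proof -
  interpret Q: prob_space Q by fact
  interpret P: prob_space P by fact
  let ?f = "rn_ratio P Q"
  have dens: "density Q (\<lambda>x. ennreal (?f x)) = P"
    using P by (intro density_rn_ratio Q.sigma_finite_measure_axioms P.finite_measure_axioms)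
  have [measurable_cong]: "sets P = sets Q" by fact
  have P': "distr P Q' h = density (distr Q Q' h) (\<lambda>y. ennreal (?f (g y)))"
  proof -
    have "distr P Q' h = distr (density Q (\<lambda>x. ennreal (?f (g (h x))))) Q' h"
      by (subst dens[symmetric]) (intro distr_cong density_cong; simp add: inv)
    also have "\<dots> = density (distr Q Q' h) (\<lambda>y. ennreal (?f (g y)))"
      by (subst density_distr) simp_all
    finally show ?thesis .
  qed
  have "phi_div (distr P Q' h) (distr Q Q' h) = (\<integral>\<^sup>+y. psi (?f (g y)) \<partial>distr Q Q' h)"
    by (intro phi_div_density P' Q.prob_space_distr P.prob_space_distr) (auto simp: rn_ratio_nonneg)
  also have "\<dots> = (\<integral>\<^sup>+x. psi (?f (g (h x))) \<partial>Q)"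
    by (subst nn_integral_distr) simp_all
  also have "\<dots> = phi_div P Q"
    unfolding phi_div_def by (intro nn_integral_cong) (simp add: inv)
  finally show ?thesis .
qed

text \<open>Jensen's inequality with its remainder: in the tangent decomposition the linear term has mean \<open>0\<close>,
so the excess over \<open>psi s\<close> is the mean distance from the supporting line at the mean \<open>s\<close>.\<close>
lemma jensen_gap:
  assumes \<nu>: "prob_space \<nu>" and g [measurable]: "g \<in> borel_measurable \<nu>"
    and nonneg: "\<And>y. 0 \<le> g y" and int: "(\<integral>\<^sup>+y. ennreal (g y) \<partial>\<nu>) = ennreal s" and s: "0 < s"
    and sup: "supports s b"
  shows "(\<integral>\<^sup>+y. psi (g y) \<partial>\<nu>) = (\<integral>\<^sup>+y. gap s b (g y) \<partial>\<nu>) + psi s"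
proof -
  interpret prob_space \<nu> by fact
  define p n where "p = max 0 (b - slope)" and "n = max 0 (slope - b)"
  have pn: "0 \<le> p" "0 \<le> n" "b = slope + p - n" by (auto simp: p_def n_def)
  let ?psi = "\<integral>\<^sup>+y. psi (g y) \<partial>\<nu>" and ?gap = "\<integral>\<^sup>+y. gap s b (g y) \<partial>\<nu>"
  have "?psi + ennreal n * ennreal s + ennreal (p * s) =
      (\<integral>\<^sup>+y. psi (g y) + ennreal n * ennreal (g y) + ennreal (p * s) \<partial>\<nu>)"
    by (simp add: nn_integral_add nn_integral_cmult int emeasure_space_1)
  also have "\<dots> = (\<integral>\<^sup>+y. gap s b (g y) + psi s + ennreal p * ennreal (g y) + ennreal (n * s) \<partial>\<nu>)"
    by (intro nn_integral_cong psi_tangent_decomposition sup s nonneg pn)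
  also have "\<dots> = ?gap + psi s + ennreal p * ennreal s + ennreal (n * s)"
    by (simp add: nn_integral_add nn_integral_cmult int emeasure_space_1)
  finally have "(ennreal (n * s) + ennreal (p * s)) + ?psi = (ennreal (n * s) + ennreal (p * s)) + (?gap + psi s)"
    using pn s by (simp add: ennreal_mult ac_simps)
  then show ?thesis by (subst (asm) ennreal_add_left_cancel) simp
qed

lemma jensen_psi:
  assumes \<nu>: "prob_space \<nu>" and g [measurable]: "g \<in> borel_measurable \<nu>"
    and nonneg: "\<And>y. 0 \<le> g y" and int: "(\<integral>\<^sup>+y. ennreal (g y) \<partial>\<nu>) = ennreal s" and s: "0 \<le> s"
  shows "psi s \<le> (\<integral>\<^sup>+y. psi (g y) \<partial>\<nu>)"
    and "strictly_convex_on {0<..} \<Phi> \<Longrightarrow> psi s < \<infinity> \<Longrightarrow> (\<integral>\<^sup>+y. psi (g y) \<partial>\<nu>) \<le> psi s \<Longrightarrow> AE y in \<nu>. g y = s"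
proof -
  interpret prob_space \<nu> by fact
  have "psi s \<le> (\<integral>\<^sup>+y. psi (g y) \<partial>\<nu>) \<and> (strictly_convex_on {0<..} \<Phi> \<and> psi s < \<infinity> \<and>
      (\<integral>\<^sup>+y. psi (g y) \<partial>\<nu>) \<le> psi s \<longrightarrow> (AE y in \<nu>. g y = s))"
  proof (cases "s = 0")
    case True
    with int have "AE y in \<nu>. ennreal (g y) = 0" by (simp add: nn_integral_0_iff_AE)
    then have "AE y in \<nu>. g y = 0" by eventually_elim (use nonneg in \<open>auto simp: ennreal_eq_0_iff intro: antisym\<close>)
    moreover from this have "(\<integral>\<^sup>+y. psi (g y) \<partial>\<nu>) = (\<integral>\<^sup>+y. psi 0 \<partial>\<nu>)"
      by (intro nn_integral_cong_AE) auto
    ultimately show ?thesis using True by (simp add: emeasure_space_1)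
  next
    case False
    with s have s: "0 < s" by simp
    obtain b where b: "supports s b" using supports_exists[OF s] by blast
    note gap = jensen_gap[OF \<nu> g nonneg int s b]
    have "AE y in \<nu>. g y = s"
      if strict: "strictly_convex_on {0<..} \<Phi>" and fin: "psi s < \<infinity>" and le: "(\<integral>\<^sup>+y. psi (g y) \<partial>\<nu>) \<le> psi s"
    proof -
      have "(\<integral>\<^sup>+y. gap s b (g y) \<partial>\<nu>) + psi s \<le> 0 + psi s" using gap le by simp
      then have "(\<integral>\<^sup>+y. gap s b (g y) \<partial>\<nu>) = 0"
        using fin by (cases "psi s"; cases "\<integral>\<^sup>+y. gap s b (g y) \<partial>\<nu>") (auto simp: top_unique simp flip: ennreal_plus)
      then have "AE y in \<nu>. gap s b (g y) = 0" by (subst (asm) nn_integral_0_iff_AE) auto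
      then show ?thesis
        by eventually_elim (use gap_eq_0_strict[OF strict b s nonneg] in auto)
    qed
    with gap show ?thesis by simp
  qed
  then show "psi s \<le> (\<integral>\<^sup>+y. psi (g y) \<partial>\<nu>)"
    and "strictly_convex_on {0<..} \<Phi> \<Longrightarrow> psi s < \<infinity> \<Longrightarrow> (\<integral>\<^sup>+y. psi (g y) \<partial>\<nu>) \<le> psi s \<Longrightarrow> AE y in \<nu>. g y = s"
    by auto
qed

text \<open>Data processing for the projection of a product measure. If \<open>f = dP/d(Q \<Otimes> \<nu>)\<close>, then the density of the
first marginal of \<open>P\<close> is \<open>x \<mapsto> \<integral>f (x, y) d\<nu>(y)\<close>, and Jensen's inequality applies for every \<open>x\<close>. If both
sides have the same finite value, Jensen's inequality is an equality for almost every \<open>x\<close>; then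
strict convexity makes \<open>f (x, y)\<close> independent of \<open>y\<close>, which says that \<open>P\<close> is a product.\<close>
lemma
  fixes Q :: "'a measure" and \<nu> :: "'b measure" and P :: "('a \<times> 'b) measure"
  assumes Q: "prob_space Q" and \<nu>: "prob_space \<nu>"
    and P: "prob_space P" "sets P = sets (Q \<Otimes>\<^sub>M \<nu>)" "absolutely_continuous (Q \<Otimes>\<^sub>M \<nu>) P"
  shows phi_div_fst_le: "phi_div (distr P Q fst) Q \<le> phi_div P (Q \<Otimes>\<^sub>M \<nu>)"
    and phi_div_fst_eq: "P = distr P Q fst \<Otimes>\<^sub>M \<nu> \<Longrightarrow> phi_div P (Q \<Otimes>\<^sub>M \<nu>) = phi_div (distr P Q fst) Q"
    and phi_div_fst_eqD: "\<lbrakk>strictly_convex_on {0<..} \<Phi>; phi_div (distr P Q fst) Q < \<infinity>;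
      phi_div P (Q \<Otimes>\<^sub>M \<nu>) = phi_div (distr P Q fst) Q\<rbrakk> \<Longrightarrow> P = distr P Q fst \<Otimes>\<^sub>M \<nu>"
proof -
  interpret Q: prob_space Q by fact
  interpret \<nu>: prob_space \<nu> by fact
  interpret P: prob_space P by fact
  interpret QN: pair_prob_space Q \<nu> ..
  have [measurable_cong]: "sets P = sets (Q \<Otimes>\<^sub>M \<nu>)" by fact
  let ?P1 = "distr P Q fst"
  interpret P1: prob_space ?P1 by (rule P.prob_space_distr) measurable
  define f where "f = rn_ratio P (Q \<Otimes>\<^sub>M \<nu>)"
  have f [measurable]: "f \<in> borel_measurable (Q \<Otimes>\<^sub>M \<nu>)" and f_nonneg: "0 \<le> f z" for z
    by (auto simp: f_def rn_ratio_nonneg)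
  have dens: "density (Q \<Otimes>\<^sub>M \<nu>) (\<lambda>z. ennreal (f z)) = P"
    unfolding f_def using P by (intro density_rn_ratio QN.sigma_finite_measure_axioms P.finite_measure_axioms)
  define m where "m x = (\<integral>\<^sup>+y. ennreal (f (x, y)) \<partial>\<nu>)" for x
  \<comment> \<open>The average \<open>m\<close> could be infinite on a null set; \<open>s\<close> is its finite version.\<close>
  define s where "s x = enn2real (m x)" for x
  have m [measurable]: "m \<in> borel_measurable Q" unfolding m_def[abs_def] by measurable
  then have s [measurable]: "s \<in> borel_measurable Q" unfolding s_def[abs_def] by measurable
  have dens_m: "?P1 = density Q m"
  proof (rule measure_eqI)
    fix A assume "A \<in> sets ?P1"
    then have [measurable]: "A \<in> sets Q" by simp
    have "emeasure ?P1 A = emeasure P (A \<times> space \<nu>)"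
      using sets.sets_into_space[OF \<open>A \<in> sets Q\<close>] sets_eq_imp_space_eq[OF P(2)]
      by (subst emeasure_distr) (auto simp: space_pair_measure intro!: arg_cong[where f = "emeasure P"])
    also have "\<dots> = (\<integral>\<^sup>+z. ennreal (f z) * indicator (A \<times> space \<nu>) z \<partial>(Q \<Otimes>\<^sub>M \<nu>))"
      by (subst dens[symmetric]) (simp add: emeasure_density)
    also have "\<dots> = (\<integral>\<^sup>+x. (\<integral>\<^sup>+y. ennreal (f (x, y)) * indicator A x \<partial>\<nu>) \<partial>Q)"
      by (subst \<nu>.nn_integral_fst[symmetric]) (auto intro!: nn_integral_cong simp: indicator_def)
    also have "\<dots> = (\<integral>\<^sup>+x. m x * indicator A x \<partial>Q)"
      by (intro nn_integral_cong) (simp add: m_def nn_integral_multc)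
    finally show "emeasure ?P1 A = emeasure (density Q m) A"
      by (simp add: emeasure_density)
  qed simp
  then have "(\<integral>\<^sup>+x. m x \<partial>Q) = 1"
    using P1.prob_space_axioms by (intro nn_integral_density_prob) simp_all
  then have fin: "AE x in Q. m x \<noteq> \<infinity>" by (intro nn_integral_PInf_AE) auto
  then have ms: "AE x in Q. m x = ennreal (s x)" by eventually_elim (simp add: s_def less_top)
  have dens_s: "?P1 = density Q (\<lambda>x. ennreal (s x))"
    unfolding dens_m by (intro density_cong) (use ms in auto)
  have D1: "phi_div ?P1 Q = (\<integral>\<^sup>+x. psi (s x) \<partial>Q)"
    by (intro phi_div_density Q s dens_s P1.prob_space_axioms) (simp add: s_def)
  have D: "phi_div P (Q \<Otimes>\<^sub>M \<nu>) = (\<integral>\<^sup>+x. (\<integral>\<^sup>+y. psi (f (x, y)) \<partial>\<nu>) \<partial>Q)"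
    unfolding phi_div_def f_def[symmetric] by (subst \<nu>.nn_integral_fst[symmetric]) simp_all
  have jensen: "AE x in Q. psi (s x) \<le> (\<integral>\<^sup>+y. psi (f (x, y)) \<partial>\<nu>)"
    using ms AE_space
  proof eventually_elim
    case (elim x)
    then show ?case
      by (intro jensen_psi(1) \<nu> f_nonneg) (auto simp: m_def s_def)
  qed
  show le: "phi_div ?P1 Q \<le> phi_div P (Q \<Otimes>\<^sub>M \<nu>)"
    unfolding D D1 by (rule nn_integral_mono_AE[OF jensen])
  have prod: "?P1 \<Otimes>\<^sub>M \<nu> = density (Q \<Otimes>\<^sub>M \<nu>) (\<lambda>(x, y). ennreal (s x))"
  proof -
    have "density Q (\<lambda>x. ennreal (s x)) \<Otimes>\<^sub>M density \<nu> (\<lambda>_. 1) =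
        density (Q \<Otimes>\<^sub>M \<nu>) (\<lambda>(x, y). ennreal (s x) * 1)"
      by (intro pair_measure_density)
         (auto simp: density_1 intro: Q.sigma_finite_measure_axioms \<nu>.sigma_finite_measure_axioms)
    then show ?thesis by (simp add: density_1 flip: dens_s)
  qed
  show "phi_div P (Q \<Otimes>\<^sub>M \<nu>) = phi_div ?P1 Q" if eq: "P = ?P1 \<Otimes>\<^sub>M \<nu>"
  proof -
    have "phi_div P (Q \<Otimes>\<^sub>M \<nu>) = (\<integral>\<^sup>+z. psi (s (fst z)) \<partial>(Q \<Otimes>\<^sub>M \<nu>))"
    proof (rule phi_div_density)
      show "P = density (Q \<Otimes>\<^sub>M \<nu>) (\<lambda>z. ennreal (s (fst z)))"
        by (subst eq) (simp add: prod split_beta')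
    qed (auto intro: P QN.prob_space_axioms simp: s_def)
    also have "\<dots> = phi_div ?P1 Q"
      by (subst \<nu>.nn_integral_fst[symmetric]) (simp_all add: D1 \<nu>.emeasure_space_1)
    finally show ?thesis .
  qed
  show "P = ?P1 \<Otimes>\<^sub>M \<nu>" if strict: "strictly_convex_on {0<..} \<Phi>" and fin: "phi_div ?P1 Q < \<infinity>"
    and eq: "phi_div P (Q \<Otimes>\<^sub>M \<nu>) = phi_div ?P1 Q"
  proof -
    have "AE x in Q. (\<integral>\<^sup>+y. psi (f (x, y)) \<partial>\<nu>) \<le> psi (s x)"
      using jensen by (rule AE_le_of_nn_integral_le) (use eq fin in \<open>simp_all add: D D1 less_top\<close>)
    moreover have "AE x in Q. psi (s x) \<noteq> \<infinity>"
      using fin by (intro nn_integral_PInf_AE) (auto simp: D1)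
    ultimately have "AE x in Q. AE y in \<nu>. f (x, y) = s x"
      using ms AE_space
    proof eventually_elim
      case (elim x)
      then show ?case
        by (intro jensen_psi(2) \<nu> f_nonneg strict) (auto simp: m_def s_def less_top)
    qed
    then have "AE z in Q \<Otimes>\<^sub>M \<nu>. f z = s (fst z)"
      by (intro QN.AE_pair_measure) auto
    then have "density (Q \<Otimes>\<^sub>M \<nu>) (\<lambda>z. ennreal (f z)) = density (Q \<Otimes>\<^sub>M \<nu>) (\<lambda>(x, y). ennreal (s x))"
      by (intro density_cong) (auto simp: case_prod_beta)
    with dens show ?thesis by (simp add: prod)
  qed
qed

end

section \<open>The unit cube and its decomposition into blocks\<close>

abbreviation unit_interval :: "real measure" where
  "unit_interval \<equiv> restrict_space lborel {0..1}"

lemma prob_space_unit_interval: "prob_space unit_interval"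
  by (rule prob_space_restrict_space) auto

global_interpretation unit_cubes: product_prob_space "\<lambda>_::'i. unit_interval" I for I :: "'i set"
  by (rule product_prob_spaceI) (rule prob_space_unit_interval)

lemma prob_space_unit_cube: "prob_space (unit_cube I)"
  unfolding unit_cube_def by (intro prob_space_PiM prob_space_unit_interval)

lemma space_unit_cube: "space (unit_cube I) = (\<Pi>\<^sub>E i\<in>I. {0..1})"
  by (simp add: unit_cube_def space_PiM space_restrict_space)

lemma measurable_unit_cubeI:
  assumes "\<And>p. p \<in> I \<Longrightarrow> U p \<in> measurable M unit_interval"
  shows "(\<lambda>\<omega>. \<lambda>p\<in>I. U p \<omega>) \<in> measurable M (unit_cube I)"
  unfolding unit_cube_def by (intro measurable_restrict assms)

lemma measurable_unit_cube_component:
  "p \<in> I \<Longrightarrow> (\<lambda>u. u p) \<in> measurable (unit_cube I) unit_interval"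
  unfolding unit_cube_def by (rule measurable_component_singleton)

lemma measurable_unit_cube_restrict:
  "J \<subseteq> I \<Longrightarrow> (\<lambda>u. restrict u J) \<in> measurable (unit_cube I) (unit_cube J)"
  unfolding unit_cube_def by (rule measurable_restrict_subset)

lemma measurable_unit_cube_merge:
  "merge I J \<in> measurable (unit_cube I \<Otimes>\<^sub>M unit_cube J) (unit_cube (I \<union> J))"
  unfolding unit_cube_def by (rule measurable_merge)

text \<open>The remaining coordinates integrate to \<open>1\<close>, since Lebesgue measure on the unit interval is a
probability measure. This carries absolute continuity of a copula over to its margins.\<close>
lemma distr_unit_cube_restrict:
  assumes "finite J" "J \<subseteq> I"
  shows "distr (unit_cube I) (unit_cube J) (\<lambda>u. restrict u J) = unit_cube J"
  unfolding unit_cube_def by (rule unit_cubes.distr_PiM_restrict_finite[OF assms])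

lemma nn_integral_unit_cube_merge:
  assumes "I \<inter> J = {}" "finite I" "finite J" "f \<in> borel_measurable (unit_cube (I \<union> J))"
  shows "(\<integral>\<^sup>+u. f u \<partial>unit_cube (I \<union> J)) =
    (\<integral>\<^sup>+x. (\<integral>\<^sup>+y. f (merge I J (x, y)) \<partial>unit_cube J) \<partial>unit_cube I)"
  using assms unfolding unit_cube_def by (rule unit_cubes.product_nn_integral_fold)

lemma unit_cube_measure_eqI:
  assumes "finite I" and P: "sets P = sets (unit_cube I)" "prob_space P" and Q: "sets Q = sets (unit_cube I)"
    and eq: "\<And>A. (\<And>p. p \<in> I \<Longrightarrow> A p \<in> sets unit_interval) \<Longrightarrow> emeasure P (PiE I A) = emeasure Q (PiE I A)"
  shows "P = Q"
proof (rule measure_eqI_PiM_finite[OF assms(1) P(1)[unfolded unit_cube_def] Q[unfolded unit_cube_def] eq])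
  interpret P: prob_space P by fact
  have "{0..1} \<in> sets unit_interval" using sets.top[of unit_interval] by (simp add: space_restrict_space)
  then show "range (\<lambda>_::nat. PiE I (\<lambda>_. {0..1})) \<subseteq> prod_algebra I (\<lambda>_. unit_interval)"
    using assms(1) by (auto intro!: prod_algebraI_finite)
  show "(\<Union>i::nat. PiE I (\<lambda>_. {0..1})) = space (PiM I (\<lambda>_. unit_interval))"
    by (simp add: space_PiM space_restrict_space)
  show "emeasure P (PiE I (\<lambda>_. {0..1})) \<noteq> \<infinity>" for i :: nat by simp
qed simp_all

lemma absolutely_continuous_distr:
  assumes ac: "absolutely_continuous L P" and sets: "sets P = sets L" and h: "h \<in> measurable L L'"
    and L': "distr L L' h = L'"
  shows "absolutely_continuous L' (distr P L' h)"
  unfolding absolutely_continuous_def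
proof
  fix N assume N: "N \<in> null_sets L'"
  have h': "h \<in> measurable P L'" using h sets by (simp cong: measurable_cong_sets)
  have sp: "space P = space L" using sets by (rule sets_eq_imp_space_eq)
  have "N \<in> null_sets (distr L L' h)" using N by (simp add: L')
  then have "h -` N \<inter> space L \<in> null_sets L" using h by (simp add: null_sets_distr_iff)
  then have "h -` N \<inter> space L \<in> null_sets P" using ac by (auto simp: absolutely_continuous_def)
  then show "N \<in> null_sets (distr P L' h)" using h' N by (simp add: null_sets_distr_iff sp null_setsD2)
qed

lemma measurable_flip_unit_interval: "(\<lambda>t. 1 - t) \<in> measurable unit_interval unit_interval"
  by (intro measurable_restrict_space2 measurable_restrict_space1) (auto simp: space_restrict_space)

lemma distr_unit_interval_flip: "distr unit_interval unit_interval (\<lambda>t. 1 - t) = unit_interval"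
proof (rule measure_eqI)
  have flip: "distr lborel borel (\<lambda>t::real. 1 - t) = lborel"
    using lborel_real_affine[of "-1" 1] by (simp add: density_1)
  fix A assume "A \<in> sets (distr unit_interval unit_interval (\<lambda>t. 1 - t))"
  then have A: "A \<in> sets borel" "A \<subseteq> {0..1}" by (auto simp: sets_restrict_space)
  have "emeasure (distr unit_interval unit_interval (\<lambda>t. 1 - t)) A =
      emeasure unit_interval ((\<lambda>t. 1 - t) -` A \<inter> {0..1})"
    using A by (subst emeasure_distr[OF measurable_flip_unit_interval]) (auto simp: sets_restrict_space space_restrict_space)
  also have "\<dots> = emeasure lborel ((\<lambda>t. 1 - t) -` A \<inter> {0..1})"
    by (intro emeasure_restrict_space) auto
  also have "(\<lambda>t. 1 - t) -` A \<inter> {0..1} = (\<lambda>t. 1 - t) -` A \<inter> space lborel"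
    using A(2) by (auto simp: subset_eq)
  also have "emeasure lborel \<dots> = emeasure (distr lborel borel (\<lambda>t. 1 - t)) A"
    using A by (intro emeasure_distr[symmetric]) auto
  also have "\<dots> = emeasure unit_interval A"
    unfolding flip using A by (intro emeasure_restrict_space[symmetric]) auto
  finally show "emeasure (distr unit_interval unit_interval (\<lambda>t. 1 - t)) A = emeasure unit_interval A" .
qed simp

abbreviation cube :: "nat \<Rightarrow> (nat \<Rightarrow> nat) \<Rightarrow> (nat \<times> nat \<Rightarrow> real) measure" where
  "cube k d \<equiv> unit_cube (comps k d)"

abbreviation block_cube :: "(nat \<Rightarrow> nat) \<Rightarrow> nat \<Rightarrow> (nat \<times> nat \<Rightarrow> real) measure" where
  "block_cube d i \<equiv> unit_cube (block d i)"

abbreviation joint_copula ::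
    "'w measure \<Rightarrow> nat \<Rightarrow> (nat \<Rightarrow> nat) \<Rightarrow> (nat \<times> nat \<Rightarrow> 'w \<Rightarrow> real) \<Rightarrow> (nat \<times> nat \<Rightarrow> real) measure" where
  "joint_copula M k d X \<equiv> copula_measure M (comps k d) X"

lemma finite_comps [simp]: "finite (comps k d)"
  by (simp add: comps_def)

lemma finite_block [simp]: "finite (block d i)"
  by (simp add: block_def)

lemma comps_Suc: "comps (Suc k) d = comps k d \<union> block d k"
  by (auto simp: comps_def block_def less_Suc_eq)

lemma comps_block_disjoint: "comps k d \<inter> block d k = {}"
  by (auto simp: comps_def block_def)

lemma block_subset_comps: "i < k \<Longrightarrow> block d i \<subseteq> comps k d"
  by (auto simp: comps_def block_def)

lemma comps_eq_Union_block: "comps k d = (\<Union>i<k. block d i)"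
  by (auto simp: comps_def block_def)

text \<open>The blocks occupy disjoint sets of coordinates, so Tonelli's theorem separates one factor after
another.\<close>
lemma nn_integral_unit_cube_prod_blocks:
  assumes "\<And>i. i < k \<Longrightarrow> g i \<in> borel_measurable (block_cube d i)"
  shows "(\<integral>\<^sup>+u. (\<Prod>i<k. g i (restrict u (block d i))) \<partial>cube k d) =
    (\<Prod>i<k. \<integral>\<^sup>+u. g i u \<partial>block_cube d i)"
  using assms
proof (induction k)
  case 0
  then show ?case by (simp add: prob_space.emeasure_space_1[OF prob_space_unit_cube])
next
  case (Suc k)
  have g: "(\<lambda>u. g i (restrict u (block d i))) \<in> borel_measurable (unit_cube I)" if "i < Suc k" "block d i \<subseteq> I" for i I
    using measurable_compose[OF measurable_unit_cube_restrict[OF that(2)] Suc.prems[OF that(1)]] .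
  have "(\<integral>\<^sup>+u. (\<Prod>i<Suc k. g i (restrict u (block d i))) \<partial>cube (Suc k) d) =
    (\<integral>\<^sup>+x. (\<integral>\<^sup>+y. (\<Prod>i<Suc k. g i (restrict (merge (comps k d) (block d k) (x, y)) (block d i)))
       \<partial>block_cube d k) \<partial>cube k d)"
    unfolding comps_Suc
    by (intro nn_integral_unit_cube_merge comps_block_disjoint borel_measurable_prod_ennreal g)
       (auto simp flip: comps_Suc simp: block_subset_comps)
  also have "\<dots> = (\<integral>\<^sup>+x. (\<integral>\<^sup>+y. (\<Prod>i<k. g i (restrict x (block d i))) * g k y
       \<partial>block_cube d k) \<partial>cube k d)"
  proof (intro nn_integral_cong)
    fix x y assume x: "x \<in> space (cube k d)" and y: "y \<in> space (block_cube d k)"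
    have 1: "restrict (merge (comps k d) (block d k) (x, y)) (block d i) = restrict x (block d i)" if "i < k" for i
      using block_subset_comps[OF that, of d] comps_block_disjoint[of k d]
      by (auto simp: merge_def restrict_def fun_eq_iff)
    have 2: "restrict (merge (comps k d) (block d k) (x, y)) (block d k) = y"
      using y comps_block_disjoint[of k d]
      by (auto simp: merge_def restrict_def fun_eq_iff space_unit_cube PiE_def extensional_def)
    show "(\<Prod>i<Suc k. g i (restrict (merge (comps k d) (block d k) (x, y)) (block d i))) =
      (\<Prod>i<k. g i (restrict x (block d i))) * g k y"
      by (simp add: 1 2)
  qed
  also have "\<dots> = (\<Prod>i<Suc k. \<integral>\<^sup>+u. g i u \<partial>block_cube d i)"
    using Suc.prems g by (simp add: nn_integral_cmult nn_integral_multc Suc.IH block_subset_comps)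
  finally show ?case .
qed

text \<open>Generalized boxes whose sides are events of whole blocks. Products of the block copulas are
characterized by their values on these sets.\<close>
definition block_event :: "nat \<Rightarrow> (nat \<Rightarrow> nat) \<Rightarrow> (nat \<Rightarrow> (nat \<times> nat \<Rightarrow> real) set) \<Rightarrow> (nat \<times> nat \<Rightarrow> real) set" where
  "block_event k d A = {u \<in> space (cube k d). \<forall>i<k. restrict u (block d i) \<in> A i}"

lemma block_event_sets:
  assumes "\<And>i. i < k \<Longrightarrow> A i \<in> sets (block_cube d i)"
  shows "block_event k d A \<in> sets (cube k d)"
proof -
  have *: "{u \<in> space (cube k d). restrict u (block d i) \<in> A i} \<in> sets (cube k d)" if "i < k" for i
    using measurable_sets[OF measurable_unit_cube_restrict[OF block_subset_comps] assms, OF that that]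
    by (simp add: vimage_def Int_def conj_commute)
  have "{u \<in> space (cube k d). \<forall>i\<in>{..<k}. restrict u (block d i) \<in> A i} \<in> sets (cube k d)"
    by (rule sets.sets_Collect_finite_All[OF _ finite_lessThan]) (simp add: *)
  moreover have "block_event k d A = {u \<in> space (cube k d). \<forall>i\<in>{..<k}. restrict u (block d i) \<in> A i}"
    by (auto simp only: block_event_def lessThan_iff)
  ultimately show ?thesis by simp
qed

lemma restrict_in_unit_cube:
  "u \<in> space (unit_cube I) \<Longrightarrow> J \<subseteq> I \<Longrightarrow> restrict u J \<in> space (unit_cube J)"
  by (auto simp: space_unit_cube PiE_def Pi_def)

text \<open>Every ordinary box is a block event whose sides are boxes, and boxes determine a measure.\<close>
lemma block_measure_eqI:
  assumes P: "sets P = sets (cube k d)" "prob_space P" and Q: "sets Q = sets (cube k d)"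
    and eq: "\<And>A. (\<And>i. i < k \<Longrightarrow> A i \<in> sets (block_cube d i)) \<Longrightarrow>
      emeasure P (block_event k d A) = emeasure Q (block_event k d A)"
  shows "P = Q"
proof (rule unit_cube_measure_eqI[OF _ P Q])
  fix A assume A: "\<And>p. p \<in> comps k d \<Longrightarrow> A p \<in> sets unit_interval"
  then have sub: "A p \<subseteq> {0..1}" if "p \<in> comps k d" for p
    using that sets.sets_into_space[of "A p" unit_interval] by (auto simp: space_restrict_space)
  have "PiE (comps k d) A = block_event k d (\<lambda>i. PiE (block d i) A)"
  proof (intro set_eqI iffI)
    fix u assume "u \<in> PiE (comps k d) A"
    then have u: "u p \<in> A p" if "p \<in> comps k d" for p using that by (auto simp: PiE_def)
    have "u \<in> space (cube k d)"
      using u sub \<open>u \<in> PiE (comps k d) A\<close> unfolding space_unit_cube PiE_def Pi_def by blast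
    moreover have "restrict u (block d i) \<in> PiE (block d i) A" if "i < k" for i
      using u block_subset_comps[OF that, of d] by (auto simp: PiE_def Pi_def)
    ultimately show "u \<in> block_event k d (\<lambda>i. PiE (block d i) A)"
      by (simp add: block_event_def)
  next
    fix u assume "u \<in> block_event k d (\<lambda>i. PiE (block d i) A)"
    then have ext: "u \<in> extensional (comps k d)" and u: "\<And>i. i < k \<Longrightarrow> restrict u (block d i) \<in> PiE (block d i) A"
      by (auto simp: block_event_def space_unit_cube PiE_def)
    have "u p \<in> A p" if p: "p \<in> comps k d" for p
    proof -
      obtain i where i: "i < k" "p \<in> block d i" using p by (auto simp: comps_eq_Union_block)
      have "restrict u (block d i) p \<in> A p" using PiE_mem[OF u[OF i(1)] i(2)] .
      with i show ?thesis by simp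
    qed
    with ext show "u \<in> PiE (comps k d) A" by (auto simp: PiE_def)
  qed
  moreover have "emeasure P (block_event k d (\<lambda>i. PiE (block d i) A)) = emeasure Q (block_event k d (\<lambda>i. PiE (block d i) A))"
    using block_subset_comps[of _ k d] by (intro eq) (auto simp: unit_cube_def intro!: sets_PiM_I_finite A)
  ultimately show "emeasure P (PiE (comps k d) A) = emeasure Q (PiE (comps k d) A)" by simp
qed simp

lemma prod_density_measurable:
  assumes "\<And>i. i < k \<Longrightarrow> cs i \<in> borel_measurable (block_cube d i)"
  shows "prod_density k d cs \<in> borel_measurable (cube k d)"
  unfolding prod_density_def[abs_def]
  by (intro borel_measurable_prod measurable_compose[OF measurable_unit_cube_restrict] assms block_subset_comps) auto

lemma prod_density_nonneg:
  assumes "\<And>i u. i < k \<Longrightarrow> u \<in> space (block_cube d i) \<Longrightarrow> 0 \<le> cs i u" "u \<in> space (cube k d)"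
  shows "0 \<le> prod_density k d cs u"
  unfolding prod_density_def
  using assms(1) restrict_in_unit_cube[OF assms(2) block_subset_comps] by (intro prod_nonneg) blast

lemma emeasure_prod_measure:
  assumes cs: "\<And>i. i < k \<Longrightarrow> cs i \<in> borel_measurable (block_cube d i)"
    and nonneg: "\<And>i u. i < k \<Longrightarrow> u \<in> space (block_cube d i) \<Longrightarrow> 0 \<le> cs i u"
    and A: "\<And>i. i < k \<Longrightarrow> A i \<in> sets (block_cube d i)"
  shows "emeasure (prod_measure k d cs) (block_event k d A) =
    (\<Prod>i<k. emeasure (density (block_cube d i) (\<lambda>u. ennreal (cs i u))) (A i))"
proof -
  have "emeasure (prod_measure k d cs) (block_event k d A) =
    (\<integral>\<^sup>+u. ennreal (prod_density k d cs u) * indicator (block_event k d A) u \<partial>cube k d)"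
    unfolding prod_measure_def
    by (intro emeasure_density block_event_sets A measurable_compose[OF prod_density_measurable measurable_ennreal] cs)
  also have "\<dots> = (\<integral>\<^sup>+u. (\<Prod>i<k. ennreal (cs i (restrict u (block d i))) * indicator (A i) (restrict u (block d i)))
      \<partial>cube k d)"
  proof (intro nn_integral_cong)
    fix u assume u: "u \<in> space (cube k d)"
    have "ennreal (prod_density k d cs u) = (\<Prod>i<k. ennreal (cs i (restrict u (block d i))))"
      unfolding prod_density_def
      by (intro prod_ennreal[symmetric] nonneg restrict_in_unit_cube[OF u] block_subset_comps) auto
    moreover have "indicator (block_event k d A) u = (\<Prod>i<k. indicator (A i) (restrict u (block d i)) :: ennreal)"
    proof (cases "u \<in> block_event k d A")
      case True
      then show ?thesis by (auto simp: block_event_def intro!: prod.neutral[symmetric])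
    next
      case False
      with u obtain i where "i < k" "restrict u (block d i) \<notin> A i" by (auto simp: block_event_def)
      with False show ?thesis by (auto intro!: prod_zero[symmetric] bexI[of _ i])
    qed
    ultimately show "ennreal (prod_density k d cs u) * indicator (block_event k d A) u =
      (\<Prod>i<k. ennreal (cs i (restrict u (block d i))) * indicator (A i) (restrict u (block d i)))"
      by (simp add: prod.distrib)
  qed
  also have "\<dots> = (\<Prod>i<k. \<integral>\<^sup>+u. ennreal (cs i u) * indicator (A i) u \<partial>block_cube d i)"
    using A cs by (intro nn_integral_unit_cube_prod_blocks borel_measurable_times_ennreal
        borel_measurable_indicator measurable_compose[OF _ measurable_ennreal])
  also have "\<dots> = (\<Prod>i<k. emeasure (density (block_cube d i) (\<lambda>u. ennreal (cs i u))) (A i))"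
    using A cs by (intro prod.cong refl emeasure_density[symmetric] measurable_compose[OF _ measurable_ennreal]) auto
  finally show ?thesis .
qed

text \<open>The symmetries of the cube used below have this form: \<open>\<tau>\<close> relabels the coordinates, and \<open>\<phi> p\<close> is
the identity or the reflection \<open>t \<mapsto> 1 - t\<close>.\<close>
definition coordinate_map :: "'i set \<Rightarrow> ('i \<Rightarrow> real \<Rightarrow> real) \<Rightarrow> ('i \<Rightarrow> 'j) \<Rightarrow> ('j \<Rightarrow> real) \<Rightarrow> ('i \<Rightarrow> real)" where
  "coordinate_map I \<phi> \<tau> u = (\<lambda>p\<in>I. \<phi> p (u (\<tau> p)))"

lemma coordinate_map_measurable:
  assumes "\<And>p. p \<in> I' \<Longrightarrow> \<phi> p \<in> measurable unit_interval unit_interval" "\<And>p. p \<in> I' \<Longrightarrow> \<tau> p \<in> I"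
  shows "coordinate_map I' \<phi> \<tau> \<in> measurable (unit_cube I) (unit_cube I')"
  unfolding coordinate_map_def[abs_def]
  by (intro measurable_unit_cubeI measurable_compose[OF measurable_unit_cube_component assms(1)] assms(2))

lemma distr_unit_cube_coordinate_map:
  assumes fin: "finite I" and bij: "bij_betw \<tau> I' I"
    and \<phi>: "\<And>p. p \<in> I' \<Longrightarrow> \<phi> p \<in> measurable unit_interval unit_interval"
    and inv: "\<And>p. p \<in> I' \<Longrightarrow> distr unit_interval unit_interval (\<phi> p) = unit_interval"
  shows "distr (unit_cube I) (unit_cube I') (coordinate_map I' \<phi> \<tau>) = unit_cube I'"
proof -
  have fin': "finite I'" using bij fin bij_betw_finite by blast
  have \<tau>: "\<tau> p \<in> I" if "p \<in> I'" for p using bij that by (auto simp: bij_betw_def)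
  note meas = coordinate_map_measurable[of I' \<phi> \<tau> I, OF \<phi> \<tau>]
  show ?thesis
    unfolding unit_cube_def[of I']
  proof (rule unit_cubes.PiM_eqI[OF fin'])
    fix A assume A: "\<And>p. p \<in> I' \<Longrightarrow> A p \<in> sets unit_interval"
    define B where "B q = (let p = inv_into I' \<tau> q in \<phi> p -` A p \<inter> space unit_interval)" for q
    have B_\<tau>: "B (\<tau> p) = \<phi> p -` A p \<inter> space unit_interval" if "p \<in> I'" for p
      using bij that by (simp add: B_def bij_betw_inv_into_left)
    have B: "B q \<in> sets unit_interval" if q: "q \<in> I" for q
    proof -
      obtain p where "p \<in> I'" "q = \<tau> p" using bij_betw_imp_surj_on[OF bij] q by blast
      then show ?thesis using measurable_sets[OF \<phi> A, of p] by (simp add: B_\<tau>)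
    qed
    have "coordinate_map I' \<phi> \<tau> -` PiE I' A \<inter> space (unit_cube I) = PiE I B"
    proof (intro set_eqI iffI)
      fix u assume u: "u \<in> coordinate_map I' \<phi> \<tau> -` PiE I' A \<inter> space (unit_cube I)"
      have "u q \<in> B q" if q: "q \<in> I" for q
      proof -
        obtain p where "p \<in> I'" "q = \<tau> p" using bij_betw_imp_surj_on[OF bij] q by blast
        moreover from u q have "u q \<in> {0..1}" by (auto simp: space_unit_cube)
        ultimately show ?thesis using u by (auto simp: B_\<tau> coordinate_map_def space_restrict_space)
      qed
      with u show "u \<in> PiE I B" by (auto simp: space_unit_cube PiE_def)
    next
      fix u assume u: "u \<in> PiE I B"
      have "u (\<tau> p) \<in> B (\<tau> p)" if "p \<in> I'" for p using u \<tau>[OF that] by auto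
      moreover have "u q \<in> {0..1}" if "q \<in> I" for q
        using u that sets.sets_into_space[OF B[OF that]] by (auto simp: space_restrict_space)
      ultimately show "u \<in> coordinate_map I' \<phi> \<tau> -` PiE I' A \<inter> space (unit_cube I)"
        using u by (auto simp: space_unit_cube coordinate_map_def B_\<tau> PiE_def Pi_def)
    qed
    moreover have "PiE I' A \<in> sets (unit_cube I')"
      unfolding unit_cube_def by (intro sets_PiM_I_finite fin' A)
    ultimately have "emeasure (distr (unit_cube I) (unit_cube I') (coordinate_map I' \<phi> \<tau>)) (PiE I' A) =
        emeasure (unit_cube I) (PiE I B)"
      using meas by (simp add: emeasure_distr)
    also have "\<dots> = (\<Prod>q\<in>I. emeasure unit_interval (B q))"
      unfolding unit_cube_def by (intro unit_cubes.emeasure_PiM fin B)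
    also have "\<dots> = (\<Prod>p\<in>I'. emeasure unit_interval (B (\<tau> p)))"
      by (rule prod.reindex_bij_betw[OF bij, symmetric])
    also have "\<dots> = (\<Prod>p\<in>I'. emeasure unit_interval (A p))"
    proof (intro prod.cong refl)
      fix p assume p: "p \<in> I'"
      have "emeasure unit_interval (B (\<tau> p)) = emeasure (distr unit_interval unit_interval (\<phi> p)) (A p)"
        by (simp add: B_\<tau>[OF p] emeasure_distr[OF \<phi>[OF p] A[OF p]])
      then show "emeasure unit_interval (B (\<tau> p)) = emeasure unit_interval (A p)" by (simp add: inv[OF p])
    qed
    finally show "emeasure (distr (unit_cube I) (Pi\<^sub>M I' (\<lambda>_. unit_interval)) (coordinate_map I' \<phi> \<tau>)) (PiE I' A) =
      (\<Prod>p\<in>I'. emeasure unit_interval (A p))" by (simp add: unit_cube_def)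
  qed (simp add: unit_cube_def)
qed

section \<open>Copula measures and the product of the block copulas\<close>

text \<open>The part of admissibility that makes the divergence of the copula measure from the product of the
block copulas meaningful. It passes directly to permuted and transformed vectors.\<close>
definition has_density_copula ::
    "'w measure \<Rightarrow> nat \<Rightarrow> (nat \<Rightarrow> nat) \<Rightarrow> (nat \<times> nat \<Rightarrow> 'w \<Rightarrow> real) \<Rightarrow> bool" where
  "has_density_copula M k d X \<longleftrightarrow> prob_space M \<and> (\<forall>p\<in>comps k d. X p \<in> borel_measurable M) \<and>
     absolutely_continuous (cube k d) (joint_copula M k d X)"

text \<open>The copula measure that the vector would have if its blocks were independent with the given block
copulas.\<close>
definition block_product ::
    "'w measure \<Rightarrow> nat \<Rightarrow> (nat \<Rightarrow> nat) \<Rightarrow> (nat \<times> nat \<Rightarrow> 'w \<Rightarrow> real) \<Rightarrow> (nat \<times> nat \<Rightarrow> real) measure" where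
  "block_product M k d X = prod_measure k d (\<lambda>i. copula_density M (block d i) X)"

lemma admissible_has_density_copula: "admissible M k d X \<Longrightarrow> has_density_copula M k d X"
  by (simp add: admissible_def has_density_copula_def)

lemma prob_transform_measurable:
  assumes "prob_space M" "X p \<in> borel_measurable M"
  shows "prob_transform M X p \<in> measurable M unit_interval"
proof -
  interpret prob_space M by fact
  interpret D: cdf_distribution "distr M borel (X p)"
    by (intro cdf_distribution.intro real_distribution_distr assms)
  have "prob_transform M X p = (\<lambda>\<omega>. cdf (distr M borel (X p)) (X p \<omega>))"
    by (simp add: prob_transform_def fun_eq_iff)
  also have "\<dots> \<in> measurable M unit_interval"
    using assms D.cdf_bounded_prob D.cdf_nonneg
    by (intro measurable_restrict_space2) auto
  finally show ?thesis .
qed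

lemma subvector_prob_transform_measurable:
  assumes "prob_space M" "\<And>p. p \<in> J \<Longrightarrow> X p \<in> borel_measurable M"
  shows "subvector (prob_transform M X) J \<in> measurable M (unit_cube J)"
  unfolding subvector_def by (intro measurable_unit_cubeI prob_transform_measurable assms)

lemma sets_copula_measure [simp, measurable_cong]: "sets (copula_measure M I X) = sets (unit_cube I)"
  by (simp add: copula_measure_def)

lemma space_copula_measure [simp]: "space (copula_measure M I X) = space (unit_cube I)"
  by (simp add: copula_measure_def)

lemma prob_space_copula_measure:
  assumes "prob_space M" "\<And>p. p \<in> I \<Longrightarrow> X p \<in> borel_measurable M"
  shows "prob_space (copula_measure M I X)"
  unfolding copula_measure_def
  by (intro prob_space.prob_space_distr subvector_prob_transform_measurable assms)

lemma copula_measure_marginal: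
  assumes "prob_space M" "\<And>p. p \<in> I \<Longrightarrow> X p \<in> borel_measurable M" "J \<subseteq> I"
  shows "distr (copula_measure M I X) (unit_cube J) (\<lambda>u. restrict u J) = copula_measure M J X"
  unfolding copula_measure_def
  using assms
  by (subst distr_distr[OF measurable_unit_cube_restrict subvector_prob_transform_measurable])
     (auto simp: comp_def subvector_def Int_absorb1 intro!: arg_cong[where f = "distr M (unit_cube J)"])

lemma copula_measure_cong:
  assumes "\<And>p \<omega>. p \<in> I \<Longrightarrow> \<omega> \<in> space M \<Longrightarrow> prob_transform M X p \<omega> = prob_transform M Y p \<omega>"
  shows "copula_measure M I X = copula_measure M I Y"
  unfolding copula_measure_def
  by (intro distr_cong refl) (simp add: subvector_def assms cong: restrict_cong)

lemma prob_transform_cong: "X p = Y p \<Longrightarrow> prob_transform M X p = prob_transform M Y p"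
  by (simp add: prob_transform_def[abs_def])

lemma absolutely_continuous_marginal:
  assumes "prob_space M" "\<And>p. p \<in> I \<Longrightarrow> X p \<in> borel_measurable M" "J \<subseteq> I" "finite J"
    and "absolutely_continuous (unit_cube I) (copula_measure M I X)"
  shows "absolutely_continuous (unit_cube J) (copula_measure M J X)"
  using absolutely_continuous_distr[OF assms(5) _ measurable_unit_cube_restrict[OF assms(3)]]
    distr_unit_cube_restrict[OF assms(4,3)] copula_measure_marginal[OF assms(1,2,3)]
  by simp

lemma is_copula_density_copula_density:
  assumes "prob_space M" "\<And>p. p \<in> I \<Longrightarrow> X p \<in> borel_measurable M"
    and "absolutely_continuous (unit_cube I) (copula_measure M I X)"
  shows "is_copula_density M I X (copula_density M I X)"
proof -
  have eq: "copula_density M I X = rn_ratio (copula_measure M I X) (unit_cube I)"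
    by (simp add: copula_density_def rn_ratio_def fun_eq_iff)
  have "density (unit_cube I) (\<lambda>u. ennreal (rn_ratio (copula_measure M I X) (unit_cube I) u)) = copula_measure M I X"
    using assms
    by (intro density_rn_ratio prob_space_imp_sigma_finite prob_space_unit_cube
        prob_space.finite_measure prob_space_copula_measure) simp_all
  then show ?thesis by (simp add: is_copula_density_def eq rn_ratio_nonneg)
qed

lemma has_density_copula_blockD:
  assumes "has_density_copula M k d X" "i < k"
  shows "is_copula_density M (block d i) X (copula_density M (block d i) X)"
    and "prob_space (copula_measure M (block d i) X)"
    and "distr (joint_copula M k d X) (block_cube d i) (\<lambda>u. restrict u (block d i)) =
      copula_measure M (block d i) X"
proof -
  have X: "prob_space M" "\<And>p. p \<in> comps k d \<Longrightarrow> X p \<in> borel_measurable M"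
    and ac: "absolutely_continuous (cube k d) (joint_copula M k d X)"
    using assms by (auto simp: has_density_copula_def)
  note sub = block_subset_comps[OF assms(2), of d]
  then have Xi: "\<And>p. p \<in> block d i \<Longrightarrow> X p \<in> borel_measurable M" using X by blast
  show "is_copula_density M (block d i) X (copula_density M (block d i) X)"
    by (intro is_copula_density_copula_density X(1) Xi absolutely_continuous_marginal[OF X sub finite_block ac])
  show "prob_space (copula_measure M (block d i) X)"
    by (intro prob_space_copula_measure X(1) Xi)
  show "distr (joint_copula M k d X) (block_cube d i) (\<lambda>u. restrict u (block d i)) =
      copula_measure M (block d i) X"
    by (rule copula_measure_marginal[OF X sub])
qed

lemma sets_block_product [simp, measurable_cong]: "sets (block_product M k d X) = sets (cube k d)"
  by (simp add: block_product_def prod_measure_def)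

lemma space_block_product [simp]: "space (block_product M k d X) = space (cube k d)"
  by (simp add: block_product_def prod_measure_def)

lemma emeasure_prod_measure_block_event:
  assumes "\<And>i. i < k \<Longrightarrow> is_copula_density M (block d i) X (cs i)"
    and "\<And>i. i < k \<Longrightarrow> A i \<in> sets (block_cube d i)"
  shows "emeasure (prod_measure k d cs) (block_event k d A) =
    (\<Prod>i<k. emeasure (copula_measure M (block d i) X) (A i))"
  using assms by (subst emeasure_prod_measure) (auto simp: is_copula_density_def)

lemma emeasure_block_product:
  assumes "has_density_copula M k d X" "\<And>i. i < k \<Longrightarrow> A i \<in> sets (block_cube d i)"
  shows "emeasure (block_product M k d X) (block_event k d A) =
    (\<Prod>i<k. emeasure (copula_measure M (block d i) X) (A i))"
  unfolding block_product_def
  using has_density_copula_blockD(1)[OF assms(1)] assms(2) by (rule emeasure_prod_measure_block_event)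

lemma prob_space_block_product:
  assumes "has_density_copula M k d X"
  shows "prob_space (block_product M k d X)"
proof
  have "block_event k d (\<lambda>i. space (block_cube d i)) = space (cube k d)"
    by (auto simp: block_event_def intro!: restrict_in_unit_cube[OF _ block_subset_comps])
  moreover have "emeasure (copula_measure M (block d i) X) (space (block_cube d i)) = 1" if "i < k" for i
    using prob_space.emeasure_space_1[OF has_density_copula_blockD(2)[OF assms that]] by simp
  ultimately show "emeasure (block_product M k d X) (space (block_product M k d X)) = 1"
    using emeasure_block_product[OF assms, of "\<lambda>i. space (block_cube d i)"] by simp
qed

lemma block_product_eqI:
  assumes X: "has_density_copula M k d X" and R: "sets R = sets (cube k d)"
    and eq: "\<And>A. (\<And>i. i < k \<Longrightarrow> A i \<in> sets (block_cube d i)) \<Longrightarrow>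
      emeasure R (block_event k d A) = (\<Prod>i<k. emeasure (copula_measure M (block d i) X) (A i))"
  shows "R = block_product M k d X"
proof (rule block_measure_eqI[symmetric])
  fix A assume A: "\<And>i. i < k \<Longrightarrow> A i \<in> sets (block_cube d i)"
  show "emeasure (block_product M k d X) (block_event k d A) = emeasure R (block_event k d A)"
    by (simp only: eq[OF A] emeasure_block_product[OF X A])
qed (simp_all add: prob_space_block_product X R)

lemma prod_measure_eq_block_product:
  assumes "has_density_copula M k d X" "\<And>i. i < k \<Longrightarrow> is_copula_density M (block d i) X (cs i)"
  shows "prod_measure k d cs = block_product M k d X"
  by (rule block_product_eqI[OF assms(1)])
     (auto simp: prod_measure_def[of k d cs] intro!: emeasure_prod_measure_block_event[unfolded prod_measure_def] assms(2))

text \<open>A block density \<open>cs i\<close> is positive almost surely under the \<open>i\<close>-th block marginal of the copula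
measure. Hence \<open>c\<close> vanishes almost everywhere where \<open>prod_density\<close> does, and multiplying the ratio by
\<open>prod_density\<close> recovers \<open>c\<close>.\<close>
lemma
  assumes X: "has_density_copula M k d X" and c: "is_copula_density M (comps k d) X c"
    and cs: "\<And>i. i < k \<Longrightarrow> is_copula_density M (block d i) X (cs i)"
  shows copula_measure_eq_density_ratio: "joint_copula M k d X =
      density (block_product M k d X) (\<lambda>u. ennreal (c u / prod_density k d cs u))"
    and ratio_measurable: "(\<lambda>u. c u / prod_density k d cs u) \<in> borel_measurable (block_product M k d X)"
    and ratio_nonneg: "AE u in block_product M k d X. 0 \<le> c u / prod_density k d cs u"
proof -
  let ?L = "cube k d" and ?\<pi> = "prod_density k d cs"
  have Q: "block_product M k d X = density ?L (\<lambda>u. ennreal (?\<pi> u))"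
    using prod_measure_eq_block_product[OF X cs] by (simp add: prod_measure_def)
  have \<pi> [measurable]: "?\<pi> \<in> borel_measurable ?L"
    using cs by (intro prod_density_measurable) (auto simp: is_copula_density_def)
  have c_meas [measurable]: "c \<in> borel_measurable ?L" and c_nonneg: "\<And>u. u \<in> space ?L \<Longrightarrow> 0 \<le> c u"
    and P: "joint_copula M k d X = density ?L (\<lambda>u. ennreal (c u))"
    using c by (auto simp: is_copula_density_def)
  have \<pi>_nonneg: "0 \<le> ?\<pi> u" if "u \<in> space ?L" for u
    using that cs by (intro prod_density_nonneg) (auto simp: is_copula_density_def)
  show "(\<lambda>u. c u / ?\<pi> u) \<in> borel_measurable (block_product M k d X)"
    by (simp add: measurable_cong_sets[OF sets_block_product refl])
  show "AE u in block_product M k d X. 0 \<le> c u / ?\<pi> u"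
    by (rule AE_I2) (simp add: c_nonneg \<pi>_nonneg)
  have "AE u in ?L. 0 < c u \<longrightarrow> 0 < cs i (restrict u (block d i))" if i: "i < k" for i
  proof -
    have "AE v in copula_measure M (block d i) X. 0 < cs i v"
    proof -
      have [measurable]: "cs i \<in> borel_measurable (block_cube d i)"
        using cs[OF i] by (simp add: is_copula_density_def)
      have "AE v in density (block_cube d i) (\<lambda>v. ennreal (cs i v)). 0 < cs i v"
        by (subst AE_density) auto
      moreover have "copula_measure M (block d i) X = density (block_cube d i) (\<lambda>v. ennreal (cs i v))"
        using cs[OF i] by (simp add: is_copula_density_def)
      ultimately show ?thesis by (simp only:)
    qed
    then have "AE v in distr (joint_copula M k d X) (block_cube d i) (\<lambda>u. restrict u (block d i)). 0 < cs i v"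
      by (simp only: has_density_copula_blockD(3)[OF X i])
    from AE_distrD[OF _ this] have "AE u in joint_copula M k d X. 0 < cs i (restrict u (block d i))"
      using measurable_unit_cube_restrict[OF block_subset_comps[OF i, of d]] by simp
    then show ?thesis unfolding P by (subst (asm) AE_density) auto
  qed
  then have "AE u in ?L. \<forall>i\<in>{..<k}. 0 < c u \<longrightarrow> 0 < cs i (restrict u (block d i))"
    by (intro AE_finite_allI) auto
  then have "AE u in ?L. ennreal (c u) = ennreal (?\<pi> u) * ennreal (c u / ?\<pi> u)"
    using AE_space
  proof eventually_elim
    case (elim u)
    show ?case
    proof (cases "0 < c u")
      case True
      then have "0 < ?\<pi> u" using elim unfolding prod_density_def by (intro prod_pos) auto
      then show ?thesis using True by (simp flip: ennreal_mult)
    next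
      case False
      with elim(2) c_nonneg[of u] have "c u = 0" by linarith
      then show ?thesis by simp
    qed
  qed
  then show "joint_copula M k d X = density (block_product M k d X) (\<lambda>u. ennreal (c u / ?\<pi> u))"
    unfolding P Q by (subst density_density_eq) (auto intro!: density_cong)
qed

lemma has_density_copulaD:
  assumes "has_density_copula M k d X"
  shows "prob_space M" "prob_space (joint_copula M k d X)"
    "\<And>p. p \<in> comps k d \<Longrightarrow> X p \<in> borel_measurable M"
    "is_copula_density M (comps k d) X (copula_density M (comps k d) X)"
    "absolutely_continuous (block_product M k d X) (joint_copula M k d X)"
proof -
  show X: "prob_space M" "\<And>p. p \<in> comps k d \<Longrightarrow> X p \<in> borel_measurable M"
    using assms by (auto simp: has_density_copula_def)
  then show "prob_space (joint_copula M k d X)" by (intro prob_space_copula_measure)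
  show c: "is_copula_density M (comps k d) X (copula_density M (comps k d) X)"
    using assms by (intro is_copula_density_copula_density X) (auto simp: has_density_copula_def)
  show "absolutely_continuous (block_product M k d X) (joint_copula M k d X)"
    by (subst copula_measure_eq_density_ratio[OF assms c has_density_copula_blockD(1)[OF assms]])
       (auto intro!: absolutely_continuousI_density measurable_compose[OF ratio_measurable measurable_ennreal]
         assms c has_density_copula_blockD(1)[OF assms])
qed

context phi_generator
begin

lemma
  assumes X: "has_density_copula M k d X" and c: "is_copula_density M (comps k d) X c"
    and cs: "\<And>i. i < k \<Longrightarrow> is_copula_density M (block d i) X (cs i)"
  shows ext_integral_exists_Phi_ratio: "ext_integral_exists (prod_measure k d cs) (Phi_ratio \<Phi> k d c cs)"
    and ext_integral_Phi_ratio: "ext_integral (prod_measure k d cs) (Phi_ratio \<Phi> k d c cs) =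
      enn2ereal (phi_div (joint_copula M k d X) (block_product M k d X))"
  using ext_integral_phi_div[OF prob_space_block_product[OF X] ratio_measurable[OF X c cs]
      ratio_nonneg[OF X c cs] copula_measure_eq_density_ratio[OF X c cs] has_density_copulaD(2)[OF X]]
  by (simp_all add: prod_measure_eq_block_product[OF X cs] Phi_ratio_def[abs_def])

text \<open>Since the right-hand side mentions only measures, \<open>D_Phi\<close> depends on the copula measure alone.\<close>
lemma D_Phi_eq_phi_div:
  assumes X: "has_density_copula M k d X"
  shows "D_Phi \<Phi> M k d X = enn2ereal (phi_div (joint_copula M k d X) (block_product M k d X))"
  unfolding D_Phi_def Let_def
  using X has_density_copulaD(4)[OF X] has_density_copula_blockD(1)[OF X] by (rule ext_integral_Phi_ratio)

end

lemma restrict_coordinate_map: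
  assumes "B' \<subseteq> I'" "\<tau> ` B' \<subseteq> B"
  shows "restrict (coordinate_map I' \<phi> \<tau> u) B' = coordinate_map B' \<phi> \<tau> (restrict u B)"
  using assms by (auto simp: coordinate_map_def fun_eq_iff restrict_def)

text \<open>The relabellings and reflections that carry the decomposition of the coordinates given by \<open>d\<close> into
that given by \<open>d'\<close>, with block \<open>i\<close> of the image taken from block \<open>\<pi> i\<close>. Each of them preserves Lebesgue
measure on the cube.\<close>
definition block_symmetry ::
    "nat \<Rightarrow> (nat \<Rightarrow> nat) \<Rightarrow> (nat \<Rightarrow> nat) \<Rightarrow> (nat \<Rightarrow> nat) \<Rightarrow> (nat \<times> nat \<Rightarrow> real \<Rightarrow> real) \<Rightarrow> (nat \<times> nat \<Rightarrow> nat \<times> nat) \<Rightarrow> bool" where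
  "block_symmetry k d d' \<pi> \<phi> \<tau> \<longleftrightarrow> bij_betw \<tau> (comps k d') (comps k d) \<and>
     \<pi> permutes {..<k} \<and> (\<forall>i<k. \<tau> ` block d' i = block d (\<pi> i)) \<and> (\<forall>p. \<phi> p = (\<lambda>t. t) \<or> \<phi> p = (\<lambda>t. 1 - t))"

lemma block_symmetryD:
  assumes "block_symmetry k d d' \<pi> \<phi> \<tau>"
  shows "bij_betw \<tau> (comps k d') (comps k d)" "\<pi> permutes {..<k}" "\<And>i. i < k \<Longrightarrow> \<tau> ` block d' i = block d (\<pi> i)"
    "\<And>p. p \<in> comps k d' \<Longrightarrow> \<tau> p \<in> comps k d" "\<And>p. \<phi> p \<in> measurable unit_interval unit_interval"
    "\<And>p. distr unit_interval unit_interval (\<phi> p) = unit_interval" "\<And>p t. \<phi> p (\<phi> p t) = t"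
proof -
  show "bij_betw \<tau> (comps k d') (comps k d)" "\<pi> permutes {..<k}" "\<And>i. i < k \<Longrightarrow> \<tau> ` block d' i = block d (\<pi> i)"
    using assms by (auto simp: block_symmetry_def)
  then show "\<And>p. p \<in> comps k d' \<Longrightarrow> \<tau> p \<in> comps k d" by (auto simp: bij_betw_def)
  fix p
  have "\<phi> p = (\<lambda>t. t) \<or> \<phi> p = (\<lambda>t. 1 - t)" using assms unfolding block_symmetry_def by blast
  then show "\<phi> p \<in> measurable unit_interval unit_interval" "distr unit_interval unit_interval (\<phi> p) = unit_interval"
    "\<phi> p (\<phi> p t) = t" for t
    by (auto simp: measurable_flip_unit_interval distr_unit_interval_flip distr_id2)
qed

lemma has_density_copula_coordinate_map:
  assumes X: "has_density_copula M k d X"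
    and Y: "prob_space M'" "\<And>p. p \<in> comps k d' \<Longrightarrow> Y p \<in> borel_measurable M'"
    and sym: "block_symmetry k d d' \<pi> \<phi> \<tau>"
    and cop: "joint_copula M' k d' Y =
      distr (joint_copula M k d X) (cube k d') (coordinate_map (comps k d') \<phi> \<tau>)"
  shows "has_density_copula M' k d' Y"
proof -
  note bij = block_symmetryD(1)[OF sym] and \<tau> = block_symmetryD(4)[OF sym]
    and \<phi> = block_symmetryD(5)[OF sym] and inv = block_symmetryD(6)[OF sym]
  have "absolutely_continuous (cube k d') (joint_copula M' k d' Y)"
    unfolding cop
    using X
    by (intro absolutely_continuous_distr[OF _ sets_copula_measure] coordinate_map_measurable
        distr_unit_cube_coordinate_map[OF finite_comps bij] \<phi> inv \<tau>)
       (simp_all add: has_density_copula_def)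
  with Y show ?thesis by (simp add: has_density_copula_def)
qed

text \<open>The map respects the block structure: the \<open>i\<close>-th block of the image is a function \<open>?hb i\<close> of block
\<open>\<pi> i\<close> of the argument. So preimages of block events are block events, and the image of the product
takes the values that characterize the product of the new block copulas.\<close>
lemma block_product_coordinate_map:
  assumes X: "has_density_copula M k d X"
    and Y: "prob_space M'" "\<And>p. p \<in> comps k d' \<Longrightarrow> Y p \<in> borel_measurable M'"
    and sym: "block_symmetry k d d' \<pi> \<phi> \<tau>"
    and cop: "joint_copula M' k d' Y =
      distr (joint_copula M k d X) (cube k d') (coordinate_map (comps k d') \<phi> \<tau>)"
  shows "distr (block_product M k d X) (cube k d') (coordinate_map (comps k d') \<phi> \<tau>) =
    block_product M' k d' Y"
proof (rule block_product_eqI)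
  let ?h = "coordinate_map (comps k d') \<phi> \<tau>"
  let ?hb = "\<lambda>i. coordinate_map (block d' i) \<phi> \<tau>"
  note bij = block_symmetryD(1)[OF sym] and \<tau> = block_symmetryD(4)[OF sym]
    and \<phi> = block_symmetryD(5)[OF sym] and \<pi> = block_symmetryD(2)[OF sym] and blocks = block_symmetryD(3)[OF sym]
  note Y' = has_density_copula_coordinate_map[OF X Y sym cop]
  show "has_density_copula M' k d' Y" by (rule Y')
  have h: "?h \<in> measurable (cube k d) (cube k d')"
    by (intro coordinate_map_measurable \<phi> \<tau>)
  have \<pi>_less: "\<pi> i < k" if "i < k" for i using permutes_in_image[OF \<pi>, of i] that by simp
  have \<pi>_bij: "bij_betw \<pi> {..<k} {..<k}" by (rule permutes_imp_bij[OF \<pi>])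
  have hb: "?hb i \<in> measurable (block_cube d (\<pi> i)) (block_cube d' i)" if "i < k" for i
    using blocks[OF that] block_subset_comps[OF that, of d'] by (intro coordinate_map_measurable \<phi>) auto
  have restr: "restrict (?h u) (block d' i) = ?hb i (restrict u (block d (\<pi> i)))" if "i < k" for i u
    using blocks[OF that] block_subset_comps[OF that, of d'] by (intro restrict_coordinate_map) auto
  have Ci: "copula_measure M' (block d' i) Y = distr (copula_measure M (block d (\<pi> i)) X) (block_cube d' i) (?hb i)"
    if i: "i < k" for i
  proof -
    note m = measurable_unit_cube_restrict[OF block_subset_comps[OF i, of d']]
      measurable_unit_cube_restrict[OF block_subset_comps[OF \<pi>_less[OF i], of d]]
    have "copula_measure M' (block d' i) Y =
      distr (distr (joint_copula M k d X) (cube k d') ?h) (block_cube d' i) (\<lambda>u. restrict u (block d' i))"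
      by (simp only: cop[symmetric] has_density_copula_blockD(3)[OF Y' i])
    also have "\<dots> = distr (joint_copula M k d X) (block_cube d' i) (\<lambda>u. ?hb i (restrict u (block d (\<pi> i))))"
      using h m by (subst distr_distr) (simp_all add: comp_def restr[OF i])
    also have "\<dots> = distr (distr (joint_copula M k d X) (block_cube d (\<pi> i))
        (\<lambda>u. restrict u (block d (\<pi> i)))) (block_cube d' i) (?hb i)"
      using m hb[OF i] by (subst distr_distr) (simp_all add: comp_def)
    finally show ?thesis by (simp only: has_density_copula_blockD(3)[OF X \<pi>_less[OF i]])
  qed
  fix A assume A: "\<And>i. i < k \<Longrightarrow> A i \<in> sets (block_cube d' i)"
  \<comment> \<open>\<open>B j\<close> is the side, in block \<open>j\<close>, of the preimage of the block event with sides \<open>A i\<close>, where \<open>j = \<pi> i\<close>.\<close>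
  define B where "B j = (let i = inv_into {..<k} \<pi> j in ?hb i -` A i \<inter> space (block_cube d j))" for j
  have B_\<pi>: "B (\<pi> i) = ?hb i -` A i \<inter> space (block_cube d (\<pi> i))" if "i < k" for i
    using \<pi>_bij that by (simp add: B_def bij_betw_inv_into_left)
  have surj: "\<exists>i<k. j = \<pi> i" if "j < k" for j
    using bij_betw_imp_surj_on[OF \<pi>_bij] that by (metis image_iff lessThan_iff)
  have B: "B j \<in> sets (block_cube d j)" if "j < k" for j
    using surj[OF that] measurable_sets[OF hb A] by (auto simp: B_\<pi>)
  have "?h -` block_event k d' A \<inter> space (cube k d) = block_event k d B"
  proof (intro set_eqI iffI)
    fix u assume u: "u \<in> ?h -` block_event k d' A \<inter> space (cube k d)"
    have "restrict u (block d (\<pi> i)) \<in> B (\<pi> i)" if "i < k" for i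
      using u that restrict_in_unit_cube[of u "comps k d", OF _ block_subset_comps[OF \<pi>_less[OF that]]]
      by (auto simp: B_\<pi> block_event_def restr)
    then show "u \<in> block_event k d B" using u surj by (auto simp: block_event_def)
  next
    fix u assume u: "u \<in> block_event k d B"
    then have sp: "u \<in> space (cube k d)" by (simp add: block_event_def)
    have "restrict (?h u) (block d' i) \<in> A i" if "i < k" for i
      using u that \<pi>_less[OF that] by (auto simp: block_event_def restr B_\<pi>)
    with sp measurable_space[OF h sp] show "u \<in> ?h -` block_event k d' A \<inter> space (cube k d)"
      by (simp add: block_event_def)
  qed
  then have "emeasure (distr (block_product M k d X) (cube k d') ?h) (block_event k d' A) =
      emeasure (block_product M k d X) (block_event k d B)"
    using h by (subst emeasure_distr) (auto intro: block_event_sets A)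
  also have "\<dots> = (\<Prod>j<k. emeasure (copula_measure M (block d j) X) (B j))"
    by (intro emeasure_block_product X B)
  also have "\<dots> = (\<Prod>i<k. emeasure (copula_measure M (block d (\<pi> i)) X) (B (\<pi> i)))"
    by (rule prod.reindex_bij_betw[OF \<pi>_bij, symmetric])
  also have "\<dots> = (\<Prod>i<k. emeasure (copula_measure M' (block d' i) Y) (A i))"
    using hb A by (intro prod.cong refl) (simp add: Ci emeasure_distr B_\<pi>)
  finally show "emeasure (distr (block_product M k d X) (cube k d') ?h) (block_event k d' A) =
      (\<Prod>i<k. emeasure (copula_measure M' (block d' i) Y) (A i))" .
qed simp

text \<open>Reflections are their own inverses, so the coordinate map along the inverse of \<open>\<tau>\<close>, with the same
reflections, is a left inverse.\<close>
lemma (in phi_generator) D_Phi_coordinate_map: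
  assumes X: "has_density_copula M k d X"
    and Y: "prob_space M'" "\<And>p. p \<in> comps k d' \<Longrightarrow> Y p \<in> borel_measurable M'"
    and sym: "block_symmetry k d d' \<pi> \<phi> \<tau>"
    and cop: "joint_copula M' k d' Y =
      distr (joint_copula M k d X) (cube k d') (coordinate_map (comps k d') \<phi> \<tau>)"
  shows "D_Phi \<Phi> M' k d' Y = D_Phi \<Phi> M k d X"
proof -
  let ?\<tau>' = "inv_into (comps k d') \<tau>"
  let ?h = "coordinate_map (comps k d') \<phi> \<tau>"
  let ?g = "coordinate_map (comps k d) (\<lambda>q. \<phi> (?\<tau>' q)) ?\<tau>'"
  note bij = block_symmetryD(1)[OF sym] and \<tau> = block_symmetryD(4)[OF sym]
    and \<phi> = block_symmetryD(5)[OF sym] and invol = block_symmetryD(7)[OF sym]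
  have \<tau>': "?\<tau>' q \<in> comps k d'" "\<tau> (?\<tau>' q) = q" if "q \<in> comps k d" for q
    using bij that by (auto simp: bij_betw_def inv_into_into f_inv_into_f)
  have h: "?h \<in> measurable (cube k d) (cube k d')"
    by (intro coordinate_map_measurable \<phi> \<tau>)
  have g: "?g \<in> measurable (cube k d') (cube k d)"
    by (intro coordinate_map_measurable \<phi> \<tau>')
  have gh: "?g (?h u) = u" if "u \<in> space (cube k d)" for u
  proof
    fix q show "?g (?h u) q = u q"
      using that \<tau>'[of q] invol by (cases "q \<in> comps k d") (auto simp: coordinate_map_def space_unit_cube)
  qed
  note Y' = has_density_copula_coordinate_map[OF X Y sym cop]
  have "phi_div (joint_copula M' k d' Y) (block_product M' k d' Y) =
      phi_div (joint_copula M k d X) (block_product M k d X)"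
  proof -
    have "block_product M' k d' Y = distr (block_product M k d X) (cube k d') ?h"
      by (rule block_product_coordinate_map[symmetric]) fact+
    with cop show ?thesis
      using phi_div_distr[OF prob_space_block_product[OF X] has_density_copulaD(2)[OF X] _ has_density_copulaD(5)[OF X],
          of ?h "cube k d'" ?g] h g gh by simp
  qed
  then show ?thesis by (simp add: D_Phi_eq_phi_div X Y')
qed

section \<open>Permutations and monotone transformations\<close>

lemma copula_measure_coordinate_map:
  assumes X: "prob_space M" "\<And>p. p \<in> I \<Longrightarrow> X p \<in> borel_measurable M"
    and \<tau>: "\<And>p. p \<in> I' \<Longrightarrow> \<tau> p \<in> I"
    and \<phi>: "\<And>p. p \<in> I' \<Longrightarrow> \<phi> p \<in> measurable unit_interval unit_interval"
    and Y: "\<And>p \<omega>. p \<in> I' \<Longrightarrow> \<omega> \<in> space M \<Longrightarrow> prob_transform M Y p \<omega> = \<phi> p (prob_transform M X (\<tau> p) \<omega>)"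
  shows "copula_measure M I' Y = distr (copula_measure M I X) (unit_cube I') (coordinate_map I' \<phi> \<tau>)"
proof -
  have "distr (copula_measure M I X) (unit_cube I') (coordinate_map I' \<phi> \<tau>) =
      distr M (unit_cube I') (coordinate_map I' \<phi> \<tau> \<circ> subvector (prob_transform M X) I)"
    unfolding copula_measure_def
    by (intro distr_distr subvector_prob_transform_measurable X coordinate_map_measurable[OF \<phi> \<tau>])
  also have "\<dots> = copula_measure M I' Y"
    unfolding copula_measure_def
    by (intro distr_cong refl) (auto simp: coordinate_map_def subvector_def fun_eq_iff Y \<tau>)
  finally show ?thesis by simp
qed

lemma cdf_distr_eq:
  assumes "X \<in> borel_measurable M"
  shows "cdf (distr M borel X) x = measure M {\<omega> \<in> space M. X \<omega> \<le> x}"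
  using assms by (simp add: cdf_def measure_distr vimage_def Int_def conj_commute)

lemma prob_transform_strict_mono:
  assumes "X p \<in> borel_measurable M" "strict_mono T" "continuous_on UNIV T" "Y p = T \<circ> X p"
  shows "prob_transform M Y p = prob_transform M X p"
proof
  fix \<omega>
  have "T \<circ> X p \<in> borel_measurable M"
    using assms(1) borel_measurable_continuous_onI[OF assms(3)] by (intro measurable_comp)
  then show "prob_transform M Y p \<omega> = prob_transform M X p \<omega>"
    using assms by (simp add: prob_transform_def cdf_distr_eq strict_mono_less_eq del: comp_apply) (simp add: strict_mono_less_eq)
qed

text \<open>\<open>T \<circ> X p\<close> is at most its value at \<open>\<omega>\<close> where \<open>X p\<close> is at least its value at \<open>\<omega>\<close>. Continuity of the
distribution function makes the event of equality negligible, so this event has the complementary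
probability.\<close>
lemma prob_transform_strict_antimono:
  assumes M: "prob_space M" and X: "X p \<in> borel_measurable M" and T: "monotone (<) (>) T" "continuous_on UNIV T"
    and Y: "Y p = T \<circ> X p" and cont: "continuous_on UNIV (cdf (distr M borel (X p)))"
  shows "prob_transform M Y p \<omega> = 1 - prob_transform M X p \<omega>"
proof -
  interpret prob_space M by fact
  interpret D: real_distribution "distr M borel (X p)" using X by (rule real_distribution_distr)
  note X [measurable]
  let ?x = "X p \<omega>"
  have TX: "T \<circ> X p \<in> borel_measurable M"
    using X borel_measurable_continuous_onI[OF T(2)] by (intro measurable_comp)
  have T_le: "T x \<le> T y \<longleftrightarrow> y \<le> x" for x y
    using monotoneD[OF T(1), of x y] monotoneD[OF T(1), of y x] by (cases x y rule: linorder_cases) auto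
  have "isCont (cdf (distr M borel (X p))) ?x" using cont by (simp add: continuous_on_eq_continuous_at)
  then have "measure (distr M borel (X p)) {?x} = 0" by (simp add: D.isCont_cdf)
  then have null: "measure M {\<omega>' \<in> space M. X p \<omega>' = ?x} = 0"
    by (simp add: measure_distr vimage_def Int_def conj_commute)
  have "prob_transform M Y p \<omega> = measure M {\<omega>' \<in> space M. ?x \<le> X p \<omega>'}"
    using TX by (simp add: prob_transform_def Y cdf_distr_eq T_le del: comp_apply) (simp add: T_le)
  also have "{\<omega>' \<in> space M. ?x \<le> X p \<omega>'} = space M - {\<omega>' \<in> space M. X p \<omega>' < ?x}" by auto
  also have "measure M \<dots> = 1 - measure M {\<omega>' \<in> space M. X p \<omega>' < ?x}"
    by (rule prob_compl) measurable
  also have "measure M {\<omega>' \<in> space M. X p \<omega>' < ?x} =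
      measure M ({\<omega>' \<in> space M. X p \<omega>' < ?x} \<union> {\<omega>' \<in> space M. X p \<omega>' = ?x})"
    by (subst finite_measure_Union) (auto simp: null)
  also have "{\<omega>' \<in> space M. X p \<omega>' < ?x} \<union> {\<omega>' \<in> space M. X p \<omega>' = ?x} = {\<omega>' \<in> space M. X p \<omega>' \<le> ?x}"
    by auto
  finally show ?thesis by (simp add: prob_transform_def cdf_distr_eq[OF X])
qed

context phi_generator
begin

lemma D_Phi_permute_blocks:
  assumes X: "has_density_copula M k d X" and \<pi>: "\<pi> permutes {..<k}"
  shows "D_Phi \<Phi> M k (d \<circ> \<pi>) (permute_blocks \<pi> X) = D_Phi \<Phi> M k d X"
proof -
  let ?\<tau> = "\<lambda>(i, j). (\<pi> i, j)"
  have \<pi>_less: "\<pi> i < k \<longleftrightarrow> i < k" for i using permutes_in_image[OF \<pi>, of i] by simp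
  have inj: "inj ?\<tau>" using permutes_inj[OF \<pi>] by (auto simp: inj_on_def)
  have blocks: "?\<tau> ` block (d \<circ> \<pi>) i = block d (\<pi> i)" for i by (auto simp: block_def)
  have im: "?\<tau> ` comps k (d \<circ> \<pi>) = comps k d"
  proof (intro equalityI subsetI)
    fix p assume "p \<in> comps k d"
    then obtain i j where p: "p = (i, j)" "i < k" "j < d i" by (auto simp: comps_def)
    moreover have "\<pi> (inv \<pi> i) = i" using permutes_inverses(1)[OF \<pi>] by simp
    ultimately show "p \<in> ?\<tau> ` comps k (d \<circ> \<pi>)"
      using \<pi>_less[of "inv \<pi> i"] by (auto simp: comps_def intro!: image_eqI[of _ _ "(inv \<pi> i, j)"])
  qed (auto simp: comps_def \<pi>_less)
  have bij: "bij_betw ?\<tau> (comps k (d \<circ> \<pi>)) (comps k d)"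
    using inj im by (auto simp: bij_betw_def intro: inj_on_subset)
  have \<tau>: "?\<tau> p \<in> comps k d" if "p \<in> comps k (d \<circ> \<pi>)" for p using im that by blast
  have Y: "permute_blocks \<pi> X p = X (?\<tau> p)" for p by (cases p) (simp add: permute_blocks_def)
  have cop: "copula_measure M (comps k (d \<circ> \<pi>)) (permute_blocks \<pi> X) =
      distr (joint_copula M k d X) (unit_cube (comps k (d \<circ> \<pi>)))
        (coordinate_map (comps k (d \<circ> \<pi>)) (\<lambda>_ t. t) ?\<tau>)"
    using has_density_copulaD[OF X] \<tau>
    by (intro copula_measure_coordinate_map) (simp_all add: prob_transform_def Y)
  show ?thesis
    by (rule D_Phi_coordinate_map[OF X _ _ _ cop, where \<pi> = \<pi>])
       (use has_density_copulaD[OF X] \<tau> bij \<pi> blocks in \<open>simp_all add: Y block_symmetry_def\<close>)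
qed

lemma D_Phi_permute_within:
  assumes X: "has_density_copula M k d X" and i: "i < k" and \<sigma>: "\<sigma> permutes {..<d i}"
  shows "D_Phi \<Phi> M k d (permute_within i \<sigma> X) = D_Phi \<Phi> M k d X"
proof -
  let ?\<tau> = "\<lambda>(i', j). if i' = i then (i, \<sigma> j) else (i', j)"
  have \<sigma>_less: "\<sigma> j < d i \<longleftrightarrow> j < d i" for j using permutes_in_image[OF \<sigma>, of j] by simp
  have inj: "inj ?\<tau>" using permutes_inj[OF \<sigma>] by (auto simp: inj_on_def split: if_splits)
  have blocks: "?\<tau> ` block d i' = block d (id i')" for i'
  proof (cases "i' = i")
    case True
    have "?\<tau> ` block d i = {i} \<times> (\<sigma> ` {..<d i})" by (auto simp: block_def image_iff)
    with True show ?thesis by (simp add: permutes_image[OF \<sigma>] block_def)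
  qed (auto simp: block_def image_iff)
  then have im: "?\<tau> ` comps k d = comps k d"
    unfolding comps_eq_Union_block image_UN by simp
  have bij: "bij_betw ?\<tau> (comps k d) (comps k d)"
    using inj im by (auto simp: bij_betw_def intro: inj_on_subset)
  have \<tau>: "?\<tau> p \<in> comps k d" if "p \<in> comps k d" for p using im that by blast
  have Y: "permute_within i \<sigma> X p = X (?\<tau> p)" for p by (cases p) (simp add: permute_within_def)
  have cop: "copula_measure M (comps k d) (permute_within i \<sigma> X) =
      distr (joint_copula M k d X) (cube k d) (coordinate_map (comps k d) (\<lambda>_ t. t) ?\<tau>)"
    using has_density_copulaD[OF X] \<tau>
    by (intro copula_measure_coordinate_map) (simp_all add: prob_transform_def Y)
  show ?thesis
    by (rule D_Phi_coordinate_map[OF X _ _ _ cop, where \<pi> = id])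
       (use has_density_copulaD[OF X] \<tau> bij blocks in \<open>simp_all add: Y block_symmetry_def permutes_id\<close>)
qed

lemma D_Phi_eq_if_copula_measure_eq:
  assumes X: "has_density_copula M k d X" and Y: "has_density_copula M' k d Y"
    and eq: "joint_copula M' k d Y = joint_copula M k d X"
  shows "D_Phi \<Phi> M' k d Y = D_Phi \<Phi> M k d X"
proof -
  have "block_product M' k d Y = block_product M k d X"
  proof (rule block_product_eqI[OF X])
    fix A assume A: "\<And>i. i < k \<Longrightarrow> A i \<in> sets (block_cube d i)"
    have "copula_measure M' (block d i) Y = copula_measure M (block d i) X" if "i < k" for i
      using has_density_copula_blockD(3)[OF X that] has_density_copula_blockD(3)[OF Y that] eq by simp
    then show "emeasure (block_product M' k d Y) (block_event k d A) =
        (\<Prod>i<k. emeasure (copula_measure M (block d i) X) (A i))"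
      by (simp add: emeasure_block_product[OF Y A])
  qed simp
  then show ?thesis by (simp add: D_Phi_eq_phi_div X Y eq)
qed

lemma D_Phi_strict_mono:
  assumes X: "has_density_copula M k d X"
    and T: "\<And>p. p \<in> comps k d \<Longrightarrow> strict_mono (T p) \<and> continuous_on UNIV (T p)"
  shows "D_Phi \<Phi> M k d (\<lambda>p. T p \<circ> X p) = D_Phi \<Phi> M k d X"
proof -
  have meas: "T p \<circ> X p \<in> borel_measurable M" if "p \<in> comps k d" for p
    using has_density_copulaD(3)[OF X that] T[OF that]
    by (intro measurable_comp[OF _ borel_measurable_continuous_onI]) auto
  have eq: "copula_measure M (comps k d) (\<lambda>p. T p \<circ> X p) = joint_copula M k d X"
    using has_density_copulaD(3)[OF X] T
    by (intro copula_measure_cong fun_cong[OF prob_transform_strict_mono]) auto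
  with X meas have "has_density_copula M k d (\<lambda>p. T p \<circ> X p)" by (simp add: has_density_copula_def)
  then show ?thesis by (rule D_Phi_eq_if_copula_measure_eq[OF X _ eq])
qed

lemma D_Phi_strict_antimono:
  assumes X: "has_density_copula M k d X" and p: "p \<in> comps k d"
    and T: "monotone (<) (>) T" "continuous_on UNIV T"
    and cont: "continuous_on UNIV (cdf (distr M borel (X p)))"
  shows "D_Phi \<Phi> M k d (X(p := T \<circ> X p)) = D_Phi \<Phi> M k d X"
proof -
  note X' = has_density_copulaD[OF X]
  define \<phi> where "\<phi> q t = (if q = p then 1 - t else t)" for q :: "nat \<times> nat" and t :: real
  have sym: "block_symmetry k d d id \<phi> id"
  proof -
    have "\<phi> q = (\<lambda>t. t) \<or> \<phi> q = (\<lambda>t. 1 - t)" for q by (cases "q = p") (simp_all add: \<phi>_def[abs_def])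
    then show ?thesis unfolding block_symmetry_def by (simp add: permutes_id)
  qed
  have meas: "(X(p := T \<circ> X p)) q \<in> borel_measurable M" if "q \<in> comps k d" for q
    using X'(3)[OF that] X'(3)[OF p] measurable_comp[OF X'(3)[OF p] borel_measurable_continuous_onI[OF T(2)]]
    by (cases "q = p") auto
  have pt: "prob_transform M (X(p := T \<circ> X p)) q \<omega> = \<phi> q (prob_transform M X q \<omega>)" for q \<omega>
  proof (cases "q = p")
    case True
    then show ?thesis
      using prob_transform_strict_antimono[where X = X and p = p and Y = "X(p := T \<circ> X p)" and \<omega> = \<omega>,
          OF X'(1) X'(3)[OF p] T _ cont]
      by (simp add: \<phi>_def)
  next
    case False
    then show ?thesis by (simp add: \<phi>_def prob_transform_def)
  qed
  have cop: "copula_measure M (comps k d) (X(p := T \<circ> X p)) =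
      distr (joint_copula M k d X) (cube k d) (coordinate_map (comps k d) \<phi> id)"
    by (intro copula_measure_coordinate_map X'(1,3) block_symmetryD(5)[OF sym]) (simp_all add: pt)
  show ?thesis
    by (rule D_Phi_coordinate_map[OF X X'(1) meas sym cop])
qed

end

lemma sets_unit_interval_sigma:
  "sets unit_interval = sets (sigma {0..1} (range (\<lambda>a. {0..1} \<inter> {..a})))"
proof -
  have borel: "sets borel = sigma_sets UNIV (range (\<lambda>a::real. {..a}))"
    unfolding borel_eq_atMost by (rule sets_measure_of) simp
  have "sets unit_interval = (\<inter>) {0..1} ` sigma_sets UNIV (range (\<lambda>a::real. {..a}))"
    by (simp add: sets_restrict_space borel)
  also have "\<dots> = sigma_sets {0..1} ((\<inter>) {0..1} ` range (\<lambda>a::real. {..a}))"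
    by (rule sigma_sets_Int) (simp_all flip: borel)
  also have "\<dots> = sets (sigma {0..1} (range (\<lambda>a. {0..1} \<inter> {..a})))"
    by (subst sets_measure_of) (auto simp: image_image)
  finally show ?thesis .
qed

lemma copula_measure_box:
  assumes X: "prob_space M" "\<And>p. p \<in> I \<Longrightarrow> X p \<in> borel_measurable M" and I: "finite I"
    and u: "u \<in> space (unit_cube I)"
  shows "measure (copula_measure M I X) (PiE I (\<lambda>p. {0..1} \<inter> {..u p})) = copula M I X u"
proof -
  have meas: "prob_transform M X p \<in> measurable M unit_interval" if "p \<in> I" for p
    by (rule prob_transform_measurable[of M X p, OF X(1) X(2)[OF that]])
  have "PiE I (\<lambda>p. {0..1} \<inter> {..u p}) \<in> sets (unit_cube I)"
    unfolding unit_cube_def by (intro sets_PiM_I_finite I) (auto simp: sets_restrict_space)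
  then have "measure (copula_measure M I X) (PiE I (\<lambda>p. {0..1} \<inter> {..u p})) =
      measure M (subvector (prob_transform M X) I -` PiE I (\<lambda>p. {0..1} \<inter> {..u p}) \<inter> space M)"
    unfolding copula_measure_def
    using subvector_prob_transform_measurable[of M I X, OF X] by (subst measure_distr) auto
  also have "subvector (prob_transform M X) I -` PiE I (\<lambda>p. {0..1} \<inter> {..u p}) \<inter> space M =
      {\<omega> \<in> space M. \<forall>p\<in>I. prob_transform M X p \<omega> \<le> u p}"
    using measurable_space[OF meas] by (auto simp: subvector_def space_restrict_space PiE_iff)
  finally show ?thesis by (simp add: copula_def)
qed

text \<open>On the unit cube the sets \<open>{v. \<forall>p. v p \<le> a p}\<close> form a generating system closed under intersection, and
the copula gives their measures. The bounds \<open>a\<close> are arbitrary reals, so that the system arises from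
that of \<open>{..a}\<close> by restriction; bounds above \<open>1\<close> are cut off at \<open>1\<close>, and a negative bound gives the
empty set.\<close>
lemma copula_measure_eqI:
  assumes X: "prob_space M" "\<And>p. p \<in> I \<Longrightarrow> X p \<in> borel_measurable M"
    and Y: "prob_space M'" "\<And>p. p \<in> I \<Longrightarrow> Y p \<in> borel_measurable M'" and I: "finite I"
    and eq: "\<And>u. u \<in> space (unit_cube I) \<Longrightarrow> copula M' I Y u = copula M I X u"
  shows "copula_measure M' I Y = copula_measure M I X"
proof -
  interpret P: prob_space "copula_measure M I X" by (rule prob_space_copula_measure[OF X])
  interpret P': prob_space "copula_measure M' I Y" by (rule prob_space_copula_measure[OF Y])
  define E where "E = {{f \<in> PiE I (\<lambda>_. {0..1::real}). \<forall>i\<in>j. f i \<in> A i} | A j. j \<in> {I} \<and>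
    A \<in> Pi j (\<lambda>_. range (\<lambda>a. {0..1} \<inter> {..a}))}"
  have sets: "sets (unit_cube I) = sigma_sets (PiE I (\<lambda>_. {0..1})) E"
  proof -
    have "sets (unit_cube I) = sets (PiM I (\<lambda>_. sigma {0..1} (range (\<lambda>a. {0..1::real} \<inter> {..a}))))"
      unfolding unit_cube_def by (intro sets_PiM_cong refl sets_unit_interval_sigma)
    also have "\<dots> = sets (sigma (PiE I (\<lambda>_. {0..1})) E)"
      unfolding E_def
    proof (rule sets_PiM_sigma)
      show "\<exists>S\<subseteq>range (\<lambda>a. {0..1::real} \<inter> {..a}). countable S \<and> {0..1} = \<Union>S"
        by (rule exI[of _ "{{0..1} \<inter> {..1}}"]) auto
      show "range (\<lambda>a. {0..1::real} \<inter> {..a}) \<subseteq> Pow {0..1}" by auto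
      show "\<And>j. j \<in> {I} \<Longrightarrow> finite j" "\<Union>{I} = I" using I by auto
    qed
    also have "\<dots> = sigma_sets (PiE I (\<lambda>_. {0..1})) E"
      by (intro sets_measure_of) (auto simp: E_def)
    finally show ?thesis .
  qed
  have E_box: "\<exists>a. S = PiE I (\<lambda>p. {0..1} \<inter> {..a p})" if "S \<in> E" for S
  proof -
    from that obtain A where A: "S = {f \<in> PiE I (\<lambda>_. {0..1}). \<forall>i\<in>I. f i \<in> A i}"
      "A \<in> Pi I (\<lambda>_. range (\<lambda>a. {0..1} \<inter> {..a}))"
      by (auto simp: E_def)
    then have "\<forall>p\<in>I. \<exists>a. A p = {0..1} \<inter> {..a}" by blast
    then obtain a where a: "\<And>p. p \<in> I \<Longrightarrow> A p = {0..1} \<inter> {..a p}" by metis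
    have "S = PiE I (\<lambda>p. {0..1} \<inter> {..a p})"
      unfolding A(1) using a by (simp add: PiE_iff set_eq_iff Ball_def) blast
    then show ?thesis by blast
  qed
  have box_E: "PiE I (\<lambda>p. {0..1} \<inter> {..a p}) \<in> E" for a
  proof -
    have "PiE I (\<lambda>p. {0..1} \<inter> {..a p}) =
        {f \<in> PiE I (\<lambda>_. {0..1}). \<forall>i\<in>I. f i \<in> (\<lambda>p. {0..1} \<inter> {..a p}) i}"
      by (simp add: PiE_iff set_eq_iff) blast
    moreover have "(\<lambda>p. {0..1} \<inter> {..a p}) \<in> Pi I (\<lambda>_. range (\<lambda>a. {0..1} \<inter> {..a}))" by blast
    ultimately show ?thesis
      unfolding E_def mem_Collect_eq by (intro exI[of _ "\<lambda>p. {0..1} \<inter> {..a p}"] exI[of _ I] conjI) simp_all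
  qed
  show ?thesis
  proof (rule measure_eqI_generator_eq[where E = E and \<Omega> = "PiE I (\<lambda>_. {0..1})"])
    show "Int_stable E"
    proof (rule Int_stableI)
      fix S T assume "S \<in> E" "T \<in> E"
      then obtain a b where S: "S = PiE I (\<lambda>p. {0..1} \<inter> {..a p})" and T: "T = PiE I (\<lambda>p. {0..1} \<inter> {..b p})"
        using E_box by metis
      have "S \<inter> T = PiE I (\<lambda>p. {0..1} \<inter> {..min (a p) (b p)})" unfolding S T by (auto simp: PiE_iff)
      then show "S \<inter> T \<in> E" using box_E by (simp only:)
    qed
    show "E \<subseteq> Pow (PiE I (\<lambda>_. {0..1}))" by (auto simp: E_def)
    show "sets (copula_measure M' I Y) = sigma_sets (PiE I (\<lambda>_. {0..1})) E"
      "sets (copula_measure M I X) = sigma_sets (PiE I (\<lambda>_. {0..1})) E"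
      by (simp_all add: sets)
    show "range (\<lambda>_::nat. PiE I (\<lambda>_. {0..1} \<inter> {..1})) \<subseteq> E"
      using box_E[of "\<lambda>_. 1"] by (simp only: image_subset_iff) blast
    show "(\<Union>i::nat. PiE I (\<lambda>_. {0..1} \<inter> {..1})) = PiE I (\<lambda>_. {0..1::real})" by (auto simp: PiE_iff)
    show "emeasure (copula_measure M' I Y) (PiE I (\<lambda>_. {0..1} \<inter> {..1})) \<noteq> \<infinity>" for i :: nat by simp
    fix S assume "S \<in> E"
    then obtain a where S: "S = PiE I (\<lambda>p. {0..1} \<inter> {..a p})" using E_box by blast
    show "emeasure (copula_measure M' I Y) S = emeasure (copula_measure M I X) S"
    proof (cases "\<forall>p\<in>I. 0 \<le> a p")
      case True
      define u where "u = (\<lambda>p\<in>I. min 1 (a p))"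
      have u: "u \<in> space (unit_cube I)" using True by (auto simp: u_def space_unit_cube)
      have "S = PiE I (\<lambda>p. {0..1} \<inter> {..u p})" unfolding S by (intro PiE_cong) (auto simp: u_def)
      then show ?thesis
        using copula_measure_box[of M I X u, OF X I u] copula_measure_box[of M' I Y u, OF Y I u] eq[OF u]
        by (simp add: P.emeasure_eq_measure P'.emeasure_eq_measure)
    next
      case False
      then have "S = {}" unfolding S by (fastforce simp: PiE_iff)
      then show ?thesis by simp
    qed
  qed
qed

section \<open>Independence in terms of copulas\<close>

text \<open>The points \<open>x > r\<close> with \<open>F x = F r\<close> form an interval starting at \<open>r\<close>, which is a countable union of
intervals \<open>(r, q]\<close>, each of probability \<open>F q - F r = 0\<close>.\<close>
lemma AE_not_flat_cdf:
  assumes "real_distribution D"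
  shows "AE x in D. \<not> (r < x \<and> cdf D x = cdf D r)"
proof -
  interpret real_distribution D by fact
  define S where "S = {x. r < x \<and> cdf D x = cdf D r}"
  have null: "AE x in D. x \<notin> {r<..q}" if "q \<in> S" for q
  proof -
    have "emeasure D {r<..q} = 0" using that emeasure_Ioc[of r q] by (simp add: S_def)
    then have "{r<..q} \<in> null_sets D" by (intro null_setsI) auto
    then show ?thesis by (rule AE_not_in)
  qed
  obtain m where m: "(\<exists>m\<in>S. \<forall>x\<in>S. x \<le> m) \<Longrightarrow> m \<in> S \<and> (\<forall>x\<in>S. x \<le> m)"
    by blast
  \<comment> \<open>Right endpoints: rational points of \<open>S\<close>, and the greatest element of \<open>S\<close> in case there is one.\<close>
  define K where "K = (\<rat> \<inter> S) \<union> ({m} \<inter> S)"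
  have "countable K" by (simp add: K_def countable_rat countable_Int1)
  moreover have "\<forall>q\<in>K. AE x in D. x \<notin> {r<..q}"
    using null by (auto simp only: K_def)
  ultimately have "AE x in D. \<forall>q\<in>K. x \<notin> {r<..q}"
    by (subst AE_ball_countable)
  then show ?thesis
  proof eventually_elim
    case (elim x)
    show ?case
    proof
      assume x: "r < x \<and> cdf D x = cdf D r"
      then have xS: "x \<in> S" by (simp add: S_def)
      show False
      proof (cases "\<exists>m\<in>S. \<forall>x\<in>S. x \<le> m")
        case True
        then have "m \<in> K" "x \<le> m" using m xS by (auto simp: K_def)
        then show False using elim x by auto
      next
        case False
        then obtain y where y: "y \<in> S" "x < y" using xS by (auto simp: not_le)
        obtain q where q: "q \<in> \<rat>" "x < q" "q < y" using Rats_dense_in_real[OF y(2)] by blast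
        have "cdf D r \<le> cdf D q" "cdf D q \<le> cdf D y" using q x by (auto intro: cdf_nondecreasing)
        then have "q \<in> K" using q x y by (auto simp: K_def S_def)
        then show False using elim x q by auto
      qed
    qed
  qed
qed

text \<open>By the preceding lemma, applied to all rational \<open>r\<close>, almost every value \<open>x\<close> of \<open>X p\<close> is one below which
\<open>F\<close> is strictly smaller than \<open>F x\<close>. At such \<open>x\<close> the quantile function \<open>I\<close> returns \<open>x\<close> from \<open>F x\<close>.\<close>
lemma prob_transform_inverse:
  assumes M: "prob_space M" and X: "X p \<in> borel_measurable M"
  shows "\<exists>g\<in>measurable unit_interval borel. AE \<omega> in M. g (prob_transform M X p \<omega>) = X p \<omega>"
proof -
  interpret prob_space M by fact
  define D where "D = distr M borel (X p)"
  interpret D: cdf_distribution D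
    unfolding D_def by (intro cdf_distribution.intro real_distribution_distr X)
  let ?F = "cdf D"
  define I where "I t = Inf {x. t \<le> ?F x}" for t
  \<comment> \<open>The quantile function is measurable on the open interval by monotonicity, and \<open>F x\<close> may be \<open>1\<close>; the value \<open>0\<close> does not occur at the points considered.\<close>
  define g where "g t = (if t = 1 then I 1 else indicator {0<..<1} t *\<^sub>R I t)" for t :: real
  have "I \<in> borel_measurable (restrict_space borel {0<..<1})"
    using D.measurable_CI unfolding I_def[abs_def] .
  then have [measurable]: "(\<lambda>t. indicator {0<..<1} t *\<^sub>R I t) \<in> borel_measurable borel"
    by (subst (asm) borel_measurable_restrict_space_iff) auto
  have "g \<in> borel_measurable borel" unfolding g_def[abs_def] by measurable
  then have g: "g \<in> measurable unit_interval borel"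
    by (intro measurable_restrict_space1) simp
  have "AE x in D. \<forall>r\<in>\<rat>. \<not> (r < x \<and> ?F x = ?F r)"
    using AE_not_flat_cdf[OF D.real_distribution_axioms] by (simp add: AE_ball_countable countable_rat)
  then have "AE x in D. g (?F x) = x"
  proof eventually_elim
    case (elim x)
    have less: "?F y < ?F x" if yx: "y < x" for y
    proof (rule ccontr)
      assume "\<not> ?F y < ?F x"
      obtain r where r: "r \<in> \<rat>" "y < r" "r < x" using Rats_dense_in_real[OF yx] by blast
      have "?F y \<le> ?F r" "?F r \<le> ?F x" using r by (auto intro: D.cdf_nondecreasing)
      with \<open>\<not> ?F y < ?F x\<close> have "?F x = ?F r" by simp
      with elim r show False by blast
    qed
    have "{y. ?F x \<le> ?F y} = {x..}"
      using less D.cdf_nondecreasing by (auto simp: not_less[symmetric])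
    then have "I (?F x) = x" by (simp add: I_def)
    moreover have "0 < ?F x" using less[of "x - 1"] D.cdf_nonneg[of "x - 1"] by linarith
    ultimately show ?case using D.cdf_bounded_prob[of x] by (auto simp: g_def less_le)
  qed
  then have "AE \<omega> in M. g (?F (X p \<omega>)) = X p \<omega>"
    unfolding D_def by (rule AE_distrD[OF X])
  with g show ?thesis by (auto simp: prob_transform_def D_def)
qed

lemma subvector_measurable:
  "(\<And>p. p \<in> J \<Longrightarrow> X p \<in> borel_measurable M) \<Longrightarrow> subvector X J \<in> measurable M (PiM J (\<lambda>_. borel))"
  unfolding subvector_def by (intro measurable_restrict)

lemma prob_transform_subvector_factors:
  assumes M: "prob_space M" and X: "\<And>p. p \<in> J \<Longrightarrow> X p \<in> borel_measurable M"
  shows "\<exists>H\<in>measurable (PiM J (\<lambda>_. borel)) (unit_cube J).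
    AE \<omega> in M. H (subvector X J \<omega>) = subvector (prob_transform M X) J \<omega>"
proof (rule bexI)
  interpret prob_space M by fact
  let ?H = "\<lambda>x. \<lambda>p\<in>J. cdf (distr M borel (X p)) (x p)"
  show "?H \<in> measurable (PiM J (\<lambda>_. borel)) (unit_cube J)"
  proof (rule measurable_unit_cubeI)
    fix p assume p: "p \<in> J"
    interpret D: cdf_distribution "distr M borel (X p)"
      by (intro cdf_distribution.intro real_distribution_distr X p)
    have "cdf (distr M borel (X p)) \<in> measurable borel unit_interval"
      using D.cdf_bounded_prob D.cdf_nonneg D.measurable_C by (intro measurable_restrict_space2) auto
    then show "(\<lambda>x. cdf (distr M borel (X p)) (x p)) \<in> measurable (PiM J (\<lambda>_. borel)) unit_interval"
      by (rule measurable_compose[OF measurable_component_singleton[OF p]])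
  qed
  show "AE \<omega> in M. ?H (subvector X J \<omega>) = subvector (prob_transform M X) J \<omega>"
    by (auto simp: subvector_def prob_transform_def fun_eq_iff)
qed

lemma subvector_prob_transform_factors:
  assumes M: "prob_space M" and X: "\<And>p. p \<in> J \<Longrightarrow> X p \<in> borel_measurable M" and J: "finite J"
  shows "\<exists>G\<in>measurable (unit_cube J) (PiM J (\<lambda>_. borel)).
    AE \<omega> in M. G (subvector (prob_transform M X) J \<omega>) = subvector X J \<omega>"
proof -
  have "\<exists>g\<in>measurable unit_interval borel. AE \<omega> in M. g (prob_transform M X p \<omega>) = X p \<omega>" if "p \<in> J" for p
    by (rule prob_transform_inverse[where X = X and p = p, OF M X[OF that]])
  then obtain g where g: "\<And>p. p \<in> J \<Longrightarrow> g p \<in> measurable unit_interval borel"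
    "\<And>p. p \<in> J \<Longrightarrow> AE \<omega> in M. g p (prob_transform M X p \<omega>) = X p \<omega>" by metis
  have "AE \<omega> in M. \<forall>p\<in>J. g p (prob_transform M X p \<omega>) = X p \<omega>"
    by (rule AE_finite_allI[OF J g(2)])
  then have "AE \<omega> in M. (\<lambda>u. \<lambda>p\<in>J. g p (u p)) (subvector (prob_transform M X) J \<omega>) = subvector X J \<omega>"
    by eventually_elim (auto simp: subvector_def fun_eq_iff)
  moreover have "(\<lambda>u. \<lambda>p\<in>J. g p (u p)) \<in> measurable (unit_cube J) (PiM J (\<lambda>_. borel))"
    by (intro measurable_restrict measurable_compose[OF measurable_unit_cube_component g(1)])
  ultimately show ?thesis by (rule bexI[where x = "\<lambda>u. \<lambda>p\<in>J. g p (u p)"])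
qed

lemma (in prob_space) indep_vars_AE_cong:
  assumes "I \<noteq> {}" "finite I" "indep_vars N X I" "\<And>i. i \<in> I \<Longrightarrow> Y i \<in> measurable M (N i)"
    and "\<And>i. i \<in> I \<Longrightarrow> AE \<omega> in M. X i \<omega> = Y i \<omega>"
  shows "indep_vars N Y I"
proof -
  have X: "X i \<in> measurable M (N i)" if "i \<in> I" for i
    using assms(3) that by (simp add: indep_vars_def2)
  have ae: "AE \<omega> in M. \<forall>i\<in>I. X i \<omega> = Y i \<omega>"
    by (rule AE_finite_allI) fact+
  have "distr M (PiM I N) (\<lambda>\<omega>. \<lambda>i\<in>I. X i \<omega>) = distr M (PiM I N) (\<lambda>\<omega>. \<lambda>i\<in>I. Y i \<omega>)"
    using ae by (intro distr_cong_AE measurable_restrict X assms(4) refl)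
      (auto elim!: eventually_mono simp: fun_eq_iff)
  moreover have "PiM I (\<lambda>i. distr M (N i) (X i)) = PiM I (\<lambda>i. distr M (N i) (Y i))"
    by (intro PiM_cong refl distr_cong_AE X assms)
  ultimately show ?thesis
    using assms X by (simp add: indep_vars_iff_distr_eq_PiM')
qed

lemma (in prob_space) indep_var_AE_cong:
  assumes "indep_var S X T Y" "X' \<in> measurable M S" "Y' \<in> measurable M T"
    and "AE \<omega> in M. X \<omega> = X' \<omega>" "AE \<omega> in M. Y \<omega> = Y' \<omega>"
  shows "indep_var S X' T Y'"
proof -
  have [measurable]: "X \<in> measurable M S" "Y \<in> measurable M T"
    using assms(1) by (simp_all add: indep_var_distribution_eq)
  note assms(2,3)[measurable]
  have "distr M S X = distr M S X'" "distr M T Y = distr M T Y'"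
    using assms by (auto intro!: distr_cong_AE)
  moreover have "distr M (S \<Otimes>\<^sub>M T) (\<lambda>\<omega>. (X \<omega>, Y \<omega>)) = distr M (S \<Otimes>\<^sub>M T) (\<lambda>\<omega>. (X' \<omega>, Y' \<omega>))"
    using assms(4,5) by (intro distr_cong_AE) (auto elim: eventually_elim2)
  ultimately show ?thesis using assms by (simp add: indep_var_distribution_eq)
qed

lemma (in prob_space) indep_vars_AE_factors:
  assumes I: "I \<noteq> {}" "finite I" and indep: "indep_vars N X I"
    and Y: "\<And>i. i \<in> I \<Longrightarrow> Y i \<in> measurable M (N' i)"
    and factors: "\<And>i. i \<in> I \<Longrightarrow> \<exists>G\<in>measurable (N i) (N' i). AE \<omega> in M. G (X i \<omega>) = Y i \<omega>"
  shows "indep_vars N' Y I"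
proof -
  obtain G where G: "\<And>i. i \<in> I \<Longrightarrow> G i \<in> measurable (N i) (N' i)" "\<And>i. i \<in> I \<Longrightarrow> AE \<omega> in M. G i (X i \<omega>) = Y i \<omega>"
    using factors by metis
  show ?thesis by (rule indep_vars_AE_cong[OF I indep_vars_compose2[OF indep G(1)] Y G(2)])
qed

lemma (in prob_space) indep_var_AE_factors:
  assumes indep: "indep_var S X T Y" and "X' \<in> measurable M S'" "Y' \<in> measurable M T'"
    and "\<exists>G\<in>measurable S S'. AE \<omega> in M. G (X \<omega>) = X' \<omega>" "\<exists>H\<in>measurable T T'. AE \<omega> in M. H (Y \<omega>) = Y' \<omega>"
  shows "indep_var S' X' T' Y'"
proof -
  obtain G H where "G \<in> measurable S S'" "AE \<omega> in M. G (X \<omega>) = X' \<omega>" "H \<in> measurable T T'" "AE \<omega> in M. H (Y \<omega>) = Y' \<omega>"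
    using assms(4,5) by blast
  then show ?thesis
    using indep_var_AE_cong[OF indep_var_compose[OF indep] assms(2,3)] by (simp add: comp_def)
qed

lemma (in prob_space) indep_var_commute:
  assumes "indep_var S X T Y"
  shows "indep_var T Y S X"
proof -
  have "indep_set B A" if "indep_set A B" for A B
    by (intro indep_setI indep_setD_ev1[OF that] indep_setD_ev2[OF that])
       (metis indep_setD[OF that] Int_commute mult.commute)
  then show ?thesis using assms unfolding indep_var_eq by blast
qed

text \<open>Each block and its transform are measurable functions of each other, almost surely, and independence
is inherited by measurable functions.\<close>
lemma mutually_independent_iff_prob_transform:
  assumes M: "prob_space M" and X: "\<And>p. p \<in> comps k d \<Longrightarrow> X p \<in> borel_measurable M" and k: "1 \<le> k"
  shows "mutually_independent M k d X \<longleftrightarrow>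
    prob_space.indep_vars M (\<lambda>i. block_cube d i) (\<lambda>i. subvector (prob_transform M X) (block d i)) {..<k}"
proof -
  interpret prob_space M by fact
  have Xi: "X p \<in> borel_measurable M" if "i \<in> {..<k}" "p \<in> block d i" for i p
    using block_subset_comps[of i k d] that X by blast
  have ne: "{..<k} \<noteq> {}" using k by (simp add: lessThan_empty_iff)
  note factors = subvector_prob_transform_factors[OF M Xi finite_block] prob_transform_subvector_factors[OF M Xi]
    and meas = subvector_measurable[OF Xi] subvector_prob_transform_measurable[OF M Xi]
  show ?thesis
    unfolding mutually_independent_def
    by (intro iffI; rule indep_vars_AE_factors[OF ne finite_lessThan]; (assumption | rule meas factors)?)
qed

text \<open>Independence of the transformed blocks is the product formula for block events, which characterizes
the product of the block copulas.\<close>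
lemma mutually_independent_iff:
  assumes X: "has_density_copula M k d X" and k: "1 \<le> k"
  shows "mutually_independent M k d X \<longleftrightarrow> joint_copula M k d X = block_product M k d X"
proof -
  note X' = has_density_copulaD[OF X]
  interpret prob_space M by (rule X')
  let ?U = "\<lambda>i. subvector (prob_transform M X) (block d i)"
  have Xi: "X p \<in> borel_measurable M" if "i < k" "p \<in> block d i" for i p
    using block_subset_comps[OF that(1), of d] that(2) X' by blast
  have U: "?U i \<in> measurable M (block_cube d i)" if "i < k" for i
    by (intro subvector_prob_transform_measurable X'(1) Xi[OF that])
  have UA: "subvector (prob_transform M X) (comps k d) \<in> measurable M (cube k d)"
    by (intro subvector_prob_transform_measurable X')
  have joint: "emeasure (joint_copula M k d X) (block_event k d A) =
      ennreal (prob (\<Inter>i<k. ?U i -` A i \<inter> space M))"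
    if A: "\<And>i. i < k \<Longrightarrow> A i \<in> sets (block_cube d i)" for A
  proof -
    have r: "restrict (subvector (prob_transform M X) (comps k d) \<omega>) (block d i) = ?U i \<omega>" if "i < k" for i \<omega>
      using block_subset_comps[OF that, of d] by (auto simp: subvector_def fun_eq_iff restrict_def)
    have "subvector (prob_transform M X) (comps k d) -` block_event k d A \<inter> space M = (\<Inter>i<k. ?U i -` A i \<inter> space M)"
      using measurable_space[OF UA] k by (auto simp: block_event_def r lessThan_empty_iff)
    then show ?thesis
      unfolding copula_measure_def using UA
      by (subst emeasure_distr) (auto intro: block_event_sets A simp: emeasure_eq_measure)
  qed
  have marg: "(\<Prod>i<k. emeasure (copula_measure M (block d i) X) (A i)) =
      ennreal (\<Prod>i<k. prob (?U i -` A i \<inter> space M))"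
    if A: "\<And>i. i < k \<Longrightarrow> A i \<in> sets (block_cube d i)" for A
  proof -
    have "(\<Prod>i<k. emeasure (copula_measure M (block d i) X) (A i)) = (\<Prod>i<k. ennreal (prob (?U i -` A i \<inter> space M)))"
      unfolding copula_measure_def using U A
      by (intro prod.cong refl) (simp add: emeasure_distr emeasure_eq_measure)
    then show ?thesis by (simp add: prod_ennreal)
  qed
  have "indep_vars (\<lambda>i. block_cube d i) ?U {..<k} \<longleftrightarrow>
    (\<forall>A\<in>(\<Pi> i\<in>{..<k}. sets (block_cube d i)).
      prob (\<Inter>j\<in>{..<k}. ?U j -` A j \<inter> space M) = (\<Prod>j\<in>{..<k}. prob (?U j -` A j \<inter> space M)))"
    using k U
    by (intro indep_vars_finite)
       (use sets.space_closed in \<open>auto simp: sets.sigma_sets_eq sets.Int_stable lessThan_empty_iff\<close>)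
  also have "\<dots> \<longleftrightarrow> joint_copula M k d X = block_product M k d X"
  proof
    assume *: "\<forall>A\<in>(\<Pi> i\<in>{..<k}. sets (block_cube d i)).
      prob (\<Inter>j\<in>{..<k}. ?U j -` A j \<inter> space M) = (\<Prod>j\<in>{..<k}. prob (?U j -` A j \<inter> space M))"
    show "joint_copula M k d X = block_product M k d X"
    proof (rule block_product_eqI[OF X])
      fix A assume A: "\<And>i. i < k \<Longrightarrow> A i \<in> sets (block_cube d i)"
      then have "prob (\<Inter>j\<in>{..<k}. ?U j -` A j \<inter> space M) = (\<Prod>j\<in>{..<k}. prob (?U j -` A j \<inter> space M))"
        using * by simp
      then show "emeasure (joint_copula M k d X) (block_event k d A) =
        (\<Prod>i<k. emeasure (copula_measure M (block d i) X) (A i))"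
        by (simp only: joint[OF A] marg[OF A])
    qed simp
  next
    assume *: "joint_copula M k d X = block_product M k d X"
    show "\<forall>A\<in>(\<Pi> i\<in>{..<k}. sets (block_cube d i)).
      prob (\<Inter>j\<in>{..<k}. ?U j -` A j \<inter> space M) = (\<Prod>j\<in>{..<k}. prob (?U j -` A j \<inter> space M))"
    proof
      fix A assume "A \<in> (\<Pi> i\<in>{..<k}. sets (block_cube d i))"
      then have A: "\<And>i. i < k \<Longrightarrow> A i \<in> sets (block_cube d i)" by auto
      have "ennreal (prob (\<Inter>i<k. ?U i -` A i \<inter> space M)) = ennreal (\<Prod>i<k. prob (?U i -` A i \<inter> space M))"
        using joint[OF A] marg[OF A] emeasure_block_product[OF X A] * by simp
      then show "prob (\<Inter>j\<in>{..<k}. ?U j -` A j \<inter> space M) = (\<Prod>j\<in>{..<k}. prob (?U j -` A j \<inter> space M))"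
        by (simp add: prod_nonneg)
    qed
  qed
  finally show ?thesis
    using mutually_independent_iff_prob_transform[OF X'(1,3) k] by simp
qed

text \<open>As for mutual independence, the vectors may be replaced by their transforms. For two random elements
independence means that the joint distribution is the product of the marginals, here read off from
the splitting of the coordinates into the first \<open>k\<close> blocks and the last one.\<close>
lemma last_block_independent_iff:
  assumes X: "has_density_copula M (Suc k) d X"
  shows "last_block_independent M k d X \<longleftrightarrow>
    distr (joint_copula M (Suc k) d X) (cube k d \<Otimes>\<^sub>M block_cube d k)
      (\<lambda>u. (restrict u (comps k d), restrict u (block d k))) =
    joint_copula M k d X \<Otimes>\<^sub>M copula_measure M (block d k) X"
proof -
  note X' = has_density_copulaD[OF X]
  interpret prob_space M by (rule X')
  have Xb: "X p \<in> borel_measurable M" if "p \<in> block d k" for p using X'(3) that by (auto simp: comps_Suc)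
  have Xc: "X p \<in> borel_measurable M" if "p \<in> comps k d" for p using X'(3) that by (auto simp: comps_Suc)
  let ?Ub = "subvector (prob_transform M X) (block d k)" and ?Uc = "subvector (prob_transform M X) (comps k d)"
  note Ub = subvector_prob_transform_measurable[of M "block d k" X, OF X'(1) Xb]
  note Uc = subvector_prob_transform_measurable[of M "comps k d" X, OF X'(1) Xc]
  note UA = subvector_prob_transform_measurable[of M "comps (Suc k) d" X, OF X'(1,3)]
  note factors = subvector_prob_transform_factors[OF X'(1) Xb finite_block] subvector_prob_transform_factors[OF X'(1) Xc finite_comps]
    prob_transform_subvector_factors[OF X'(1) Xb] prob_transform_subvector_factors[OF X'(1) Xc]
  note meas = Ub Uc subvector_measurable[OF Xb] subvector_measurable[OF Xc]
  have "last_block_independent M k d X \<longleftrightarrow> indep_var (block_cube d k) ?Ub (cube k d) ?Uc"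
    unfolding last_block_independent_def
    by (intro iffI; rule indep_var_AE_factors; (assumption | rule meas factors)?)
  also have "\<dots> \<longleftrightarrow> indep_var (cube k d) ?Uc (block_cube d k) ?Ub"
    using indep_var_commute by blast
  also have "\<dots> \<longleftrightarrow> joint_copula M k d X \<Otimes>\<^sub>M copula_measure M (block d k) X =
      distr M (cube k d \<Otimes>\<^sub>M block_cube d k) (\<lambda>\<omega>. (?Uc \<omega>, ?Ub \<omega>))"
    using Ub Uc by (simp add: indep_var_distribution_eq copula_measure_def)
  also have "distr M (cube k d \<Otimes>\<^sub>M block_cube d k) (\<lambda>\<omega>. (?Uc \<omega>, ?Ub \<omega>)) =
    distr (joint_copula M (Suc k) d X) (cube k d \<Otimes>\<^sub>M block_cube d k)
      (\<lambda>u. (restrict u (comps k d), restrict u (block d k)))"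
  proof -
    have m: "(\<lambda>u. (restrict u (comps k d), restrict u (block d k))) \<in>
        measurable (cube (Suc k) d) (cube k d \<Otimes>\<^sub>M block_cube d k)"
      by (intro measurable_Pair measurable_unit_cube_restrict) (auto simp: comps_Suc)
    show ?thesis
      unfolding copula_measure_def
      by (subst distr_distr[OF m UA]) (auto simp: comp_def subvector_def comps_Suc Int_absorb1
          intro!: distr_cong)
  qed
  finally show ?thesis by auto
qed

section \<open>Adjoining a random vector\<close>

lemma merge_restrict_unit_cube:
  "u \<in> space (unit_cube (I \<union> J)) \<Longrightarrow> merge I J (restrict u I, restrict u J) = u"
  by (auto simp: merge_def space_unit_cube PiE_def extensional_def fun_eq_iff)

lemma restrict_merge_unit_cube:
  assumes "I \<inter> J = {}" "x \<in> space (unit_cube I)" "y \<in> space (unit_cube J)"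
  shows "restrict (merge I J (x, y)) I = x" "restrict (merge I J (x, y)) J = y"
  using assms by (auto simp: merge_def space_unit_cube PiE_def extensional_def fun_eq_iff restrict_def)

lemma restrict_unit_cube_id: "x \<in> space (unit_cube I) \<Longrightarrow> restrict x I = x"
  by (auto simp: space_unit_cube PiE_def extensional_def fun_eq_iff)

text \<open>The measure on the left is the product of the block copulas because its value on a block event splits
off the factor of the last block.\<close>
lemma block_product_Suc:
  assumes X: "has_density_copula M (Suc k) d X" and X0: "has_density_copula M k d X"
  shows "distr (block_product M k d X \<Otimes>\<^sub>M copula_measure M (block d k) X) (cube (Suc k) d)
    (merge (comps k d) (block d k)) = block_product M (Suc k) d X"
proof (rule block_product_eqI[OF X])
  let ?Q = "block_product M k d X" and ?\<nu> = "copula_measure M (block d k) X"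
  let ?m = "merge (comps k d) (block d k)"
  interpret \<nu>: prob_space ?\<nu> by (rule has_density_copula_blockD(2)[OF X lessI])
  have sets: "sets (?Q \<Otimes>\<^sub>M ?\<nu>) = sets (cube k d \<Otimes>\<^sub>M block_cube d k)"
    by (intro sets_pair_measure_cong) simp_all
  have m: "?m \<in> measurable (?Q \<Otimes>\<^sub>M ?\<nu>) (cube (Suc k) d)"
    unfolding comps_Suc measurable_cong_sets[OF sets refl] by (rule measurable_unit_cube_merge)
  fix A assume A: "\<And>i. i < Suc k \<Longrightarrow> A i \<in> sets (block_cube d i)"
  have "?m -` block_event (Suc k) d A \<inter> space (?Q \<Otimes>\<^sub>M ?\<nu>) = block_event k d A \<times> A k"
  proof (intro set_eqI)
    fix z :: "(nat \<times> nat \<Rightarrow> real) \<times> (nat \<times> nat \<Rightarrow> real)"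
    obtain x y where z: "z = (x, y)" by fastforce
    show "z \<in> ?m -` block_event (Suc k) d A \<inter> space (?Q \<Otimes>\<^sub>M ?\<nu>) \<longleftrightarrow> z \<in> block_event k d A \<times> A k"
    proof (cases "x \<in> space (cube k d) \<and> y \<in> space (block_cube d k)")
      case True
      then have z_space: "(x, y) \<in> space (?Q \<Otimes>\<^sub>M ?\<nu>)" by (simp add: space_pair_measure)
      have "restrict (?m (x, y)) (block d i) = restrict x (block d i)" if "i < k" for i
      proof -
        have "restrict (?m (x, y)) (block d i) = restrict (restrict (?m (x, y)) (comps k d)) (block d i)"
          using block_subset_comps[OF that, of d] by (simp add: Int_absorb1)
        also have "restrict (?m (x, y)) (comps k d) = x"
          using True by (intro restrict_merge_unit_cube comps_block_disjoint) simp_all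
        finally show ?thesis .
      qed
      moreover have "restrict (?m (x, y)) (block d k) = y"
        using True by (intro restrict_merge_unit_cube comps_block_disjoint) simp_all
      moreover have "?m (x, y) \<in> space (cube (Suc k) d)"
        using measurable_space[OF m z_space] .
      ultimately show ?thesis using True z_space by (auto simp: z block_event_def less_Suc_eq)
    next
      case False
      then show ?thesis
        using sets.sets_into_space[OF A[OF lessI]] by (auto simp: z block_event_def space_pair_measure)
    qed
  qed
  then have "emeasure (distr (?Q \<Otimes>\<^sub>M ?\<nu>) (cube (Suc k) d) ?m) (block_event (Suc k) d A) =
      emeasure (?Q \<Otimes>\<^sub>M ?\<nu>) (block_event k d A \<times> A k)"
    using m by (subst emeasure_distr) (auto intro: block_event_sets A)
  also have "\<dots> = emeasure ?Q (block_event k d A) * emeasure ?\<nu> (A k)"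
    using A by (intro \<nu>.emeasure_pair_measure_Times) (auto intro: block_event_sets)
  also have "\<dots> = (\<Prod>i<Suc k. emeasure (copula_measure M (block d i) X) (A i))"
    using A by (simp add: emeasure_block_product[OF X0])
  finally show "emeasure (distr (?Q \<Otimes>\<^sub>M ?\<nu>) (cube (Suc k) d) ?m) (block_event (Suc k) d A) =
    (\<Prod>i<Suc k. emeasure (copula_measure M (block d i) X) (A i))" .
qed simp

lemma has_density_copula_butlast:
  assumes X: "has_density_copula M (Suc k) d X"
  shows "has_density_copula M k d X"
proof -
  note X' = has_density_copulaD[OF X]
  have "absolutely_continuous (cube k d) (joint_copula M k d X)"
    by (rule absolutely_continuous_marginal[where I = "comps (Suc k) d"])
       (use X X' in \<open>auto simp: comps_Suc has_density_copula_def\<close>)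
  then show ?thesis using X' by (auto simp: has_density_copula_def comps_Suc)
qed

context phi_generator
begin

text \<open>Splitting the coordinates into \<open>(u, v)\<close>, with \<open>v\<close> those of the last block, turns the product of the
block copulas into \<open>Q \<Otimes> \<nu>\<close>. Forgetting \<open>v\<close> is then the projection to which data processing
applies.\<close>
lemma
  assumes X: "has_density_copula M (Suc k) d X"
  shows D_Phi_Suc_ge: "D_Phi \<Phi> M k d X \<le> D_Phi \<Phi> M (Suc k) d X"
    and D_Phi_Suc_eqI: "last_block_independent M k d X \<Longrightarrow> D_Phi \<Phi> M (Suc k) d X = D_Phi \<Phi> M k d X"
    and D_Phi_Suc_eqD: "\<lbrakk>strictly_convex_on {0<..} \<Phi>; D_Phi \<Phi> M k d X < \<infinity>;
      D_Phi \<Phi> M (Suc k) d X = D_Phi \<Phi> M k d X\<rbrakk> \<Longrightarrow> last_block_independent M k d X"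
proof -
  note X' = has_density_copulaD[OF X]
  have X0: "has_density_copula M k d X" by (rule has_density_copula_butlast[OF X])
  let ?Q' = "block_product M (Suc k) d X" and ?P' = "joint_copula M (Suc k) d X"
  let ?Q = "block_product M k d X" and ?P = "joint_copula M k d X"
  let ?\<nu> = "copula_measure M (block d k) X"
  let ?N = "?Q \<Otimes>\<^sub>M ?\<nu>"
  let ?h = "\<lambda>u. (restrict u (comps k d), restrict u (block d k))" and ?g = "merge (comps k d) (block d k)"
  interpret \<nu>: prob_space ?\<nu> by (rule has_density_copula_blockD(2)[OF X lessI])
  interpret Q: prob_space ?Q by (rule prob_space_block_product[OF X0])
  interpret Q': prob_space ?Q' by (rule prob_space_block_product[OF X])
  interpret P': prob_space ?P' by (rule X')
  interpret QN: pair_prob_space ?Q ?\<nu> ..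
  have sets_N: "sets ?N = sets (cube k d \<Otimes>\<^sub>M block_cube d k)"
    by (intro sets_pair_measure_cong) simp_all
  have h: "?h \<in> measurable (cube (Suc k) d) ?N"
    unfolding measurable_cong_sets[OF refl sets_N]
    by (intro measurable_Pair measurable_unit_cube_restrict) (auto simp: comps_Suc)
  have g: "?g \<in> measurable ?N (cube (Suc k) d)"
    unfolding comps_Suc measurable_cong_sets[OF sets_N refl] by (rule measurable_unit_cube_merge)
  have hQ: "distr ?Q' ?N ?h = ?N"
  proof -
    have "distr ?Q' ?N ?h = distr (distr ?N (cube (Suc k) d) ?g) ?N ?h"
      by (simp only: block_product_Suc[OF X X0])
    also have "\<dots> = distr ?N ?N (\<lambda>z. z)"
      unfolding distr_distr[OF h g]
      by (intro distr_cong refl)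
         (auto simp: space_pair_measure comps_block_disjoint restrict_unit_cube_id)
    finally show ?thesis by (simp add: distr_id2)
  qed
  let ?PP = "distr ?P' ?N ?h"
  have PP: "prob_space ?PP" "sets ?PP = sets ?N" "absolutely_continuous ?N ?PP"
    using h hQ X'(5)
    by (auto intro!: P'.prob_space_distr absolutely_continuous_distr[where L = ?Q'])
  have div': "phi_div ?PP ?N = phi_div ?P' ?Q'"
  proof -
    have gh: "?g (?h u) = u" if "u \<in> space ?Q'" for u
      using that merge_restrict_unit_cube[of u "comps k d" "block d k"] by (simp add: comps_Suc)
    have h': "?h \<in> measurable ?Q' ?N"
      unfolding measurable_cong_sets[OF sets_block_product refl] by (rule h)
    have g': "?g \<in> measurable ?N ?Q'"
      unfolding measurable_cong_sets[OF refl sets_block_product] by (rule g)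
    have sets': "sets ?P' = sets ?Q'" by simp
    have "phi_div ?PP (distr ?Q' ?N ?h) = phi_div ?P' ?Q'"
      by (rule phi_div_distr[OF Q'.prob_space_axioms X'(2) sets' X'(5) h' g' gh])
    then show ?thesis by (simp only: hQ)
  qed
  have fst: "distr ?PP ?Q fst = ?P"
  proof -
    have "distr ?PP ?Q fst = distr ?P' ?Q (\<lambda>u. restrict u (comps k d))"
      using h by (subst distr_distr) (simp_all add: comp_def)
    also have "\<dots> = distr ?P' (cube k d) (\<lambda>u. restrict u (comps k d))"
      by (intro distr_cong refl) simp
    also have "\<dots> = ?P" by (intro copula_measure_marginal X') (auto simp: comps_Suc)
    finally show ?thesis .
  qed
  have indep: "last_block_independent M k d X \<longleftrightarrow> ?PP = ?P \<Otimes>\<^sub>M ?\<nu>"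
  proof -
    have "distr ?P' (cube k d \<Otimes>\<^sub>M block_cube d k) ?h = ?PP"
      by (intro distr_cong refl sets_N[symmetric])
    then show ?thesis by (simp only: last_block_independent_iff[OF X])
  qed
  note DPI = phi_div_fst_le[OF Q.prob_space_axioms \<nu>.prob_space_axioms PP]
    phi_div_fst_eq[OF Q.prob_space_axioms \<nu>.prob_space_axioms PP]
    phi_div_fst_eqD[OF Q.prob_space_axioms \<nu>.prob_space_axioms PP]
  show "D_Phi \<Phi> M k d X \<le> D_Phi \<Phi> M (Suc k) d X"
    using DPI(1) by (simp add: D_Phi_eq_phi_div X X0 div' fst less_eq_ennreal.rep_eq)
  show "D_Phi \<Phi> M (Suc k) d X = D_Phi \<Phi> M k d X" if "last_block_independent M k d X"
    using DPI(2)[unfolded fst div', OF iffD1[OF indep that]] by (simp only: D_Phi_eq_phi_div X X0)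
  show "last_block_independent M k d X"
    if "strictly_convex_on {0<..} \<Phi>" "D_Phi \<Phi> M k d X < \<infinity>" "D_Phi \<Phi> M (Suc k) d X = D_Phi \<Phi> M k d X"
    using DPI(3) that
    by (simp add: D_Phi_eq_phi_div X X0 div' fst indep enn2ereal_inject less_ennreal.rep_eq)
qed

lemma D_Phi_cong:
  assumes X: "has_density_copula M k d X" and d: "\<And>i. i < k \<Longrightarrow> d' i = d i"
    and Y: "\<And>p. p \<in> comps k d \<Longrightarrow> Y p = X p"
  shows "D_Phi \<Phi> M k d' Y = D_Phi \<Phi> M k d X"
proof -
  have comps: "comps k d' = comps k d" using d by (auto simp: comps_def)
  have blocks: "id ` block d' i = block d (id i)" if "i < k" for i using d[OF that] by (simp add: block_def)
  have cop: "joint_copula M k d' Y = distr (joint_copula M k d X) (cube k d')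
      (coordinate_map (comps k d') (\<lambda>_ t. t) id)"
    using has_density_copulaD[OF X]
    by (intro copula_measure_coordinate_map) (simp_all add: comps prob_transform_cong[OF Y])
  show ?thesis
    by (rule D_Phi_coordinate_map[OF X _ _ _ cop, where \<pi> = id])
       (use has_density_copulaD[OF X] Y blocks in \<open>simp_all add: comps block_symmetry_def permutes_id\<close>)
qed

end

text \<open>The density of the \<open>J\<close>-margin obtained by integrating out the other coordinates. Unlike a
Radon-Nikodym derivative it is defined pointwise, so bounds and limits of \<open>c\<close> pass to it at every
point.\<close>
definition marginal_density :: "'i set \<Rightarrow> 'i set \<Rightarrow> (('i \<Rightarrow> real) \<Rightarrow> real) \<Rightarrow> ('i \<Rightarrow> real) \<Rightarrow> real" where
  "marginal_density I J c v = (\<integral>w. c (merge J (I - J) (v, w)) \<partial>unit_cube (I - J))"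

lemma merge_section_measurable:
  assumes "J \<subseteq> I" and c: "c \<in> borel_measurable (unit_cube I)"
  shows "(\<lambda>(v, w). c (merge J (I - J) (v, w))) \<in> borel_measurable (unit_cube J \<Otimes>\<^sub>M unit_cube (I - J))"
proof -
  have "J \<union> (I - J) = I" using assms by auto
  then show ?thesis
    using measurable_compose[OF measurable_unit_cube_merge[of J "I - J"], of c borel] c by (simp add: split_beta')
qed

lemma merge_in_unit_cube:
  assumes "J \<subseteq> I" "v \<in> space (unit_cube J)" "w \<in> space (unit_cube (I - J))"
  shows "merge J (I - J) (v, w) \<in> space (unit_cube I)"
  using assms by (auto simp: space_unit_cube merge_def PiE_iff extensional_def)

lemma section_measurable:
  assumes "J \<subseteq> I" "c \<in> borel_measurable (unit_cube I)" "v \<in> space (unit_cube J)"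
  shows "(\<lambda>w. c (merge J (I - J) (v, w))) \<in> borel_measurable (unit_cube (I - J))"
  using measurable_compose[OF measurable_Pair1'[OF assms(3)] merge_section_measurable[OF assms(1,2)]] by simp

lemma section_integrable:
  assumes J: "J \<subseteq> I" and c: "c \<in> borel_measurable (unit_cube I)" and v: "v \<in> space (unit_cube J)"
    and bd: "\<And>u. u \<in> space (unit_cube I) \<Longrightarrow> 0 \<le> c u \<and> c u \<le> (B::real)"
  shows "integrable (unit_cube (I - J)) (\<lambda>w. c (merge J (I - J) (v, w)))"
proof -
  interpret prob_space "unit_cube (I - J)" by (rule prob_space_unit_cube)
  show ?thesis
    by (rule integrable_const_bound[where B = B])
       (use bd merge_in_unit_cube[OF J v] in \<open>auto intro!: AE_I2 section_measurable[OF J c v] simp: abs_of_nonneg\<close>)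
qed

lemma marginal_density_bounds:
  assumes J: "J \<subseteq> I" and c: "c \<in> borel_measurable (unit_cube I)" and v: "v \<in> space (unit_cube J)"
    and bd: "\<And>u. u \<in> space (unit_cube I) \<Longrightarrow> a \<le> c u \<and> c u \<le> (B::real)" and a: "0 \<le> a"
  shows "a \<le> marginal_density I J c v" "marginal_density I J c v \<le> B"
proof -
  interpret prob_space "unit_cube (I - J)" by (rule prob_space_unit_cube)
  have int: "integrable (unit_cube (I - J)) (\<lambda>w. c (merge J (I - J) (v, w)))"
    by (rule section_integrable[OF J c v]) (use bd a in force)
  have "(\<integral>w. a \<partial>unit_cube (I - J)) \<le> marginal_density I J c v"
    unfolding marginal_density_def
    by (intro integral_mono int) (use bd merge_in_unit_cube[OF J v] in auto)
  then show "a \<le> marginal_density I J c v" by (simp add: prob_space)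
  have "marginal_density I J c v \<le> (\<integral>w. B \<partial>unit_cube (I - J))"
    unfolding marginal_density_def
    by (intro integral_mono int) (use bd merge_in_unit_cube[OF J v] in auto)
  then show "marginal_density I J c v \<le> B" by (simp add: prob_space)
qed

lemma is_copula_density_marginal_density:
  assumes X: "prob_space M" "\<And>p. p \<in> I \<Longrightarrow> X p \<in> borel_measurable M"
    and I: "finite I" and J: "J \<subseteq> I" and c: "is_copula_density M I X c"
    and bd: "\<And>u. u \<in> space (unit_cube I) \<Longrightarrow> c u \<le> B"
  shows "is_copula_density M J X (marginal_density I J c)"
proof -
  have c_meas: "c \<in> borel_measurable (unit_cube I)" and bd': "\<And>u. u \<in> space (unit_cube I) \<Longrightarrow> 0 \<le> c u \<and> c u \<le> B"
    and P: "copula_measure M I X = density (unit_cube I) (\<lambda>u. ennreal (c u))"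
    using c bd by (auto simp: is_copula_density_def)
  have IJ: "J \<union> (I - J) = I" using J by auto
  interpret R: prob_space "unit_cube (I - J)" by (rule prob_space_unit_cube)
  have meas: "marginal_density I J c \<in> borel_measurable (unit_cube J)"
    unfolding marginal_density_def[abs_def]
    by (intro R.borel_measurable_lebesgue_integral merge_section_measurable J c_meas)
  have "copula_measure M J X = density (unit_cube J) (\<lambda>v. ennreal (marginal_density I J c v))"
  proof (rule measure_eqI)
    fix A assume "A \<in> sets (copula_measure M J X)"
    then have A: "A \<in> sets (unit_cube J)" by simp
    have restr: "(\<lambda>u. restrict u J) \<in> measurable (unit_cube I) (unit_cube J)"
      by (rule measurable_unit_cube_restrict[OF J])
    have f: "(\<lambda>u. ennreal (c u) * indicator A (restrict u J)) \<in> borel_measurable (unit_cube I)"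
      by (intro borel_measurable_times_ennreal measurable_compose[OF c_meas measurable_ennreal]
          measurable_compose[OF restr borel_measurable_indicator[OF A]])
    have "emeasure (copula_measure M J X) A = emeasure (copula_measure M I X) ((\<lambda>u. restrict u J) -` A \<inter> space (unit_cube I))"
    proof -
      have restr': "(\<lambda>u. restrict u J) \<in> measurable (copula_measure M I X) (unit_cube J)"
        unfolding measurable_cong_sets[OF sets_copula_measure refl] by (rule restr)
      show ?thesis
        using emeasure_distr[OF restr' A] copula_measure_marginal[OF X J] by simp
    qed
    also have "\<dots> = (\<integral>\<^sup>+u. ennreal (c u) * indicator ((\<lambda>u. restrict u J) -` A \<inter> space (unit_cube I)) u \<partial>unit_cube I)"
      unfolding P by (intro emeasure_density measurable_compose[OF c_meas measurable_ennreal] measurable_sets[OF restr A])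
    also have "\<dots> = (\<integral>\<^sup>+u. ennreal (c u) * indicator A (restrict u J) \<partial>unit_cube (J \<union> (I - J)))"
      unfolding IJ by (intro nn_integral_cong) (simp add: indicator_def)
    also have "\<dots> = (\<integral>\<^sup>+v. (\<integral>\<^sup>+w. ennreal (c (merge J (I - J) (v, w))) * indicator A (restrict (merge J (I - J) (v, w)) J)
        \<partial>unit_cube (I - J)) \<partial>unit_cube J)"
      using I J finite_subset[OF J I] f by (intro nn_integral_unit_cube_merge) (auto simp: Un_absorb1)
    also have "\<dots> = (\<integral>\<^sup>+v. ennreal (marginal_density I J c v) * indicator A v \<partial>unit_cube J)"
    proof (intro nn_integral_cong)
      fix v assume v: "v \<in> space (unit_cube J)"
      have "(\<integral>\<^sup>+w. ennreal (c (merge J (I - J) (v, w))) * indicator A (restrict (merge J (I - J) (v, w)) J) \<partial>unit_cube (I - J)) =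
          (\<integral>\<^sup>+w. ennreal (c (merge J (I - J) (v, w))) * indicator A v \<partial>unit_cube (I - J))"
        using v by (intro nn_integral_cong) (simp add: restrict_unit_cube_id)
      also have "\<dots> = (\<integral>\<^sup>+w. ennreal (c (merge J (I - J) (v, w))) \<partial>unit_cube (I - J)) * indicator A v"
        by (intro nn_integral_multc measurable_compose[OF section_measurable[OF J c_meas v] measurable_ennreal])
      also have "(\<integral>\<^sup>+w. ennreal (c (merge J (I - J) (v, w))) \<partial>unit_cube (I - J)) = ennreal (marginal_density I J c v)"
        unfolding marginal_density_def
        by (intro nn_integral_eq_integral section_integrable[OF J c_meas v bd'] AE_I2)
           (use bd' merge_in_unit_cube[OF J v] in auto)
      finally show "(\<integral>\<^sup>+w. ennreal (c (merge J (I - J) (v, w))) * indicator A (restrict (merge J (I - J) (v, w)) J) \<partial>unit_cube (I - J)) =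
          ennreal (marginal_density I J c v) * indicator A v" .
    qed
    also have "\<dots> = emeasure (density (unit_cube J) (\<lambda>v. ennreal (marginal_density I J c v))) A"
      by (intro emeasure_density[symmetric] measurable_compose[OF meas measurable_ennreal] A)
    finally show "emeasure (copula_measure M J X) A =
      emeasure (density (unit_cube J) (\<lambda>v. ennreal (marginal_density I J c v))) A" .
  qed simp
  moreover have "0 \<le> marginal_density I J c v" if "v \<in> space (unit_cube J)" for v
    by (rule marginal_density_bounds(1)[OF J c_meas that bd']) auto
  ultimately show ?thesis using meas by (simp add: is_copula_density_def)
qed

lemma marginal_density_tendsto:
  assumes J: "J \<subseteq> I" and v: "v \<in> space (unit_cube J)"
    and cn: "\<And>n. cn n \<in> borel_measurable (unit_cube I)"
    and bdn: "\<And>n u. u \<in> space (unit_cube I) \<Longrightarrow> 0 \<le> cn n u \<and> cn n u \<le> B"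
    and c: "c \<in> borel_measurable (unit_cube I)"
    and lim: "\<And>u. u \<in> space (unit_cube I) \<Longrightarrow> (\<lambda>n. cn n u) \<longlonglongrightarrow> c u"
  shows "(\<lambda>n. marginal_density I J (cn n) v) \<longlonglongrightarrow> marginal_density I J c v"
  unfolding marginal_density_def
proof (rule integral_dominated_convergence[where w = "\<lambda>_. B"])
  interpret prob_space "unit_cube (I - J)" by (rule prob_space_unit_cube)
  show "integrable (unit_cube (I - J)) (\<lambda>_. B)" by simp
qed (use bdn lim merge_in_unit_cube[OF J v] in \<open>auto intro!: section_measurable[OF J _ v] cn c AE_I2\<close>)

section \<open>Convergence of densities and normalization\<close>

lemma prod_density_bounds:
  assumes bd: "\<And>i v. i < k \<Longrightarrow> v \<in> space (block_cube d i) \<Longrightarrow> a \<le> cs i v \<and> cs i v \<le> B"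
    and a: "0 \<le> a" and u: "u \<in> space (cube k d)"
  shows "a ^ k \<le> prod_density k d cs u" "prod_density k d cs u \<le> B ^ k"
proof -
  have r: "restrict u (block d i) \<in> space (block_cube d i)" if "i < k" for i
    by (rule restrict_in_unit_cube[OF u block_subset_comps[OF that]])
  have "(\<Prod>i<k. a) \<le> prod_density k d cs u"
    unfolding prod_density_def using bd[OF _ r] a by (intro prod_mono) auto
  then show "a ^ k \<le> prod_density k d cs u" by simp
  have "prod_density k d cs u \<le> (\<Prod>i<k. B)"
    unfolding prod_density_def using bd[OF _ r] a by (intro prod_mono) (auto intro: order_trans)
  then show "prod_density k d cs u \<le> B ^ k" by simp
qed

context phi_generator
begin

definition psi_real :: "real \<Rightarrow> real" where
  "psi_real t = \<Phi> t - slope * (t - 1)"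

lemma psi_eq_psi_real: "0 < t \<Longrightarrow> psi t = ennreal (psi_real t)"
  by (simp add: gap_pos psi_real_def Phi_1)

lemma continuous_on_psi_real: "continuous_on {0<..} psi_real"
  unfolding psi_real_def[abs_def] by (intro continuous_intros Phi_cont)

lemma phi_div_eq_integral_unit_cube:
  assumes X: "has_density_copula M k d X" and c: "is_copula_density M (comps k d) X c"
    and cs: "\<And>i. i < k \<Longrightarrow> is_copula_density M (block d i) X (cs i)"
  shows "phi_div (joint_copula M k d X) (block_product M k d X) =
    (\<integral>\<^sup>+u. ennreal (prod_density k d cs u) * psi (c u / prod_density k d cs u) \<partial>cube k d)"
proof -
  have [measurable]: "c \<in> borel_measurable (cube k d)"
    using c by (simp add: is_copula_density_def)
  have [measurable]: "prod_density k d cs \<in> borel_measurable (cube k d)"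
    using cs by (intro prod_density_measurable) (auto simp: is_copula_density_def)
  have "phi_div (joint_copula M k d X) (block_product M k d X) =
      (\<integral>\<^sup>+u. psi (c u / prod_density k d cs u) \<partial>block_product M k d X)"
    by (rule phi_div_density[OF prob_space_block_product[OF X] ratio_measurable[OF X c cs]
        ratio_nonneg[OF X c cs] copula_measure_eq_density_ratio[OF X c cs] has_density_copulaD(2)[OF X]])
  also have "\<dots> = (\<integral>\<^sup>+u. psi (c u / prod_density k d cs u)
      \<partial>density (cube k d) (\<lambda>u. ennreal (prod_density k d cs u)))"
    by (simp only: prod_measure_eq_block_product[OF X cs, symmetric] prod_measure_def)
  also have "\<dots> = (\<integral>\<^sup>+u. ennreal (prod_density k d cs u) * psi (c u / prod_density k d cs u) \<partial>cube k d)"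
    by (subst nn_integral_density) simp_all
  finally show ?thesis .
qed

text \<open>With all densities in \<open>[a, B]\<close>, the products of marginal densities lie in \<open>[a ^ k, B ^ k]\<close> and the ratios
in \<open>[a / B ^ k, B / a ^ k]\<close>, a compact interval of positive numbers. The integrands converge pointwise and
have a common constant bound on the cube.\<close>
lemma D_Phi_tendsto_bounded:
  assumes X: "has_density_copula M k d X" and c: "is_copula_density M (comps k d) X c"
    and Xs: "\<And>n. has_density_copula (Ms n) k d (Xs n)"
    and cn: "\<And>n. is_copula_density (Ms n) (comps k d) (Xs n) (cn n)"
    and a: "0 < a" and bdn: "\<And>n u. u \<in> space (cube k d) \<Longrightarrow> a \<le> cn n u \<and> cn n u \<le> B"
    and bd: "\<And>u. u \<in> space (cube k d) \<Longrightarrow> a \<le> c u \<and> c u \<le> B"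
    and lim: "\<And>u. u \<in> space (cube k d) \<Longrightarrow> (\<lambda>n. cn n u) \<longlonglongrightarrow> c u"
  shows "(\<lambda>n. D_Phi \<Phi> (Ms n) k d (Xs n)) \<longlonglongrightarrow> D_Phi \<Phi> M k d X"
proof -
  let ?L = "cube k d"
  interpret L: prob_space ?L by (rule prob_space_unit_cube)
  obtain u0 where u0: "u0 \<in> space ?L" using L.not_empty by blast
  have B: "0 < B" using bd[OF u0] a by linarith
  define mc where "mc i = marginal_density (comps k d) (block d i) c" for i
  define mcn where "mcn n i = marginal_density (comps k d) (block d i) (cn n)" for n i
  note Xs' = has_density_copulaD[OF Xs] and X' = has_density_copulaD[OF X]
  have cn_meas: "cn n \<in> borel_measurable ?L" for n using cn[of n] by (simp add: is_copula_density_def)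
  have c_meas: "c \<in> borel_measurable ?L" using c by (simp add: is_copula_density_def)
  have mc: "is_copula_density M (block d i) X (mc i)" if "i < k" for i
    unfolding mc_def
    by (rule is_copula_density_marginal_density[OF X'(1,3) finite_comps block_subset_comps[OF that] c])
       (use bd in auto)
  have mcn: "is_copula_density (Ms n) (block d i) (Xs n) (mcn n i)" if "i < k" for i n
    unfolding mcn_def
    by (rule is_copula_density_marginal_density[OF Xs'(1,3) finite_comps block_subset_comps[OF that] cn])
       (use bdn in auto)
  define \<pi> where "\<pi> = prod_density k d mc"
  define \<pi>n where "\<pi>n n = prod_density k d (mcn n)" for n
  have \<pi>_bd: "a ^ k \<le> \<pi> u \<and> \<pi> u \<le> B ^ k" if "u \<in> space ?L" for u
    unfolding \<pi>_def using a
    by (intro conjI prod_density_bounds[OF _ _ that])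
       (auto simp: mc_def intro!: marginal_density_bounds[OF block_subset_comps c_meas _ bd])
  have \<pi>n_bd: "a ^ k \<le> \<pi>n n u \<and> \<pi>n n u \<le> B ^ k" if "u \<in> space ?L" for u n
    unfolding \<pi>n_def using a
    by (intro conjI prod_density_bounds[OF _ _ that])
       (auto simp: mcn_def intro!: marginal_density_bounds[OF block_subset_comps cn_meas _ bdn])
  have \<pi>_pos: "0 < \<pi> u" if "u \<in> space ?L" for u
    using \<pi>_bd[OF that] a zero_less_power[OF a, of k] by linarith
  have \<pi>n_pos: "0 < \<pi>n n u" if "u \<in> space ?L" for u n
    using \<pi>n_bd[OF that, of n] zero_less_power[OF a, of k] by linarith
  have \<pi>_lim: "(\<lambda>n. \<pi>n n u) \<longlonglongrightarrow> \<pi> u" if u: "u \<in> space ?L" for u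
    unfolding \<pi>n_def \<pi>_def prod_density_def
  proof (intro tendsto_prod)
    fix i assume "i \<in> {..<k}"
    then have sub: "block d i \<subseteq> comps k d" by (simp add: block_subset_comps)
    have bd0: "0 \<le> cn n u \<and> cn n u \<le> B" if "u \<in> space ?L" for n u using bdn[OF that, of n] a by linarith
    show "(\<lambda>n. mcn n i (restrict u (block d i))) \<longlonglongrightarrow> mc i (restrict u (block d i))"
      unfolding mcn_def mc_def
      by (rule marginal_density_tendsto[OF sub restrict_in_unit_cube[OF u sub] cn_meas bd0 c_meas lim])
  qed
  define r where "r u = c u / \<pi> u" for u
  define rn where "rn n u = cn n u / \<pi>n n u" for n u
  define lo hi where "lo = a / B ^ k" and "hi = B / a ^ k"
  have lo: "0 < lo" using a B by (simp add: lo_def)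
  have rn_bd: "rn n u \<in> {lo..hi}" if "u \<in> space ?L" for u n
    using bdn[OF that, of n] \<pi>n_bd[OF that, of n] \<pi>n_pos[OF that, of n] a B
    by (auto simp: rn_def lo_def hi_def intro!: frac_le)
  have r_pos: "0 < r u" if "u \<in> space ?L" for u
    using bd[OF that] \<pi>_pos[OF that] a by (simp add: r_def)
  have r_lim: "(\<lambda>n. rn n u) \<longlonglongrightarrow> r u" if "u \<in> space ?L" for u
    unfolding rn_def r_def using \<pi>_pos[OF that] by (intro tendsto_divide lim \<pi>_lim that) auto
  have cont: "continuous_on {lo..hi} psi_real"
    using lo by (intro continuous_on_subset[OF continuous_on_psi_real]) auto
  have "compact (psi_real ` {lo..hi})" by (rule compact_continuous_image[OF cont compact_Icc])
  then have "bounded (psi_real ` {lo..hi})" by (rule compact_imp_bounded)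
  then obtain K where "\<forall>y\<in>psi_real ` {lo..hi}. norm y \<le> K"
    unfolding bounded_iff by blast
  then have K: "\<bar>psi_real t\<bar> \<le> K" if "t \<in> {lo..hi}" for t using that by auto
  have gap_lim: "(\<lambda>n. psi_real (rn n u)) \<longlonglongrightarrow> psi_real (r u)" if "u \<in> space ?L" for u
    by (rule continuous_on_tendsto_compose[OF continuous_on_psi_real r_lim[OF that]])
       (use r_pos[OF that] rn_bd[OF that] lo in \<open>auto intro!: always_eventually intro: less_le_trans\<close>)
  let ?F = "\<lambda>u. ennreal (\<pi> u) * psi (r u)" and ?Fn = "\<lambda>n u. ennreal (\<pi>n n u) * psi (rn n u)"
  have \<pi>_meas: "\<pi> \<in> borel_measurable ?L"
    unfolding \<pi>_def using mc by (intro prod_density_measurable) (auto simp: is_copula_density_def)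
  have \<pi>n_meas: "\<pi>n n \<in> borel_measurable ?L" for n
    unfolding \<pi>n_def using mcn by (intro prod_density_measurable) (auto simp: is_copula_density_def)
  note [measurable] = \<pi>_meas \<pi>n_meas cn_meas c_meas
  have "(\<lambda>n. \<integral>\<^sup>+u. ?Fn n u \<partial>?L) \<longlonglongrightarrow> (\<integral>\<^sup>+u. ?F u \<partial>?L)"
  proof (rule nn_integral_dominated_convergence[where w = "\<lambda>_. ennreal (B ^ k) * ennreal K"])
    show "?Fn n \<in> borel_measurable ?L" for n unfolding rn_def by measurable
    show "?F \<in> borel_measurable ?L" unfolding r_def by measurable
    show "AE u in ?L. ?Fn n u \<le> ennreal (B ^ k) * ennreal K" for n
    proof (rule AE_I2)
      fix u assume u: "u \<in> space ?L"
      have "psi (rn n u) \<le> ennreal K"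
        using rn_bd[OF u, of n] lo K[OF rn_bd[OF u, of n]] by (auto simp: psi_eq_psi_real intro!: ennreal_leI)
      then show "?Fn n u \<le> ennreal (B ^ k) * ennreal K"
        using \<pi>n_bd[OF u, of n] by (intro mult_mono ennreal_leI) auto
    qed
    show "(\<integral>\<^sup>+u. ennreal (B ^ k) * ennreal K \<partial>?L) < \<infinity>"
      by (simp add: L.emeasure_space_1 ennreal_mult_less_top)
    show "AE u in ?L. (\<lambda>n. ?Fn n u) \<longlonglongrightarrow> ?F u"
    proof (rule AE_I2)
      fix u assume u: "u \<in> space ?L"
      have rn_pos: "0 < rn n u" for n using rn_bd[OF u, of n] lo by auto
      have "(\<lambda>n. ennreal (\<pi>n n u * psi_real (rn n u))) \<longlonglongrightarrow> ennreal (\<pi> u * psi_real (r u))"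
        by (intro tendsto_ennrealI tendsto_mult \<pi>_lim gap_lim u)
      moreover have "ennreal (\<pi>n n u * psi_real (rn n u)) = ?Fn n u" for n
        using \<pi>n_pos[OF u, of n] rn_pos[of n] by (simp add: psi_eq_psi_real ennreal_mult')
      moreover have "ennreal (\<pi> u * psi_real (r u)) = ?F u"
        using \<pi>_pos[OF u] r_pos[OF u] by (simp add: psi_eq_psi_real ennreal_mult')
      ultimately show "(\<lambda>n. ?Fn n u) \<longlonglongrightarrow> ?F u" by simp
    qed
  qed simp
  then have "(\<lambda>n. phi_div (joint_copula (Ms n) k d (Xs n)) (block_product (Ms n) k d (Xs n))) \<longlonglongrightarrow>
      phi_div (joint_copula M k d X) (block_product M k d X)"
    by (simp only: phi_div_eq_integral_unit_cube[OF X c mc] phi_div_eq_integral_unit_cube[OF Xs cn mcn]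
        \<pi>_def \<pi>n_def r_def rn_def)
  then show ?thesis
    by (simp only: D_Phi_eq_phi_div[OF X] D_Phi_eq_phi_div[OF Xs] tendsto_enn2ereal_iff)
qed

text \<open>Once \<open>cn n\<close> is within \<open>m / 2\<close> of \<open>c\<close>, it lies between \<open>m / 2\<close> and \<open>B + m / 2\<close>, so the bounded case applies to
the tail of the sequence.\<close>
lemma D_Phi_tendsto:
  assumes X: "has_density_copula M k d X" and c: "is_copula_density M (comps k d) X c"
    and Xs: "\<And>n. has_density_copula (Ms n) k d (Xs n)"
    and cn: "\<And>n. is_copula_density (Ms n) (comps k d) (Xs n) (cn n)"
    and m: "0 < m" and bd: "\<And>u. u \<in> space (cube k d) \<Longrightarrow> m \<le> c u \<and> c u \<le> B"
    and lim: "uniform_limit (space (cube k d)) cn c sequentially"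
  shows "(\<lambda>n. D_Phi \<Phi> (Ms n) k d (Xs n)) \<longlonglongrightarrow> D_Phi \<Phi> M k d X"
proof -
  have "\<forall>\<^sub>F n in sequentially. \<forall>u\<in>space (cube k d). dist (cn n u) (c u) < m / 2"
    using lim m by (intro uniform_limitD) auto
  then obtain n0 where n0: "\<And>n u. n0 \<le> n \<Longrightarrow> u \<in> space (cube k d) \<Longrightarrow> \<bar>cn n u - c u\<bar> < m / 2"
    by (auto simp: eventually_sequentially dist_real_def)
  have "(\<lambda>n. D_Phi \<Phi> (Ms (n + n0)) k d (Xs (n + n0))) \<longlonglongrightarrow> D_Phi \<Phi> M k d X"
  proof (rule D_Phi_tendsto_bounded[OF X c Xs cn, where a = "m / 2" and B = "B + m / 2"])
    fix u assume u: "u \<in> space (cube k d)"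
    show "m / 2 \<le> cn (n + n0) u \<and> cn (n + n0) u \<le> B + m / 2" for n
      using bd[OF u] n0[OF le_add2 u, of n] by linarith
    show "m / 2 \<le> c u \<and> c u \<le> B + m / 2" using bd[OF u] m by linarith
    show "(\<lambda>n. cn (n + n0) u) \<longlonglongrightarrow> c u"
      using tendsto_uniform_limitI[OF lim u] by (rule LIMSEQ_ignore_initial_segment)
  qed (use m in simp)
  then show ?thesis by (rule LIMSEQ_offset)
qed

lemma D_Phi_nonneg: "has_density_copula M k d X \<Longrightarrow> 0 \<le> D_Phi \<Phi> M k d X"
  by (simp add: D_Phi_eq_phi_div)

lemma D_Phi_le:
  assumes X: "has_density_copula M k d X" and "Phi_zero \<Phi> + Phi_star_zero \<Phi> < \<infinity>"
  shows "D_Phi \<Phi> M k d X \<le> Phi_zero \<Phi> + Phi_star_zero \<Phi>"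
  using phi_div_le[OF prob_space_block_product[OF X] has_density_copulaD(2)[OF X] _ has_density_copulaD(5)[OF X] assms(2)]
  by (simp add: D_Phi_eq_phi_div X)

lemma D_Phi_eq_0_iff:
  assumes X: "has_density_copula M k d X" and k: "1 \<le> k" and strict: "strictly_convex_at_1 \<Phi>"
  shows "D_Phi \<Phi> M k d X = 0 \<longleftrightarrow> mutually_independent M k d X"
proof -
  have "enn2ereal x = 0 \<longleftrightarrow> x = 0" for x
    using enn2ereal_inject[of x 0] by (simp add: zero_ennreal.rep_eq)
  then show ?thesis
    using phi_div_eq_0_iff[OF prob_space_block_product[OF X] has_density_copulaD(2)[OF X] _ has_density_copulaD(5)[OF X] strict]
    by (simp add: D_Phi_eq_phi_div X mutually_independent_iff[OF X k])
qed

end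

locale normalized_phi_generator = phi_generator +
  fixes N :: "ereal \<Rightarrow> real"
  assumes Phi_nonzero: "Phi_zero \<Phi> + Phi_star_zero \<Phi> \<noteq> 0"
    and N_range: "N ` {0..} \<subseteq> {0..1}"
    and N_cont: "continuous_on {0..} N"
    and N_mono: "strict_mono_on {0..} N"
    and N_0: "N 0 = 0"
begin

text \<open>Both branches are continuous and strictly increasing on \<open>[0, \<infinity>]\<close>, the first because
\<open>\<Phi>(0) + \<Phi>*(0)\<close> is then a positive number, so every comparison of divergences transfers to the
normalized measure.\<close>
definition N_Phi :: "ereal \<Rightarrow> ereal" where
  "N_Phi x = (if Phi_zero \<Phi> + Phi_star_zero \<Phi> < \<infinity> then x / (Phi_zero \<Phi> + Phi_star_zero \<Phi>) else ereal (N x))"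

lemma D_norm_eq: "D_norm \<Phi> N M k d X = N_Phi (D_Phi \<Phi> M k d X)"
  by (simp add: D_norm_def N_Phi_def)

lemma Phi_sum_cases:
  obtains s where "0 < s" "Phi_zero \<Phi> + Phi_star_zero \<Phi> = ereal s"
  | "Phi_zero \<Phi> + Phi_star_zero \<Phi> = \<infinity>"
  using Phi_sum_nonneg Phi_nonzero by (cases "Phi_zero \<Phi> + Phi_star_zero \<Phi>") (auto simp: zero_ereal_def)

lemma N_Phi_less_iff:
  assumes "0 \<le> x" "0 \<le> y"
  shows "N_Phi x < N_Phi y \<longleftrightarrow> x < y"
proof (cases rule: Phi_sum_cases)
  case (1 s)
  have *: "z / ereal s = ereal (inverse s) * z" for z :: ereal using 1(1) by (auto simp: divide_ereal_def mult.commute)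
  show ?thesis
    using 1 assms by (cases x; cases y) (auto simp: N_Phi_def * mult_less_cancel_left)
next
  case 2
  then show ?thesis
    using assms strict_mono_on_less[OF N_mono] by (simp add: N_Phi_def)
qed

lemma N_Phi_0: "N_Phi 0 = 0"
  by (simp add: N_Phi_def N_0 zero_ereal_def[symmetric])

lemma N_Phi_bounds:
  assumes "0 \<le> x" "Phi_zero \<Phi> + Phi_star_zero \<Phi> < \<infinity> \<Longrightarrow> x \<le> Phi_zero \<Phi> + Phi_star_zero \<Phi>"
  shows "0 \<le> N_Phi x" "N_Phi x \<le> 1"
proof -
  have "0 \<le> N_Phi x \<and> N_Phi x \<le> 1"
  proof (cases rule: Phi_sum_cases)
    case (1 s)
    with assms obtain r where "x = ereal r" "0 \<le> r" "r \<le> s" by (cases x) auto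
    with 1 show ?thesis by (simp add: N_Phi_def one_ereal_def)
  next
    case 2
    then show ?thesis using assms N_range by (auto simp: N_Phi_def one_ereal_def)
  qed
  then show "0 \<le> N_Phi x" "N_Phi x \<le> 1" by auto
qed

lemma N_Phi_inject: "0 \<le> x \<Longrightarrow> 0 \<le> y \<Longrightarrow> N_Phi x = N_Phi y \<longleftrightarrow> x = y"
  using N_Phi_less_iff[of x y] N_Phi_less_iff[of y x] by (metis less_irrefl not_less_iff_gr_or_eq)

lemma N_Phi_mono: "0 \<le> x \<Longrightarrow> x \<le> y \<Longrightarrow> N_Phi x \<le> N_Phi y"
  using N_Phi_less_iff[of y x] by (metis not_less order_trans)

lemma N_Phi_tendsto:
  assumes "(f \<longlongrightarrow> x) F" "\<And>n. 0 \<le> f n" "0 \<le> x"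
  shows "((\<lambda>n. N_Phi (f n)) \<longlongrightarrow> N_Phi x) F"
proof (cases rule: Phi_sum_cases)
  case (1 s)
  have *: "z / ereal s = ereal (inverse s) * z" for z :: ereal using 1(1) by (auto simp: divide_ereal_def mult.commute)
  show ?thesis using 1 assms(1) by (simp add: N_Phi_def * tendsto_cmult_ereal del: times_ereal.simps)
next
  case 2
  have "((\<lambda>n. N (f n)) \<longlongrightarrow> N x) F"
    by (rule continuous_on_tendsto_compose[OF N_cont assms(1)]) (use assms in auto)
  then show ?thesis using 2 by (simp add: N_Phi_def)
qed

end

theorem proposition1:
  fixes \<Phi> :: "real \<Rightarrow> real" and N :: "ereal \<Rightarrow> real"
    and M :: "'w measure" and k :: nat and d :: "nat \<Rightarrow> nat"
    and X :: "nat \<times> nat \<Rightarrow> 'w \<Rightarrow> real"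
  assumes Phi_cont: "continuous_on {0<..} \<Phi>"
    and Phi_convex: "convex_on {0<..} \<Phi>"
    and Phi_1: "\<Phi> 1 = 0"
    and Phi_nonzero: "Phi_zero \<Phi> + Phi_star_zero \<Phi> \<noteq> 0"
    and N_range: "N ` {0..} \<subseteq> {0..1}"
    and N_cont: "continuous_on {0..} N"
    and N_mono: "strict_mono_on {0..} N"
    and N_0: "N 0 = 0" and N_inf: "N \<infinity> = 1"
    and X: "admissible M k d X"
  shows
    \<comment> \<open>A1\<close>
    "(\<forall>\<pi>. \<pi> permutes {..<k} \<longrightarrow>
        D_norm \<Phi> N M k (d \<circ> \<pi>) (permute_blocks \<pi> X) = D_norm \<Phi> N M k d X) \<and>
     (\<forall>i<k. \<forall>\<sigma>. \<sigma> permutes {..<d i} \<longrightarrow>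
        D_norm \<Phi> N M k d (permute_within i \<sigma> X) = D_norm \<Phi> N M k d X) \<and>
     \<comment> \<open>A2\<close>
     (0 \<le> D_norm \<Phi> N M k d X \<and> D_norm \<Phi> N M k d X \<le> 1) \<and>
     \<comment> \<open>A5: densities exist, the integral exists for every choice of them and does not depend
       on that choice\<close>
     (is_copula_density M (comps k d) X (copula_density M (comps k d) X) \<and>
      (\<forall>i<k. is_copula_density M (block d i) X (copula_density M (block d i) X)) \<and>
      (\<forall>c cs. is_copula_density M (comps k d) X c \<and>
              (\<forall>i<k. is_copula_density M (block d i) X (cs i)) \<longrightarrow>
         ext_integral_exists (prod_measure k d cs) (Phi_ratio \<Phi> k d c cs) \<and>
         ext_integral (prod_measure k d cs) (Phi_ratio \<Phi> k d c cs) = D_Phi \<Phi> M k d X) \<and>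
      0 \<le> D_Phi \<Phi> M k d X) \<and>
     \<comment> \<open>A5: functional of the copula only\<close>
     (\<forall>(M' :: 'v measure) Y. admissible M' k d Y \<and>
        (\<forall>u\<in>space (unit_cube (comps k d)). copula M' (comps k d) Y u = copula M (comps k d) X u) \<longrightarrow>
        D_norm \<Phi> N M' k d Y = D_norm \<Phi> N M k d X) \<and>
     \<comment> \<open>A6\<close>
     (\<forall>T :: nat \<times> nat \<Rightarrow> real \<Rightarrow> real.
        (\<forall>p\<in>comps k d. strict_mono (T p) \<and> continuous_on UNIV (T p)) \<longrightarrow>
        D_norm \<Phi> N M k d (\<lambda>p. T p \<circ> X p) = D_norm \<Phi> N M k d X) \<and>
     \<comment> \<open>A7\<close>
     (\<forall>p\<in>comps k d. \<forall>T :: real \<Rightarrow> real.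
        monotone (<) (>) T \<and> continuous_on UNIV T \<longrightarrow>
        D_norm \<Phi> N M k d (X(p := T \<circ> X p)) = D_norm \<Phi> N M k d X) \<and>
     \<comment> \<open>A3\<close>
     (strictly_convex_at_1 \<Phi> \<longrightarrow>
        (D_norm \<Phi> N M k d X = 0 \<longleftrightarrow> mutually_independent M k d X)) \<and>
     \<comment> \<open>A4; if \<open>\<Phi>(0) + \<Phi>*(0) = \<infinity>\<close> and \<open>D_Phi\<close> of the first \<open>k\<close> vectors is already
       \<open>\<infinity>\<close>, then both sides equal \<open>N \<infinity> = 1\<close> and equality carries no information\<close>
     (strictly_convex_on {0<..} \<Phi> \<longrightarrow>
        (\<forall>e Y. admissible M (Suc k) (d(k := e)) (append_block k X Y) \<longrightarrow>
           D_norm \<Phi> N M (Suc k) (d(k := e)) (append_block k X Y) \<ge> D_norm \<Phi> N M k d X \<and>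
           (Phi_zero \<Phi> + Phi_star_zero \<Phi> < \<infinity> \<or> D_Phi \<Phi> M k d X < \<infinity> \<longrightarrow>
              (D_norm \<Phi> N M (Suc k) (d(k := e)) (append_block k X Y) = D_norm \<Phi> N M k d X \<longleftrightarrow>
               last_block_independent M k (d(k := e)) (append_block k X Y))) \<and>
           (last_block_independent M k (d(k := e)) (append_block k X Y) \<longrightarrow>
              D_norm \<Phi> N M (Suc k) (d(k := e)) (append_block k X Y) = D_norm \<Phi> N M k d X))) \<and>
     \<comment> \<open>A8\<close>
     (\<forall>(Ms :: nat \<Rightarrow> 'v measure) Xs cn c m B.
        (\<forall>n. admissible (Ms n) k d (Xs n) \<and> is_copula_density (Ms n) (comps k d) (Xs n) (cn n)) \<and>
        is_copula_density M (comps k d) X c \<and>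
        0 < m \<and> (\<forall>u\<in>space (unit_cube (comps k d)). m \<le> c u \<and> c u \<le> B) \<and>
        uniform_limit (space (unit_cube (comps k d))) cn c sequentially \<longrightarrow>
        (\<lambda>n. D_norm \<Phi> N (Ms n) k d (Xs n)) \<longlonglongrightarrow> D_norm \<Phi> N M k d X)"
    (is "?A1a \<and> ?A1b \<and> ?A2 \<and> ?A5a \<and> ?A5b \<and> ?A6 \<and> ?A7 \<and> ?A3 \<and> ?A4 \<and> ?A8")
proof -
  interpret normalized_phi_generator \<Phi> N
    by unfold_locales fact+
  have hX: "has_density_copula M k d X" by (rule admissible_has_density_copula[OF X])
  have k: "1 \<le> k" using X by (simp add: admissible_def)
  have nonneg: "0 \<le> D_Phi \<Phi> M k d X" by (rule D_Phi_nonneg[OF hX])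
  have a1a: ?A1a by (simp add: D_norm_eq D_Phi_permute_blocks[OF hX])
  have a1b: ?A1b by (simp add: D_norm_eq D_Phi_permute_within[OF hX])
  have a2: ?A2
    unfolding D_norm_eq using N_Phi_bounds[OF nonneg D_Phi_le[OF hX]] by simp
  have a5a: ?A5a
    using has_density_copulaD(4)[OF hX] has_density_copula_blockD(1)[OF hX] nonneg
      ext_integral_exists_Phi_ratio[OF hX] ext_integral_Phi_ratio[OF hX]
    by (auto simp: D_Phi_eq_phi_div[OF hX])
  have a5b: ?A5b
  proof (intro allI impI, elim conjE)
    fix M' :: "'v measure" and Y
    assume Y: "admissible M' k d Y"
      and eq: "\<forall>u\<in>space (cube k d). copula M' (comps k d) Y u = copula M (comps k d) X u"
    have hY: "has_density_copula M' k d Y" by (rule admissible_has_density_copula[OF Y])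
    have "joint_copula M' k d Y = joint_copula M k d X"
      using has_density_copulaD[OF hX] has_density_copulaD[OF hY] eq by (intro copula_measure_eqI) auto
    then show "D_norm \<Phi> N M' k d Y = D_norm \<Phi> N M k d X"
      by (simp only: D_norm_eq D_Phi_eq_if_copula_measure_eq[OF hX hY])
  qed
  have a6: ?A6 by (simp add: D_norm_eq D_Phi_strict_mono[OF hX])
  have a7: ?A7
    using X by (simp add: D_norm_eq D_Phi_strict_antimono[OF hX] admissible_def)
  have a3: ?A3
    using N_Phi_inject[OF nonneg order_refl] by (simp add: D_norm_eq N_Phi_0 D_Phi_eq_0_iff[OF hX k])
  have a4: ?A4
  proof (intro impI allI)
    fix e Y
    assume strict: "strictly_convex_on {0<..} \<Phi>"
      and adm: "admissible M (Suc k) (d(k := e)) (append_block k X Y)"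
    let ?d = "d(k := e)" and ?X = "append_block k X Y"
    have h: "has_density_copula M (Suc k) ?d ?X" by (rule admissible_has_density_copula[OF adm])
    have eq: "D_Phi \<Phi> M k ?d ?X = D_Phi \<Phi> M k d X"
      by (rule D_Phi_cong[OF hX]) (auto simp: append_block_def comps_def)
    note D = D_Phi_Suc_ge[OF h, unfolded eq] D_Phi_Suc_eqI[OF h, unfolded eq] D_Phi_Suc_eqD[OF h, unfolded eq]
    have fin: "D_Phi \<Phi> M k d X < \<infinity>" if "Phi_zero \<Phi> + Phi_star_zero \<Phi> < \<infinity> \<or> D_Phi \<Phi> M k d X < \<infinity>"
      using that D_Phi_le[OF hX] by (auto intro: le_less_trans)
    show "D_norm \<Phi> N M (Suc k) ?d ?X \<ge> D_norm \<Phi> N M k d X \<and>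
        (Phi_zero \<Phi> + Phi_star_zero \<Phi> < \<infinity> \<or> D_Phi \<Phi> M k d X < \<infinity> \<longrightarrow>
          (D_norm \<Phi> N M (Suc k) ?d ?X = D_norm \<Phi> N M k d X \<longleftrightarrow> last_block_independent M k ?d ?X)) \<and>
        (last_block_independent M k ?d ?X \<longrightarrow> D_norm \<Phi> N M (Suc k) ?d ?X = D_norm \<Phi> N M k d X)"
      using N_Phi_mono[OF nonneg D(1)] N_Phi_inject[OF D_Phi_nonneg[OF h] nonneg] D(2) D(3)[OF strict] fin
      by (auto simp only: D_norm_eq)
  qed
  have a8: ?A8
  proof (intro allI impI, elim conjE)
    fix Ms :: "nat \<Rightarrow> 'v measure" and Xs cn c m B
    assume seq: "\<forall>n. admissible (Ms n) k d (Xs n) \<and> is_copula_density (Ms n) (comps k d) (Xs n) (cn n)"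
      and c: "is_copula_density M (comps k d) X c" and m: "0 < m"
      and bd: "\<forall>u\<in>space (cube k d). m \<le> c u \<and> c u \<le> B"
      and lim: "uniform_limit (space (cube k d)) cn c sequentially"
    have Xs: "has_density_copula (Ms n) k d (Xs n)" for n
      using seq by (blast intro: admissible_has_density_copula)
    have "(\<lambda>n. D_Phi \<Phi> (Ms n) k d (Xs n)) \<longlonglongrightarrow> D_Phi \<Phi> M k d X"
      by (rule D_Phi_tendsto[OF hX c Xs _ m _ lim]) (use seq bd in auto)
    then show "(\<lambda>n. D_norm \<Phi> N (Ms n) k d (Xs n)) \<longlonglongrightarrow> D_norm \<Phi> N M k d X"
      unfolding D_norm_eq by (intro N_Phi_tendsto D_Phi_nonneg Xs hX)
  qed
  from a1a a1b a2 a5a a5b a6 a7 a3 a4 a8 show ?thesis by blast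
qed

end
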